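(* Let $g_1,g_2$ be unbounded convex mappings defined in $\mathbb{D}$ whose images have angles at infinity $\pi\alpha$ and $\pi\beta$, respectively. (i) If $\alpha+\beta<1$, then $g_1*g_2$ is bounded. (ii) If $\alpha+\beta\ge1$, then $g_1*g_2$ is unbounded and its angle at infinity is at least $\pi(\alpha+\beta-1)$. The angle at infinity of $g_1*g_2$ is equal to $\pi(\alpha+\beta-1)$ if both regions $g_1(\mathbb{D})$ and $g_2(\mathbb{D})$ admit sectors of minimal amplitude containing them.
   Context: Let $\mathbb{D}$ be the open unit disk in $\mathbb{C}$. A convex mapping is a univalent (injective) holomorphic function on $\mathbb{D}$ whose range is a convex set; it is unbounded if its range is an unbounded set. For holomorphic functions $f(z)=\sum_{n\ge0}a_nz^n$ and $g(z)=\sum_{n\ge0}b_nz^n$ in $\mathbb{D}$, the convolution (Hadamard product) is $(f*g)(z)=\sum_{n\ge0}a_nb_nz^n$. By a theorem of Ruscheweyh and Sheil-Small, the convolution of two convex mappings is again a convex mapping. The angle at infinity of an unbounded convex set is the infimum of the (opening) angles of all sectors containing that set, a sector being a planar region bounded by two rays issuing from a common vertex; the angle at infinity of an unbounded convex mapping is that of its image. It takes values in $[0,\pi]$. A convex region $\Omega$ with angle at infinity $\pi\gamma$ admits a sector of minimal amplitude containing it if some sector of opening angle exactly $\pi\gamma$ contains $\Omega$; when $\gamma=0$ this means that $\Omega$ is contained in a parallel strip (a strip being regarded as a sector of angle $0$). *)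

theory Defs
  imports "HOL-Complex_Analysis.Complex_Analysis"
begin

abbreviation unit_disk :: "complex set" where
  "unit_disk \<equiv> ball 0 1"

definition convex_mapping :: "(complex \<Rightarrow> complex) \<Rightarrow> bool" where
  "convex_mapping f \<longleftrightarrow>
     f holomorphic_on unit_disk \<and> inj_on f unit_disk \<and> convex (f ` unit_disk)"

definition hadamard :: "(complex \<Rightarrow> complex) \<Rightarrow> (complex \<Rightarrow> complex) \<Rightarrow> complex \<Rightarrow> complex" where
  "hadamard f g z =
     (\<Sum>n. fps_nth (fps_expansion f 0) n * fps_nth (fps_expansion g 0) n * z ^ n)"

definition open_sector :: "complex \<Rightarrow> real \<Rightarrow> real \<Rightarrow> complex set" where
  "open_sector v \<phi> \<theta> = {v + of_real r * cis t | r t. 0 < r \<and> \<phi> < t \<and> t < \<phi> + \<theta>}"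

definition open_strip :: "complex \<Rightarrow> real \<Rightarrow> real \<Rightarrow> complex set" where
  "open_strip u a b = {z. a < u \<bullet> z \<and> u \<bullet> z < b}"

text \<open>
  A parallel strip counts as a sector of opening angle 0. For the infimum in
  \<open>angle_at_infinity\<close> this only matters for sets containing a whole line: a
  two-sided strip lies in no proper sector of angle less than \<open>\<pi>\<close>, but has angle 0
  at infinity. Taking regions open is immaterial for the open image of a convex mapping.
\<close>

definition sector_of_angle :: "real \<Rightarrow> complex set \<Rightarrow> bool" where
  "sector_of_angle \<theta> S \<longleftrightarrow>
     (0 < \<theta> \<and> \<theta> < 2 * pi \<and> (\<exists>v \<phi>. S = open_sector v \<phi> \<theta>)) \<or>
     (\<theta> = 0 \<and> (\<exists>u a b. u \<noteq> 0 \<and> a < b \<and> S = open_strip u a b))"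

definition angle_at_infinity :: "complex set \<Rightarrow> real" where
  "angle_at_infinity \<Omega> = Inf {\<theta>. \<exists>S. sector_of_angle \<theta> S \<and> \<Omega> \<subseteq> S}"

definition admits_minimal_sector :: "complex set \<Rightarrow> bool" where
  "admits_minimal_sector \<Omega> \<longleftrightarrow>
     (\<exists>S. sector_of_angle (angle_at_infinity \<Omega>) S \<and> \<Omega> \<subseteq> S)"

end

theory Submission imports Defs begin

text \<open>
  Write \<open>h\<close> for the convolution of \<open>g\<^sub>1\<close> and \<open>g\<^sub>2\<close>, and \<open>\<pi>\<alpha>\<close>, \<open>\<pi>\<beta>\<close> for the two angles at infinity. Two
  observations, one from outside and one from inside, carry the proof.

  From outside: if \<open>Re (l * g\<^sub>1)\<close> and \<open>Re (m * g\<^sub>2)\<close> are bounded below on the disk, then so is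
  \<open>Re (l * m * h)\<close>. Indeed an affine image \<open>P\<close> of \<open>l * g\<^sub>1\<close> has \<open>P 0 = 1\<close> and \<open>Re P \<ge> 1/2\<close>, so by the Poisson
  formula the values of \<open>P * g\<^sub>2\<close> (convolution) are averages of values of \<open>g\<^sub>2\<close>. Hence half-planes containing
  the two images multiply to half-planes containing \<open>h(\<D>)\<close> (\<open>hadamard_halfplane\<close>). If the images lie in
  sectors of angles \<open>\<theta>\<close> and \<open>\<eta>\<close>, their four bounding half-planes give four half-planes around \<open>h(\<D>)\<close>
  (\<open>hadamard_in_wedge\<close>). For \<open>\<theta> + \<eta> \<ge> \<pi>\<close> two of them cut out a sector of angle \<open>\<theta> + \<eta> - \<pi>\<close>, which is the upper
  bound for the angle; for \<open>\<theta> + \<eta> < \<pi>\<close> all four together cut out a bounded set (\<open>bounded_of_wedges\<close>). The one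
  degenerate case is that of two strips, where all four half-planes are bounded by parallel lines; there a bounded real part
  makes both coefficient sequences square summable, and Cauchy-Schwarz bounds \<open>h\<close>
  (\<open>hadamard_bounded_of_strips\<close>).

  From inside: the region \<open>g\<^sub>1(\<D>)\<close> is invariant under translations in an arc of directions of length \<open>\<pi>\<alpha>\<close>
  (\<open>recession_arc\<close>). Such translations, pulled back by \<open>g\<^sub>1\<close>, are semigroups of self-maps of the disk
  moving towards a single boundary point. Normalising this point to 1, the Julia-Wolff inequality says that
  \<open>(1 - z)\<^sup>2 g\<^sub>1'(z)\<close> lies in the dual cone of the arc, of angle \<open>\<pi>(1 - \<alpha>)\<close> (\<open>recession_angle_condition\<close>).
  For convex \<open>g\<^sub>2\<close> the quotient \<open>h'/g\<^sub>2'\<close> inherits this cone (\<open>convolution_derivative_halfplane\<close>, an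
  instance of the convolution principle of Ruscheweyh and Sheil-Small), and \<open>(1 - z)\<^sup>2 g\<^sub>2'(z)\<close> lies in a
  cone of angle \<open>\<pi>(1 - \<beta>)\<close>. So \<open>(1 - z)\<^sup>2 h'(z)\<close> lies in a cone of angle \<open>\<pi>(2 - \<alpha> - \<beta>)\<close>, whose dual
  cone \<open>C\<close> has angle \<open>\<pi>(\<alpha> + \<beta> - 1)\<close> (a ray when \<open>\<alpha> + \<beta> = 1\<close>). In the coordinate \<open>\<zeta> = 1/(1 - z)\<close>, in which
  \<open>dh/d\<zeta> = (1 - z)\<^sup>2 h'(z)\<close>, the Harnack inequality shows that a linear functional that is positive at
  some point of \<open>C\<close> grows at least logarithmically along a suitable ray
  (\<open>unbounded_in_direction\<close>). Therefore \<open>h\<close> is unbounded, and every sector containing \<open>h(\<D>)\<close> has angle at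
  least that of \<open>C\<close> (\<open>sector_angle_ge_arc\<close>).
\<close>

section \<open>Circle integrals of absolutely convergent power series\<close>

lemma has_integral_cis_int:
  fixes k :: int
  shows "((\<lambda>t. cis (of_int k * t)) has_integral (if k = 0 then 2 * of_real pi else 0)) {0..2*pi}"
proof (cases "k = 0")
  case True
  then show ?thesis
    using has_integral_const_real[of "1::complex" 0 "2*pi"] by (simp add: scaleR_conv_of_real)
next
  case False
  have "((\<lambda>t. cis (of_int k * t)) has_integral
      (cis (of_int k * (2*pi)) / (\<i> * of_int k) - cis (of_int k * 0) / (\<i> * of_int k))) {0..2*pi}"
  proof (rule fundamental_theorem_of_calculus)
    fix t
    have "((\<lambda>z. exp (\<i> * of_int k * z) / (\<i> * of_int k)) has_field_derivative
        exp (\<i> * of_int k * of_real t)) (at (of_real t))"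
      using False by (auto intro!: derivative_eq_intros)
    from has_vector_derivative_real_field[OF this]
    have "((\<lambda>t. exp (\<i> * of_int k * of_real t) / (\<i> * of_int k)) has_vector_derivative
        exp (\<i> * of_int k * of_real t)) (at t within {0..2*pi})" .
    then show "((\<lambda>t. cis (of_int k * t) / (\<i> * of_int k)) has_vector_derivative cis (of_int k * t))
       (at t within {0..2*pi})"
      by (simp add: cis_conv_exp mult.assoc)
  qed auto
  moreover have "cis (of_int k * (2*pi)) = 1"
    using cis_multiple_2pi[of "of_int k"] by (simp add: mult.commute)
  ultimately show ?thesis using False by simp
qed

lemma has_integral_suminf_uniform:
  fixes f :: "nat \<Rightarrow> real \<Rightarrow> complex"
  assumes cont: "\<And>n. continuous_on {a..b} (f n)"
    and bound: "\<And>n t. t \<in> {a..b} \<Longrightarrow> norm (f n t) \<le> M n" and M: "summable M"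
    and int: "\<And>n. (f n has_integral I n) {a..b}"
  shows "((\<lambda>t. \<Sum>n. f n t) has_integral (\<Sum>n. I n)) {a..b}" and "summable I"
proof -
  have u: "uniform_limit {a..b} (\<lambda>N t. \<Sum>n<N. f n t) (\<lambda>t. \<Sum>n. f n t) sequentially"
    by (rule Weierstrass_m_test) (use bound M in auto)
  obtain J K where J: "\<And>N. ((\<lambda>t. \<Sum>n<N. f n t) has_integral J N) {a..b}"
      and K: "((\<lambda>t. \<Sum>n. f n t) has_integral K) {a..b}" and JK: "J \<longlonglongrightarrow> K"
    by (rule uniform_limit_integral[OF u]) (auto intro!: continuous_intros cont)
  have "J = (\<lambda>N. \<Sum>n<N. I n)"
    using has_integral_unique[OF J has_integral_sum[of "{..<_}"]] int by auto
  with JK have "I sums K" by (simp add: sums_def)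
  with K show "((\<lambda>t. \<Sum>n. f n t) has_integral (\<Sum>n. I n)) {a..b}" "summable I"
    by (auto simp: sums_iff)
qed

text \<open>
  Functions of this kind extend continuously to the closed disk, so that circle integrals can be taken
  on the unit circle itself; holomorphic functions enter through their dilations.
\<close>

definition wiener :: "(nat \<Rightarrow> complex) \<Rightarrow> complex \<Rightarrow> complex" where
  "wiener a z = (\<Sum>n. a n * z ^ n)"

lemma wiener_sums:
  assumes "summable (\<lambda>n. norm (a n))" "norm z \<le> 1"
  shows "(\<lambda>n. a n * z ^ n) sums wiener a z"
proof -
  have "summable (\<lambda>n. a n * z ^ n)"
    by (rule summable_comparison_test'[OF assms(1)])
      (use assms in \<open>simp add: norm_mult norm_power mult_left_le power_le_one\<close>)
  then show ?thesis by (simp add: wiener_def summable_sums)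
qed

lemma continuous_on_wiener:
  assumes "summable (\<lambda>n. norm (a n))"
  shows "continuous_on (cball 0 1) (wiener a)"
proof -
  have "uniform_limit (cball 0 1) (\<lambda>N z. \<Sum>n<N. a n * z ^ n) (\<lambda>z. \<Sum>n. a n * z ^ n) sequentially"
    by (rule Weierstrass_m_test[OF _ assms])
      (simp add: norm_mult norm_power mult_left_le power_le_one)
  then show ?thesis unfolding wiener_def[abs_def]
    by (rule uniform_limit_theorem[rotated]) (auto intro!: always_eventually continuous_intros)
qed

lemma cis_pow_nat: "cis t ^ n = cis (of_int (int n) * t)"
  using Complex.DeMoivre[of t n] by simp

lemma continuous_on_wiener_cis:
  assumes "summable (\<lambda>n. norm (a n))" "continuous_on S u"
  shows "continuous_on S (\<lambda>t. wiener a (cis (u t)))"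
  by (rule continuous_on_compose2[OF continuous_on_wiener[OF assms(1)]])
    (use assms in \<open>auto intro!: continuous_intros\<close>)

lemma norm_wiener_le:
  assumes "summable (\<lambda>n. norm (a n))" "norm z \<le> 1"
  shows "norm (wiener a z) \<le> (\<Sum>n. norm (a n))"
proof -
  have s: "summable (\<lambda>n. norm (a n * z ^ n))"
    by (rule summable_comparison_test'[OF assms(1)])
      (use assms in \<open>simp add: norm_mult norm_power mult_left_le power_le_one\<close>)
  have "norm (wiener a z) \<le> (\<Sum>n. norm (a n * z ^ n))"
    unfolding wiener_def by (rule summable_norm[OF s])
  also have "\<dots> \<le> (\<Sum>n. norm (a n))"
    by (rule suminf_le[OF _ s assms(1)])
      (use assms in \<open>simp add: norm_mult norm_power mult_left_le power_le_one\<close>)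
  finally show ?thesis .
qed

lemma wiener_fourier_coeff:
  fixes k :: int
  assumes "summable (\<lambda>n. norm (a n))"
  shows "((\<lambda>t. wiener a (cis t) * cis (of_int k * t)) has_integral
           (if k \<le> 0 then 2 * of_real pi * a (nat (- k)) else 0)) {0..2*pi}"
proof -
  define I where "I n = a n * (if int n + k = 0 then 2 * of_real pi else 0)" for n
  have "((\<lambda>t. \<Sum>n. a n * cis (of_int (int n + k) * t)) has_integral (\<Sum>n. I n)) {0..2*pi}"
  proof (rule has_integral_suminf_uniform[OF _ _ assms])
    show "((\<lambda>t. a n * cis (of_int (int n + k) * t)) has_integral I n) {0..2*pi}" for n
      unfolding I_def by (intro has_integral_mult_right has_integral_cis_int)
  qed (auto intro!: continuous_intros simp: norm_mult)
  moreover have "(\<Sum>n. a n * cis (of_int (int n + k) * t)) = wiener a (cis t) * cis (of_int k * t)" for t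
  proof -
    have "(\<lambda>n. a n * cis t ^ n * cis (of_int k * t)) sums (wiener a (cis t) * cis (of_int k * t))"
      by (rule sums_mult2[OF wiener_sums[OF assms]]) simp
    then have "(\<lambda>n. a n * cis (of_int (int n + k) * t)) sums (wiener a (cis t) * cis (of_int k * t))"
      by (simp add: cis_pow_nat mult.assoc cis_mult ring_distribs)
    then show ?thesis by (simp add: sums_iff)
  qed
  moreover have "(\<Sum>n. I n) = (if k \<le> 0 then 2 * of_real pi * a (nat (- k)) else 0)"
  proof -
    have "(\<Sum>n. I n) = (\<Sum>n\<in>(if k \<le> 0 then {nat (-k)} else {}). I n)"
      by (rule suminf_finite) (auto simp: I_def split: if_splits)
    then show ?thesis by (auto simp: I_def)
  qed
  ultimately show ?thesis by simp
qed

text \<open>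
  Only the frequency 0 survives integration: with opposite frequencies it collects all products of equal
  index, with equal frequencies only the product of the constant terms.
\<close>

lemma wiener_product_integral:
  assumes a: "summable (\<lambda>n. norm (a n))" and c: "summable (\<lambda>n. norm (c n))"
  shows "((\<lambda>t. wiener a (cis t) * wiener c (cis (- t))) has_integral
           2 * of_real pi * (\<Sum>n. a n * c n)) {0..2*pi}" (is ?A)
    and "((\<lambda>t. wiener a (cis t) * wiener c (cis t)) has_integral
           2 * of_real pi * (a 0 * c 0)) {0..2*pi}" (is ?B)
proof -
  define A where "A = (\<Sum>n. norm (a n))"
  have *: "((\<lambda>t. \<Sum>n. c n * (wiener a (cis t) * cis (of_int (\<sigma> * int n) * t))) has_integral (\<Sum>n. I n)) {0..2*pi}
           \<and> summable I"
    if I: "\<And>n. I n = c n * (if \<sigma> * int n \<le> 0 then 2 * of_real pi * a (nat (- (\<sigma> * int n))) else 0)"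
    for \<sigma> :: int and I
  proof -
    have bd: "norm (c n * (wiener a (cis t) * cis (of_int (\<sigma> * int n) * t))) \<le> norm (c n) * A" for n t
      unfolding A_def norm_mult norm_cis mult_1_right by (intro mult_left_mono norm_wiener_le a) auto
    have sum: "summable (\<lambda>n. norm (c n) * A)"
      by (intro summable_mult2 c)
    have cont: "continuous_on {0..2*pi} (\<lambda>t. c n * (wiener a (cis t) * cis (of_int (\<sigma> * int n) * t)))" for n
      by (intro continuous_intros continuous_on_wiener_cis a)
    have int: "((\<lambda>t. c n * (wiener a (cis t) * cis (of_int (\<sigma> * int n) * t))) has_integral I n) {0..2*pi}" for n
      unfolding I by (intro has_integral_mult_right wiener_fourier_coeff a)
    show ?thesis
      by (intro conjI has_integral_suminf_uniform[OF cont bd sum int])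
  qed
  have sm: "(\<Sum>n. c n * (wiener a (cis t) * cis (of_int (\<sigma> * int n) * t))) = wiener a (cis t) * wiener c (cis (of_int \<sigma> * t))"
    for \<sigma> :: int and t
  proof -
    have "(\<lambda>n. wiener a (cis t) * (c n * cis (of_int \<sigma> * t) ^ n)) sums (wiener a (cis t) * wiener c (cis (of_int \<sigma> * t)))"
      by (rule sums_mult[OF wiener_sums[OF c]]) simp
    then show ?thesis by (simp add: Complex.DeMoivre mult_ac(1,2,3) sums_iff)
  qed
  show ?A
  proof -
    have "((\<lambda>t. wiener a (cis t) * wiener c (cis (of_int (-1) * t))) has_integral
         (\<Sum>n. c n * (2 * of_real pi * a n))) {0..2*pi} \<and> summable (\<lambda>n. c n * (2 * of_real pi * a n))"
      using *[of "\<lambda>n. c n * (2 * of_real pi * a n)" "-1"] unfolding sm by simp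
    moreover have "(\<Sum>n. c n * (2 * of_real pi * a n)) = (\<Sum>n. (2 * of_real pi) * (a n * c n))"
      by (simp add: mult_ac)
    moreover have "summable (\<lambda>n. a n * c n)"
    proof -
      have "summable (\<lambda>n. (2 * of_real pi) * (a n * c n))" using calculation by (simp add: mult_ac)
      then show ?thesis by (subst (asm) summable_cmult_iff) auto
    qed
    ultimately show ?thesis by (simp add: suminf_mult)
  qed
  show ?B
  proof -
    define I where "I n = c n * (if 1 * int n \<le> 0 then 2 * of_real pi * a (nat (- (1 * int n))) else 0)" for n
    have "(\<Sum>n. I n) = (\<Sum>n\<in>{0}. I n)" by (rule suminf_finite) (auto simp: I_def)
    then have "(\<Sum>n. I n) = 2 * of_real pi * (a 0 * c 0)" by (simp add: I_def)
    then show ?thesis using *[of I 1, OF I_def] sm[of _ 1] by simp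
  qed
qed

lemma wiener_cnj:
  assumes "summable (\<lambda>n. norm (a n))" "norm z \<le> 1"
  shows "cnj (wiener a z) = wiener (\<lambda>n. cnj (a n)) (cnj z)"
proof -
  have "(\<lambda>n. cnj (a n * z ^ n)) sums cnj (wiener a z)"
    using wiener_sums[OF assms] by (simp only: sums_cnj)
  moreover have "(\<lambda>n. cnj (a n) * cnj z ^ n) sums wiener (\<lambda>n. cnj (a n)) (cnj z)"
    by (rule wiener_sums) (use assms in auto)
  ultimately show ?thesis by (simp add: sums_iff)
qed

lemma wiener_integral_cnj:
  assumes a: "summable (\<lambda>n. norm (a n))" and c: "summable (\<lambda>n. norm (c n))"
  shows "((\<lambda>t. wiener a (cis t) * cnj (wiener c (cis (- t)))) has_integral
           2 * of_real pi * (a 0 * cnj (c 0))) {0..2*pi}"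
    and "((\<lambda>t. wiener a (cis t) * cnj (wiener c (cis t))) has_integral
           2 * of_real pi * (\<Sum>n. a n * cnj (c n))) {0..2*pi}"
  using wiener_product_integral[OF a, of "\<lambda>n. cnj (c n)"] c
  by (simp_all add: wiener_cnj cis_cnj)

lemma wiener_integral:
  assumes a: "summable (\<lambda>n. norm (a n))"
  shows "((\<lambda>t. wiener a (cis t)) has_integral 2 * of_real pi * a 0) {0..2*pi}"
  using wiener_fourier_coeff[OF a, of 0] by simp

text \<open>
  The Poisson formula in convolution form. By the two product integrals, the coefficient sum is the mean of
  the first function against the weight \<open>2 Re P - 1\<close>: the conjugate of \<open>P\<close> contributes only the
  constant term, which the \<open>- 1\<close> cancels. The weight is nonnegative by hypothesis.
\<close>

lemma hadamard_positivity:
  assumes a: "summable (\<lambda>n. norm (a n))" and p: "summable (\<lambda>n. norm (p n))" and p0: "p 0 = 1"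
    and F: "\<And>z. norm z = 1 \<Longrightarrow> 0 \<le> Re (wiener a z)"
    and P: "\<And>z. norm z = 1 \<Longrightarrow> 1 / 2 \<le> Re (wiener p z)"
  shows "0 \<le> Re (\<Sum>n. a n * p n)"
proof -
  have "((\<lambda>t. wiener a (cis t) * wiener p (cis (- t)) + wiener a (cis t) * cnj (wiener p (cis (- t))) - wiener a (cis t))
      has_integral (2 * of_real pi * (\<Sum>n. a n * p n) + 2 * of_real pi * (a 0 * cnj (p 0)) - 2 * of_real pi * a 0)) {0..2*pi}"
    by (intro has_integral_diff has_integral_add wiener_product_integral(1) wiener_integral_cnj(1) wiener_integral a p)
  then have "((\<lambda>t. wiener a (cis t) * of_real (2 * Re (wiener p (cis (- t))) - 1))
      has_integral (2 * of_real pi * (\<Sum>n. a n * p n))) {0..2*pi}"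
  proof (rule has_integral_eq_rhs[OF has_integral_eq, rotated])
    fix t
    show "wiener a (cis t) * wiener p (cis (- t)) + wiener a (cis t) * cnj (wiener p (cis (- t))) - wiener a (cis t)
      = wiener a (cis t) * of_real (2 * Re (wiener p (cis (- t))) - 1)"
      by (simp add: ring_distribs[symmetric] complex_add_cnj right_diff_distrib)
  qed (simp add: p0)
  from has_integral_linear[OF this bounded_linear_Re]
  have I: "((\<lambda>t. Re (wiener a (cis t)) * (2 * Re (wiener p (cis (- t))) - 1)) has_integral 2 * pi * Re (\<Sum>n. a n * p n)) {0..2*pi}"
    by (simp add: o_def)
  have "0 \<le> 2 * pi * Re (\<Sum>n. a n * p n)"
  proof (rule has_integral_nonneg[OF I])
    fix t
    show "0 \<le> Re (wiener a (cis t)) * (2 * Re (wiener p (cis (- t))) - 1)"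
      using F[of "cis t"] P[of "cis (- t)"] by (intro mult_nonneg_nonneg) (simp_all only: norm_cis, linarith)
  qed
  then show ?thesis using pi_gt_zero by (auto simp: zero_le_mult_iff)
qed

text \<open>
  With vanishing constant term the square of the function has mean 0, hence the mean of the squared real part is
  half of the mean of the squared modulus, and the latter is the sum in question.
\<close>

lemma parseval_real_part_bound:
  assumes a: "summable (\<lambda>n. norm (a n))" and a0: "a 0 = 0"
    and bd: "\<And>z. norm z = 1 \<Longrightarrow> \<bar>Re (wiener a z)\<bar> \<le> M"
  shows "(\<Sum>n<N. (norm (a n))\<^sup>2) \<le> 2 * M\<^sup>2"
proof -
  have "((\<lambda>t. wiener a (cis t) * cnj (wiener a (cis t)) + wiener a (cis t) * wiener a (cis t))
      has_integral (2 * of_real pi * (\<Sum>n. a n * cnj (a n)) + 2 * of_real pi * (a 0 * a 0))) {0..2*pi}"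
    by (intro has_integral_add wiener_product_integral(2) wiener_integral_cnj(2) a)
  from has_integral_linear[OF this bounded_linear_Re]
  have I: "((\<lambda>t. 2 * (Re (wiener a (cis t)))\<^sup>2) has_integral 2 * pi * Re (\<Sum>n. a n * cnj (a n))) {0..2*pi}"
    by (simp add: o_def a0 power2_eq_square)
  have "norm (2 * pi * Re (\<Sum>n. a n * cnj (a n))) \<le> 2 * M\<^sup>2 * measure lborel (cbox 0 (2*pi))"
  proof (rule has_integral_bound[OF _ I[unfolded cbox_interval[symmetric]]])
    fix t
    have "(Re (wiener a (cis t)))\<^sup>2 \<le> M\<^sup>2"
      using power_mono[OF bd[OF norm_cis] abs_ge_zero, where n = 2] by (simp only: power2_abs)
    then show "norm (2 * (Re (wiener a (cis t)))\<^sup>2) \<le> 2 * M\<^sup>2"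
      by simp
  qed simp
  then have "norm (2 * pi * Re (\<Sum>n. a n * cnj (a n))) \<le> 2 * M\<^sup>2 * (2 * pi)"
    by (simp only: cbox_interval content_real) simp
  then have "2 * pi * Re (\<Sum>n. a n * cnj (a n)) \<le> 2 * pi * (2 * M\<^sup>2)"
    unfolding real_norm_def using abs_ge_self order_trans by (fastforce simp only: mult_ac)
  then have le: "Re (\<Sum>n. a n * cnj (a n)) \<le> 2 * M\<^sup>2"
    by (rule mult_left_le_imp_le) simp
  have nz: "(\<lambda>n. norm (a n)) \<longlonglongrightarrow> 0" using a by (rule summable_LIMSEQ_zero)
  have "eventually (\<lambda>n. norm (a n) < 1) sequentially"
    using order_tendstoD(2)[OF nz, of 1] by simp
  then have "eventually (\<lambda>n. norm ((norm (a n))\<^sup>2) \<le> norm (a n)) sequentially"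
    by eventually_elim (simp add: power2_eq_square mult_left_le)
  then have s: "summable (\<lambda>n. (norm (a n))\<^sup>2)"
    by (rule summable_comparison_test_ev[OF _ a])
  have "(\<lambda>n. of_real ((norm (a n))\<^sup>2)) sums (of_real (\<Sum>n. (norm (a n))\<^sup>2) :: complex)"
    using summable_sums[OF s] by (simp only: sums_of_real_iff)
  then have "(\<Sum>n. a n * cnj (a n)) = of_real (\<Sum>n. (norm (a n))\<^sup>2)"
    by (simp add: complex_norm_square sums_iff del: of_real_power)
  with le have "(\<Sum>n. (norm (a n))\<^sup>2) \<le> 2 * M\<^sup>2" by simp
  moreover have "(\<Sum>n<N. (norm (a n))\<^sup>2) \<le> (\<Sum>n. (norm (a n))\<^sup>2)"
    by (rule sum_le_suminf[OF s]) auto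
  ultimately show ?thesis by simp
qed

section \<open>Taylor coefficients and half-planes containing a convolution\<close>

abbreviation tcoeff :: "(complex \<Rightarrow> complex) \<Rightarrow> nat \<Rightarrow> complex" where
  "tcoeff f \<equiv> fps_nth (fps_expansion f 0)"

lemma tcoeff_sums:
  assumes "f holomorphic_on ball 0 R" "norm z < R"
  shows "(\<lambda>n. tcoeff f n * z ^ n) sums f z"
  using holomorphic_power_series[OF assms(1), of z] assms(2) by (simp add: fps_expansion_def)

lemma tcoeff_0 [simp]: "tcoeff f 0 = f 0"
  by (simp add: fps_expansion_def)

lemma tcoeff_1 [simp]: "tcoeff f (Suc 0) = deriv f 0"
  by (simp add: fps_expansion_def)

lemma summable_norm_tcoeff:
  assumes "f holomorphic_on ball 0 R" "norm z < R"
  shows "summable (\<lambda>n. norm (tcoeff f n * z ^ n))"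
proof -
  obtain r where r: "norm z < r" "r < R" using dense[OF assms(2)] by blast
  then have "0 \<le> r" using norm_ge_zero[of z] by linarith
  then have "summable (\<lambda>n. tcoeff f n * of_real r ^ n)"
    using tcoeff_sums[OF assms(1), of "of_real r"] r by (auto simp: sums_iff)
  then show ?thesis
    by (rule powser_insidea) (use r \<open>0 \<le> r\<close> in simp)
qed

lemma tcoeff_unique:
  assumes "0 < R" and sums: "\<And>z. norm z < R \<Longrightarrow> (\<lambda>n. c n * z ^ n) sums f z"
  shows "tcoeff f n = c n"
proof -
  have "eventually (\<lambda>u. u \<in> ball 0 R) (nhds (0::complex))"
    using \<open>0 < R\<close> by (intro eventually_nhds_in_open) auto
  then have "eventually (\<lambda>u. (\<lambda>n. fps_nth (Abs_fps c) n * u ^ n) sums f u) (nhds 0)"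
    by eventually_elim (use sums in simp)
  then have "fps_expansion f 0 = Abs_fps c"
    by (intro fps_expansion_eqI has_fps_expansionI)
  then show ?thesis by simp
qed

lemma hadamard_sums:
  assumes f: "f holomorphic_on unit_disk" and g: "g holomorphic_on unit_disk" and z: "norm z < 1"
  shows "(\<lambda>n. tcoeff f n * tcoeff g n * z ^ n) sums hadamard f g z"
    and "summable (\<lambda>n. norm (tcoeff f n * tcoeff g n * z ^ n))"
proof -
  obtain r where r: "norm z < r" "r < 1" using dense[OF z] by blast
  then have r0: "0 < r" using norm_ge_zero[of z] by linarith
  have zr: "norm (z / of_real r) < 1" using r r0 by (simp add: norm_divide)
  have s1: "summable (\<lambda>n. norm (tcoeff f n * of_real r ^ n))"
    by (rule summable_norm_tcoeff[OF f]) (use r r0 in simp)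
  have s2: "summable (\<lambda>n. norm (tcoeff g n * (z / of_real r) ^ n))"
    by (rule summable_norm_tcoeff[OF g zr])
  have "(\<lambda>n. norm (tcoeff f n * of_real r ^ n)) \<longlonglongrightarrow> 0"
    by (rule summable_LIMSEQ_zero[OF s1])
  from order_tendstoD(2)[OF this, of 1]
  have "eventually (\<lambda>n. norm (tcoeff f n * of_real r ^ n) < 1) sequentially" by simp
  then have "eventually (\<lambda>n. norm (norm (tcoeff f n * tcoeff g n * z ^ n)) \<le> norm (tcoeff g n * (z / of_real r) ^ n)) sequentially"
  proof eventually_elim
    case (elim n)
    have "tcoeff f n * tcoeff g n * z ^ n = (tcoeff f n * of_real r ^ n) * (tcoeff g n * (z / of_real r) ^ n)"
      using r0 by (simp add: power_divide)
    then have "norm (tcoeff f n * tcoeff g n * z ^ n) =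
        norm (tcoeff f n * of_real r ^ n) * norm (tcoeff g n * (z / of_real r) ^ n)"
      by (simp only: norm_mult)
    also have "\<dots> \<le> 1 * norm (tcoeff g n * (z / of_real r) ^ n)"
      by (intro mult_right_mono) (use elim in auto)
    finally show ?case by simp
  qed
  then show s: "summable (\<lambda>n. norm (tcoeff f n * tcoeff g n * z ^ n))"
    by (rule summable_comparison_test_ev[OF _ s2])
  show "(\<lambda>n. tcoeff f n * tcoeff g n * z ^ n) sums hadamard f g z"
    using summable_sums[OF summable_norm_cancel[OF s]] by (simp add: hadamard_def)
qed

lemma hadamard_holomorphic:
  assumes f: "f holomorphic_on unit_disk" and g: "g holomorphic_on unit_disk"
  shows "hadamard f g holomorphic_on unit_disk"
  by (rule power_series_holomorphic[where a = "\<lambda>n. tcoeff f n * tcoeff g n"])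
    (use hadamard_sums(1)[OF f g] in \<open>simp add: dist_norm\<close>)

lemma tcoeff_hadamard:
  assumes f: "f holomorphic_on unit_disk" and g: "g holomorphic_on unit_disk"
  shows "tcoeff (hadamard f g) n = tcoeff f n * tcoeff g n"
  by (rule tcoeff_unique[of 1]) (use hadamard_sums(1)[OF f g] in auto)

lemma wiener_dilate:
  assumes "f holomorphic_on unit_disk" "norm r < 1" "norm z \<le> 1"
  shows "wiener (\<lambda>n. tcoeff f n * r ^ n) z = f (r * z)"
proof -
  have "norm (r * z) < 1"
    using assms(2,3) mult_left_le[of "norm z" "norm r"] by (auto simp: norm_mult)
  from tcoeff_sums[OF assms(1) this] show ?thesis
    by (simp add: wiener_def sums_iff power_mult_distrib mult.assoc)
qed

lemma wiener_shift_const: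
  assumes a: "summable (\<lambda>n. norm (a n))" and z: "norm z \<le> 1"
  shows "summable (\<lambda>n. norm (k * a n + (if n = 0 then c else 0)))"
    and "wiener (\<lambda>n. k * a n + (if n = 0 then c else 0)) z = k * wiener a z + c"
proof -
  have "summable (\<lambda>n. norm k * norm (a n) + norm (if n = 0 then c else 0))"
    by (intro summable_add summable_mult a summable_finite[of "{0}"]) auto
  then show "summable (\<lambda>n. norm (k * a n + (if n = 0 then c else 0)))"
    by (rule summable_comparison_test'[of _ 0])
      (use norm_triangle_ineq[of "k * a _"] in \<open>simp add: norm_mult del: norm_triangle_ineq\<close>)
  have "(\<lambda>n. k * (a n * z ^ n) + (if n = 0 then c else 0)) sums (k * wiener a z + c)"
    using sums_add[OF sums_mult[OF wiener_sums[OF a z], of k] sums_single[of 0 "\<lambda>_. c"]] by simp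
  moreover have "(\<lambda>n. k * (a n * z ^ n) + (if n = 0 then c else 0)) =
      (\<lambda>n. (k * a n + (if n = 0 then c else 0)) * z ^ n)"
    by (auto simp: algebra_simps)
  ultimately show "wiener (\<lambda>n. k * a n + (if n = 0 then c else 0)) z = k * wiener a z + c"
    by (simp add: wiener_def sums_iff)
qed

text \<open>
  The quotient \<open>P = 1 + (l * f - l * f 0) / (2 * \<kappa>)\<close> has real part at least 1/2 once \<open>\<kappa>\<close> is at least the
  distance of \<open>l * f 0\<close> from the bounding line, and convolving with such a \<open>P\<close> keeps \<open>m * g\<close> in its
  half-plane by positivity. This convolution is an affine image of \<open>l * m * hadamard f g\<close>.
\<close>

proposition hadamard_halfplane:
  assumes f: "f holomorphic_on unit_disk" and g: "g holomorphic_on unit_disk"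
    and lf: "\<And>z. z \<in> unit_disk \<Longrightarrow> c \<le> Re (l * f z)"
    and mg: "\<And>z. z \<in> unit_disk \<Longrightarrow> d \<le> Re (m * g z)"
  shows "\<exists>k. \<forall>z\<in>unit_disk. k \<le> Re (l * m * hadamard f g z)"
proof -
  \<comment> \<open>The added 1 keeps \<kappa> positive, since c may be attained.\<close>
  define \<kappa> where "\<kappa> = Re (l * f 0) - c + 1"
  have \<kappa>: "0 < \<kappa>" using lf[of 0] by (simp add: \<kappa>_def)
  have "Re (l * m * f 0 * g 0) - 2 * \<kappa> * (Re (m * g 0) - d) \<le> Re (l * m * hadamard f g z)"
    if z: "z \<in> unit_disk" for z
  proof -
    have z1: "norm z < 1" using z by simp
    obtain r where r: "norm z < r" "r < 1" using dense[OF z1] by blast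
    then have r0: "0 < r" using norm_ge_zero[of z] by linarith
    have zr: "norm (z / of_real r) < 1" using r r0 by (simp add: norm_divide)
    have nr: "norm (complex_of_real r) < 1" using r r0 by simp
    define A where "A n = m * (tcoeff g n * (z / of_real r) ^ n) + (if n = 0 then - of_real d else 0)" for n
    define p where "p n = l / of_real (2 * \<kappa>) * (tcoeff f n * of_real r ^ n)
        + (if n = 0 then 1 - l / of_real (2 * \<kappa>) * f 0 else 0)" for n
    note sg = summable_norm_tcoeff[OF g zr] and sf = summable_norm_tcoeff[OF f nr]
    have "0 \<le> Re (\<Sum>n. A n * p n)"
    proof (rule hadamard_positivity)
      show "summable (\<lambda>n. norm (A n))" "summable (\<lambda>n. norm (p n))"
        unfolding A_def p_def by (rule wiener_shift_const[OF sg, of 0] wiener_shift_const[OF sf, of 0]; simp)+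
      show "p 0 = 1" by (simp add: p_def)
    next
      fix x :: complex assume x: "norm x = 1"
      have "norm (z / of_real r * x) < 1" using zr x by (simp add: norm_mult norm_divide)
      from mg[of "z / of_real r * x"] this
      show "0 \<le> Re (wiener A x)"
        unfolding A_def using x by (subst wiener_shift_const(2)[OF sg]) (simp_all only: wiener_dilate[OF g zr], auto)
      have "norm (of_real r * x) < 1" using nr x by (simp add: norm_mult)
      from lf[of "of_real r * x"] this have "c \<le> Re (l * f (of_real r * x))" by simp
      then have "- \<kappa> \<le> Re (l * f (of_real r * x)) - Re (l * f 0)" by (simp add: \<kappa>_def)
      then have "- (1/2) \<le> (Re (l * f (of_real r * x)) - Re (l * f 0)) / (2 * \<kappa>)"
        using \<kappa> by (simp add: field_simps)
      also have "\<dots> = Re ((l * f (of_real r * x) - l * f 0) / of_real (2 * \<kappa>))"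
        by (simp only: Re_divide_of_real minus_complex.sel)
      finally have "1 / 2 \<le> Re ((l * f (of_real r * x) - l * f 0) / of_real (2 * \<kappa>)) + 1" by linarith
      also have "\<dots> = Re (wiener p x)"
        unfolding p_def using x
        by (subst wiener_shift_const(2)[OF sf]) (simp_all add: wiener_dilate[OF f nr] diff_divide_distrib)
      finally show "1 / 2 \<le> Re (wiener p x)" .
    qed
    also have "(\<Sum>n. A n * p n) = l * m / of_real (2 * \<kappa>) * (hadamard f g z - f 0 * g 0) + (m * g 0 - of_real d)"
    proof -
      have "(\<lambda>n. l * m / of_real (2 * \<kappa>) * (tcoeff f n * tcoeff g n * z ^ n)
              + (if n = 0 then m * g 0 - of_real d - l * m / of_real (2 * \<kappa>) * (f 0 * g 0) else 0))
          sums (l * m / of_real (2 * \<kappa>) * hadamard f g z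
              + (m * g 0 - of_real d - l * m / of_real (2 * \<kappa>) * (f 0 * g 0)))"
        by (intro sums_add sums_mult hadamard_sums(1)[OF f g z1])
          (use sums_single[of 0 "\<lambda>_. m * g 0 - of_real d - l * m / of_real (2 * \<kappa>) * (f 0 * g 0)"] in simp)
      moreover have "A n * p n = l * m / of_real (2 * \<kappa>) * (tcoeff f n * tcoeff g n * z ^ n)
              + (if n = 0 then m * g 0 - of_real d - l * m / of_real (2 * \<kappa>) * (f 0 * g 0) else 0)" for n
        using r0 by (cases "n = 0") (simp_all add: A_def p_def power_divide)
      ultimately show ?thesis by (simp add: sums_iff right_diff_distrib)
    qed
    finally have "0 \<le> Re (l * m * (hadamard f g z - f 0 * g 0) / of_real (2 * \<kappa>) + (m * g 0 - of_real d))"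
      by simp
    also have "\<dots> = (Re (l * m * hadamard f g z) - Re (l * m * f 0 * g 0)) / (2 * \<kappa>) + (Re (m * g 0) - d)"
      by (simp only: plus_complex.sel Re_divide_of_real right_diff_distrib minus_complex.sel Re_complex_of_real mult.assoc)
    finally show ?thesis using \<kappa> by (simp add: field_simps)
  qed
  then show ?thesis by blast
qed

text \<open>
  Parseval on the circles of radius \<open>r\<close>, then \<open>r \<longrightarrow> 1\<close>.
\<close>

lemma strip_coeff_square_sum:
  assumes f: "f holomorphic_on unit_disk" and l: "l \<noteq> 0"
    and bd: "\<And>z. z \<in> unit_disk \<Longrightarrow> \<bar>Re (l * f z)\<bar> \<le> M"
  shows "\<exists>K. \<forall>N. (\<Sum>n<N. (norm (tcoeff f n))\<^sup>2) \<le> K"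
proof (intro exI allI)
  fix N
  define e where "e n = (if n = 0 then 0 else norm (tcoeff f n))" for n
  have r: "(\<Sum>n<N. (norm l * e n * r ^ n)\<^sup>2) \<le> 2 * (2 * M)\<^sup>2" if "0 < r" "r < 1" for r :: real
  proof -
    have nr: "norm (complex_of_real r) < 1" using that by simp
    note sf = summable_norm_tcoeff[OF f nr]
    define a where "a n = l * (tcoeff f n * of_real r ^ n) + (if n = 0 then - (l * f 0) else 0)" for n
    have "(\<Sum>n<N. (norm (a n))\<^sup>2) \<le> 2 * (2 * M)\<^sup>2"
    proof (rule parseval_real_part_bound)
      show "summable (\<lambda>n. norm (a n))"
        unfolding a_def by (rule wiener_shift_const[OF sf, of 0]) simp
      show "a 0 = 0" by (simp add: a_def)
      fix x :: complex assume x: "norm x = 1"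
      have "norm (of_real r * x) < 1" using nr x by (simp add: norm_mult)
      then have "\<bar>Re (l * f (of_real r * x))\<bar> \<le> M" "\<bar>Re (l * f 0)\<bar> \<le> M"
        using bd[of "of_real r * x"] bd[of 0] by auto
      moreover have "Re (wiener a x) = Re (l * f (of_real r * x)) - Re (l * f 0)"
        unfolding a_def using x
        by (subst wiener_shift_const(2)[OF sf]) (simp_all add: wiener_dilate[OF f nr])
      ultimately show "\<bar>Re (wiener a x)\<bar> \<le> 2 * M" by linarith
    qed
    moreover have "norm (a n) = norm l * e n * r ^ n" for n
      using that by (simp add: a_def e_def norm_mult norm_power)
    ultimately show ?thesis by simp
  qed
  have "((\<lambda>r. \<Sum>n<N. (norm l * e n * r ^ n)\<^sup>2) \<longlongrightarrow> (\<Sum>n<N. (norm l * e n * 1 ^ n)\<^sup>2)) (at_left (1::real))"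
    by (intro tendsto_intros)
  moreover have "eventually (\<lambda>r. (\<Sum>n<N. (norm l * e n * r ^ n)\<^sup>2) \<le> 2 * (2 * M)\<^sup>2) (at_left (1::real))"
    using r by (intro eventually_at_leftI[of 0]) auto
  ultimately have "(\<Sum>n<N. (norm l * e n * 1 ^ n)\<^sup>2) \<le> 2 * (2 * M)\<^sup>2"
    by (rule tendsto_upperbound) simp
  then have "(norm l)\<^sup>2 * (\<Sum>n<N. (e n)\<^sup>2) \<le> 8 * M\<^sup>2"
    by (simp add: power_mult_distrib sum_distrib_left)
  then have "(\<Sum>n<N. (e n)\<^sup>2) \<le> 8 * M\<^sup>2 / (norm l)\<^sup>2"
    using l by (simp add: pos_le_divide_eq mult.commute)
  moreover have "(\<Sum>n<N. (norm (tcoeff f n))\<^sup>2) \<le> (\<Sum>n<N. (e n)\<^sup>2 + (if n = 0 then (norm (f 0))\<^sup>2 else 0))"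
    by (rule sum_mono) (simp add: e_def)
  moreover have "(\<Sum>n<N. if n = 0 then (norm (f 0))\<^sup>2 else 0) \<le> (norm (f 0))\<^sup>2"
    by (simp add: sum.delta)
  ultimately show "(\<Sum>n<N. (norm (tcoeff f n))\<^sup>2) \<le> 8 * M\<^sup>2 / (norm l)\<^sup>2 + (norm (f 0))\<^sup>2"
    by (simp add: sum.distrib)
qed

lemma hadamard_bounded_of_strips:
  assumes f: "f holomorphic_on unit_disk" and l: "l \<noteq> 0"
    and lf: "\<And>z. z \<in> unit_disk \<Longrightarrow> \<bar>Re (l * f z)\<bar> \<le> M"
    and g: "g holomorphic_on unit_disk" and m: "m \<noteq> 0"
    and mg: "\<And>z. z \<in> unit_disk \<Longrightarrow> \<bar>Re (m * g z)\<bar> \<le> M'"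
  shows "bounded (hadamard f g ` unit_disk)"
proof -
  obtain K where K: "\<And>N. (\<Sum>n<N. (norm (tcoeff f n))\<^sup>2) \<le> K"
    using strip_coeff_square_sum[OF f l lf] by blast
  obtain L where L: "\<And>N. (\<Sum>n<N. (norm (tcoeff g n))\<^sup>2) \<le> L"
    using strip_coeff_square_sum[OF g m mg] by blast
  have "norm (hadamard f g z) \<le> K + L" if z: "norm z < 1" for z
  proof -
    have "(\<lambda>N. norm (\<Sum>n<N. tcoeff f n * tcoeff g n * z ^ n)) \<longlonglongrightarrow> norm (hadamard f g z)"
      using hadamard_sums(1)[OF f g z] unfolding sums_def by (rule tendsto_norm)
    moreover have "norm (\<Sum>n<N. tcoeff f n * tcoeff g n * z ^ n) \<le> K + L" for N
    proof -
      have "norm (\<Sum>n<N. tcoeff f n * tcoeff g n * z ^ n) \<le>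
          (\<Sum>n<N. (norm (tcoeff f n))\<^sup>2 + (norm (tcoeff g n))\<^sup>2)"
      proof (rule sum_norm_le)
        fix n
        have "norm (tcoeff f n * tcoeff g n * z ^ n) \<le> norm (tcoeff f n) * norm (tcoeff g n)"
          using z by (simp add: norm_mult norm_power mult_left_le power_le_one)
        also have "\<dots> \<le> (norm (tcoeff f n))\<^sup>2 + (norm (tcoeff g n))\<^sup>2"
          using sum_squares_bound[of "norm (tcoeff f n)" "norm (tcoeff g n)"]
            mult_nonneg_nonneg[OF norm_ge_zero norm_ge_zero, of "tcoeff f n" "tcoeff g n"] by linarith
        finally show "norm (tcoeff f n * tcoeff g n * z ^ n) \<le> (norm (tcoeff f n))\<^sup>2 + (norm (tcoeff g n))\<^sup>2" .
      qed
      also have "\<dots> \<le> K + L" using K[of N] L[of N] by (simp add: sum.distrib)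
      finally show ?thesis .
    qed
    ultimately show ?thesis by (intro tendsto_upperbound[of _ _ sequentially]) auto
  qed
  then show ?thesis by (auto intro!: boundedI)
qed

section \<open>Sectors, strips and wedges\<close>

text \<open>
  The two half-planes bounding a sector of angle \<open>\<theta>\<close> with first side in direction \<open>\<phi>\<close>. Their intersection
  is a sector for \<open>0 < \<theta> < \<pi>\<close> but a strip for \<open>\<theta> = 0\<close>, so that the predicate treats sectors and strips alike.
\<close>

definition in_wedge :: "complex set \<Rightarrow> real \<Rightarrow> real \<Rightarrow> bool" where
  "in_wedge \<Omega> \<phi> \<theta> \<longleftrightarrow>
     (\<exists>c d. \<forall>z\<in>\<Omega>. c \<le> Im (cis (- \<phi>) * z) \<and> Im (cis (- \<phi> - \<theta>) * z) \<le> d)"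

text \<open>
  A sector of angle at most \<open>\<pi>\<close> lies on one side of each of the lines through its two sides.
\<close>

lemma sector_imp_in_wedge:
  assumes S: "sector_of_angle \<theta> S" and sub: "\<Omega> \<subseteq> S" and \<theta>: "\<theta> \<le> pi"
  shows "\<exists>\<phi>. in_wedge \<Omega> \<phi> \<theta>"
  using S unfolding sector_of_angle_def
proof (elim disjE conjE exE)
  fix v \<phi> assume th: "0 < \<theta>" and S: "S = open_sector v \<phi> \<theta>"
  have "Im (cis (- \<phi>) * v) \<le> Im (cis (- \<phi>) * z) \<and> Im (cis (- \<phi> - \<theta>) * z) \<le> Im (cis (- \<phi> - \<theta>) * v)"
    if "z \<in> \<Omega>" for z
  proof -
    obtain r t where z: "z = v + of_real r * cis t" and r: "0 < r" and t: "\<phi> < t" "t < \<phi> + \<theta>"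
      using \<open>z \<in> \<Omega>\<close> sub unfolding S open_sector_def by auto
    have e: "Im (cis (- s) * z) = Im (cis (- s) * v) + r * sin (t - s)" for s
    proof -
      have "cis (- s) * z = cis (- s) * v + of_real r * (cis (- s) * cis t)"
        unfolding z by (simp add: algebra_simps)
      also have "cis (- s) * cis t = cis (t - s)" by (simp add: cis_mult)
      finally show ?thesis by simp
    qed
    have "0 \<le> r * sin (t - \<phi>)"
      using r t \<theta> by (intro mult_nonneg_nonneg sin_ge_zero) auto
    moreover have "0 \<le> r * sin (\<phi> + \<theta> - t)"
      using r t \<theta> by (intro mult_nonneg_nonneg sin_ge_zero) auto
    then have "r * sin (t - (\<phi> + \<theta>)) \<le> 0"
      using sin_minus[of "\<phi> + \<theta> - t"] by simp
    ultimately show ?thesis using e[of \<phi>] e[of "\<phi> + \<theta>"] by simp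
  qed
  then show ?thesis unfolding in_wedge_def by blast
next
  fix u a b assume th: "\<theta> = 0" and u: "u \<noteq> 0" and S: "S = open_strip u a b"
  \<comment> \<open>The side of the strip is perpendicular to u.\<close>
  define \<phi> where "\<phi> = Arg u - pi / 2"
  have c: "cis (- \<phi>) = \<i> * cis (- Arg u)"
    unfolding cis_pi_half[symmetric] cis_mult by (simp add: \<phi>_def)
  have e: "Im (cis (- \<phi>) * z) = (u \<bullet> z) / norm u" for z
  proof -
    have "cnj u = of_real (norm u) * cis (- Arg u)"
      by (metis complex_cnj_complex_of_real complex_cnj_mult cis_cnj rcis_cmod_Arg rcis_def)
    moreover have "u \<bullet> z = Re (cnj u * z)" by (simp add: inner_complex_def)
    ultimately have "u \<bullet> z = Re (of_real (norm u) * (cis (- Arg u) * z))"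
      by (simp only: mult.assoc)
    then show ?thesis using u unfolding c by simp
  qed
  have "a / norm u \<le> Im (cis (- \<phi>) * z) \<and> Im (cis (- \<phi>) * z) \<le> b / norm u" if "z \<in> \<Omega>" for z
    using that sub u unfolding e S open_strip_def by (auto intro!: divide_right_mono)
  then show ?thesis unfolding in_wedge_def th by auto
qed

lemma Arg_decomp: "z = of_real (norm z) * cis (Arg z)"
  using rcis_cmod_Arg[of z] by (simp add: rcis_def)

text \<open>
  For \<open>0 < \<theta> < \<pi>\<close> the vertex is the intersection of two lines moved outwards by 1, which makes the
  inequalities strict. For \<open>\<theta> = \<pi>\<close> the lines are parallel and any point of the first one serves.
\<close>

lemma in_wedge_imp_sector:
  assumes W: "in_wedge \<Omega> \<phi> \<theta>" and \<theta>: "0 \<le> \<theta>" "\<theta> \<le> pi"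
  shows "\<exists>S. sector_of_angle \<theta> S \<and> \<Omega> \<subseteq> S"
proof -
  obtain c d where cd: "\<And>z. z \<in> \<Omega> \<Longrightarrow> c \<le> Im (cis (- \<phi>) * z)" "\<And>z. z \<in> \<Omega> \<Longrightarrow> Im (cis (- \<phi> - \<theta>) * z) \<le> d"
    using W unfolding in_wedge_def by blast
  show ?thesis
  proof (cases "\<theta> = 0")
    case True
    define u where "u = \<i> * cis \<phi>"
    have e: "u \<bullet> z = Im (cis (- \<phi>) * z)" for z
      by (simp add: u_def inner_complex_def)
    have "\<Omega> \<subseteq> open_strip u (c - 1) (max c d + 1)"
      using cd unfolding open_strip_def e True by fastforce
    moreover have "sector_of_angle \<theta> (open_strip u (c - 1) (max c d + 1))"
      unfolding sector_of_angle_def using True by (intro disjI2 conjI exI[of _ u] exI[of _ "c - 1"] exI[of _ "max c d + 1"]) (auto simp: u_def)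
    ultimately show ?thesis by blast
  next
    case False
    then have th: "0 < \<theta>" using \<theta> by simp
    define y where "y = c - 1"
    define x where "x = (if \<theta> = pi then 0 else (y * cos \<theta> - d - 1) / sin \<theta>)"
    define v where "v = cis \<phi> * Complex x y"
    have v: "cis (- \<phi> - s) * v = cis (- s) * Complex x y" for s
      unfolding v_def by (simp add: cis_mult mult.assoc[symmetric])
    have "z \<in> open_sector v \<phi> \<theta>" if z: "z \<in> \<Omega>" for z
    proof -
      define k where "k = Arg (cis (- \<phi>) * (z - v))"
      define r where "r = norm (z - v)"
      have zv: "cis (- \<phi>) * (z - v) = of_real r * cis k"
        using Arg_decomp[of "cis (- \<phi>) * (z - v)"] by (simp add: k_def r_def norm_mult)
      have zv2: "cis (- \<phi> - s) * (z - v) = of_real r * cis (k - s)" for s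
      proof -
        have "cis (- \<phi> - s) * (z - v) = cis (- s) * (cis (- \<phi>) * (z - v))"
          by (simp only: mult.assoc[symmetric] cis_mult) (simp add: add.commute)
        then show ?thesis unfolding zv by (simp add: cis_mult mult.left_commute)
      qed
      have "Im (cis (- \<phi>) * v) = y" using v[of 0] by simp
      then have "1 \<le> Im (cis (- \<phi>) * (z - v))"
        using cd(1)[OF z] by (simp add: y_def right_diff_distrib del: minus_mult_left)
      then have p1: "0 < r * sin k" unfolding zv by simp
      have r0: "0 < r" using p1 by (cases "r = 0") (auto simp: r_def)
      have k: "- pi < k" "k \<le> pi" using Arg_bounded[of "cis (- \<phi>) * (z - v)"] by (auto simp: k_def)
      have sk: "0 < sin k" using p1 r0 by (simp add: zero_less_mult_iff)
      have k0: "0 < k"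
      proof (rule ccontr)
        assume "\<not> 0 < k"
        then have "0 \<le> sin (- k)" using k by (intro sin_ge_zero) auto
        then show False using sk by simp
      qed
      have kpi: "k < pi" using sk k by (cases "k = pi") auto
      have "k < \<theta>"
      proof (cases "\<theta> = pi")
        case True then show ?thesis using kpi by simp
      next
        case False
        then have thp: "\<theta> < pi" using \<theta> by simp
        then have s: "0 < sin \<theta>" using th by (intro sin_gt_zero)
        have "Im (cis (- \<phi> - \<theta>) * v) = y * cos \<theta> - x * sin \<theta>"
          unfolding v by simp
        also have "\<dots> = d + 1" using False s by (simp add: x_def)
        finally have "Im (cis (- \<phi> - \<theta>) * (z - v)) \<le> - 1"
          using cd(2)[OF z] by (simp only: right_diff_distrib minus_complex.sel)
        then have "r * sin (k - \<theta>) < 0" unfolding zv2 by simp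
        then have sk2: "sin (k - \<theta>) < 0" using r0 by (simp add: mult_less_0_iff)
        show ?thesis
        proof (rule ccontr)
          assume "\<not> k < \<theta>"
          then have "0 \<le> sin (k - \<theta>)" using kpi th by (intro sin_ge_zero) auto
          then show False using sk2 by simp
        qed
      qed
      moreover have "z = v + of_real r * cis (\<phi> + k)"
      proof -
        have "z - v = cis \<phi> * (cis (- \<phi>) * (z - v))" by (simp add: mult.assoc[symmetric] cis_mult)
        also have "\<dots> = of_real r * cis (\<phi> + k)" unfolding zv by (simp add: cis_mult mult.left_commute)
        finally show ?thesis by (simp add: algebra_simps)
      qed
      ultimately show ?thesis unfolding open_sector_def using r0 k0 by fastforce
    qed
    moreover have "sector_of_angle \<theta> (open_sector v \<phi> \<theta>)"
      unfolding sector_of_angle_def using th \<theta> pi_gt_zero by (intro disjI1) auto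
    ultimately show ?thesis by blast
  qed
qed

lemma angle_set_bdd_below: "bdd_below {\<theta>. \<exists>S. sector_of_angle \<theta> S \<and> \<Omega> \<subseteq> S}"
  by (rule bdd_belowI[of _ 0]) (auto simp: sector_of_angle_def)

lemma angle_at_infinity_le:
  assumes "sector_of_angle \<theta> S" "\<Omega> \<subseteq> S"
  shows "angle_at_infinity \<Omega> \<le> \<theta>"
  unfolding angle_at_infinity_def by (rule cInf_lower[OF _ angle_set_bdd_below]) (use assms in blast)

lemma angle_at_infinity_le_wedge:
  assumes "in_wedge \<Omega> \<phi> \<theta>" "0 \<le> \<theta>" "\<theta> \<le> pi"
  shows "angle_at_infinity \<Omega> \<le> \<theta>"
  using in_wedge_imp_sector[OF assms] angle_at_infinity_le by blast

text \<open>
  The same condition in the form to which \<open>hadamard_halfplane\<close> applies.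
\<close>

lemma in_wedge_Re:
  "in_wedge \<Omega> \<phi> \<theta> \<longleftrightarrow>
     (\<exists>c. \<forall>z\<in>\<Omega>. c \<le> Re (- \<i> * cis (- \<phi>) * z)) \<and> (\<exists>c. \<forall>z\<in>\<Omega>. c \<le> Re (\<i> * cis (- \<phi> - \<theta>) * z))"
proof -
  have 1: "Re (- \<i> * w * z) = Im (w * z)" "Re (\<i> * w * z) = - Im (w * z)" for w z
    by (simp_all add: mult.assoc)
  have 2: "(\<exists>c. \<forall>z\<in>\<Omega>. c \<le> - f z) \<longleftrightarrow> (\<exists>d. \<forall>z\<in>\<Omega>. f z \<le> d)" for f :: "complex \<Rightarrow> real"
    using le_minus_iff by (metis minus_minus)
  show ?thesis unfolding in_wedge_def 1 2
    by blast
qed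

text \<open>
  The products of the four normals, paired in two ways: first with first and second with second side, then
  crosswise. For \<open>\<theta> + \<eta> < \<pi>\<close> the first wedge has a negative parameter and is then just a pair of half-planes.
\<close>

lemma hadamard_in_wedge:
  assumes f: "f holomorphic_on unit_disk" and g: "g holomorphic_on unit_disk"
    and wf: "in_wedge (f ` unit_disk) \<phi> \<theta>" and wg: "in_wedge (g ` unit_disk) \<psi> \<eta>"
  shows "in_wedge (hadamard f g ` unit_disk) (\<phi> + \<psi> + pi / 2) (\<theta> + \<eta> - pi)"
    and "in_wedge (hadamard f g ` unit_disk) (\<phi> + \<psi> + \<theta> - pi / 2) (\<eta> - \<theta> + pi)"
proof -
  define P where "P l \<longleftrightarrow> (\<exists>k. \<forall>z\<in>hadamard f g ` unit_disk. k \<le> Re (l * z))" for l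
  have *: "P (l * m)" if "\<exists>c. \<forall>z\<in>f ` unit_disk. c \<le> Re (l * z)" "\<exists>c. \<forall>z\<in>g ` unit_disk. c \<le> Re (m * z)" for l m
  proof -
    obtain c d where "\<And>z. z \<in> unit_disk \<Longrightarrow> c \<le> Re (l * f z)" "\<And>z. z \<in> unit_disk \<Longrightarrow> d \<le> Re (m * g z)"
      using \<open>\<exists>c. \<forall>z\<in>f ` unit_disk. c \<le> Re (l * z)\<close> \<open>\<exists>c. \<forall>z\<in>g ` unit_disk. c \<le> Re (m * z)\<close> by blast
    from hadamard_halfplane[OF f g this] show ?thesis unfolding P_def by blast
  qed
  note wf' = wf[unfolded in_wedge_Re] and wg' = wg[unfolded in_wedge_Re]
  have i: "\<i> = cis (pi / 2)" "- \<i> = cis (- (pi / 2))" by simp_all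
  have e: "P (cis s)" if "P (cis t)" "s = t \<or> s = t + 2 * pi \<or> s = t - 2 * pi" for s t
    using that cis_mult[of t "2*pi"] cis_divide[of t "2*pi"] by auto
  note s = i cis_mult
  note r = *[OF conjunct1[OF wf'] conjunct1[OF wg'], unfolded i(2), unfolded s]
    *[OF conjunct2[OF wf'] conjunct2[OF wg'], unfolded i(2), unfolded s]
    *[OF conjunct1[OF wf'] conjunct2[OF wg'], unfolded i(2), unfolded s]
    *[OF conjunct2[OF wf'] conjunct1[OF wg'], unfolded i(2), unfolded s]
  show "in_wedge (hadamard f g ` unit_disk) (\<phi> + \<psi> + pi / 2) (\<theta> + \<eta> - pi)"
    unfolding in_wedge_Re P_def[symmetric] unfolding i(2) unfolding s
    by (intro conjI e[OF r(1)] e[OF r(2)]) (simp_all add: field_simps)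
  show "in_wedge (hadamard f g ` unit_disk) (\<phi> + \<psi> + \<theta> - pi / 2) (\<eta> - \<theta> + pi)"
    unfolding in_wedge_Re P_def[symmetric] unfolding i(2) unfolding s
    by (intro conjI e[OF r(4)] e[OF r(3)]) (simp_all add: field_simps)
qed

lemma bounded_complex_of_two_directions:
  assumes s: "sin (b - a) \<noteq> 0"
    and a: "\<And>z. z \<in> \<Omega> \<Longrightarrow> \<bar>Im (cis a * z)\<bar> \<le> A" and b: "\<And>z. z \<in> \<Omega> \<Longrightarrow> \<bar>Im (cis b * z)\<bar> \<le> B"
  shows "bounded \<Omega>"
proof (rule boundedI)
  fix z assume z: "z \<in> \<Omega>"
  have "z * of_real (sin (b - a)) = of_real (Im (cis b * z)) * cis (- a) - of_real (Im (cis a * z)) * cis (- b)"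
  proof (rule complex_eqI)
    show "Re (z * of_real (sin (b - a))) = Re (of_real (Im (cis b * z)) * cis (- a) - of_real (Im (cis a * z)) * cis (- b))"
      by (simp add: sin_diff algebra_simps)
    show "Im (z * of_real (sin (b - a))) = Im (of_real (Im (cis b * z)) * cis (- a) - of_real (Im (cis a * z)) * cis (- b))"
      by (simp add: sin_diff algebra_simps)
  qed
  then have "norm (z * of_real (sin (b - a))) \<le> \<bar>Im (cis b * z)\<bar> + \<bar>Im (cis a * z)\<bar>"
    using norm_triangle_ineq4[of "of_real (Im (cis b * z)) * cis (- a)" "of_real (Im (cis a * z)) * cis (- b)"]
    by (simp only: norm_mult norm_of_real norm_cis mult_1_right)
  also have "\<dots> \<le> A + B" using a[OF z] b[OF z] by linarith
  finally show "norm z \<le> (A + B) / \<bar>sin (b - a)\<bar>"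
    using s by (simp add: norm_mult pos_le_divide_eq)
qed

text \<open>
  Let \<open>e s\<close> be the linear functional in direction \<open>s\<close>. The wedges bound \<open>e 0\<close> and \<open>e (\<theta> + \<eta>)\<close> above, \<open>e \<theta>\<close> and
  \<open>e \<eta>\<close> below. The identity \<open>sin \<theta> * e (\<theta> + \<eta>) + sin \<eta> * e 0 = sin (\<theta> + \<eta>) * e \<theta>\<close>, whose sines are
  nonnegative and whose right one is positive, turns these into bounds on both sides for two independent functionals.
\<close>

lemma bounded_of_wedges:
  assumes w1: "in_wedge \<Omega> (\<phi> + pi / 2) (\<theta> + \<eta> - pi)" and w2: "in_wedge \<Omega> (\<phi> + \<theta> - pi / 2) (\<eta> - \<theta> + pi)"
    and \<theta>: "0 \<le> \<theta>" and \<eta>: "0 \<le> \<eta>" and le: "\<theta> + \<eta> < pi" and nz: "\<theta> \<noteq> 0 \<or> \<eta> \<noteq> 0"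
  shows "bounded \<Omega>"
proof -
  define e where "e s z = Re (cis (- s - \<phi>) * z)" for s z
  have eq: "Im (cis (- (\<phi> + pi / 2)) * z) = - e 0 z"
    "Im (cis (- (\<phi> + pi / 2) - (\<theta> + \<eta> - pi)) * z) = e (\<theta> + \<eta>) z"
    "Im (cis (- (\<phi> + \<theta> - pi / 2)) * z) = e \<theta> z"
    "Im (cis (- (\<phi> + \<theta> - pi / 2) - (\<eta> - \<theta> + pi)) * z) = - e \<eta> z" for z
  proof -
    have c: "cis (- (\<phi> + pi / 2)) = - \<i> * cis (- 0 - \<phi>)"
      "cis (- (\<phi> + pi / 2) - (\<theta> + \<eta> - pi)) = \<i> * cis (- (\<theta> + \<eta>) - \<phi>)"
      "cis (- (\<phi> + \<theta> - pi / 2)) = \<i> * cis (- \<theta> - \<phi>)"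
      "cis (- (\<phi> + \<theta> - pi / 2) - (\<eta> - \<theta> + pi)) = - \<i> * cis (- \<eta> - \<phi>)"
      unfolding cis_minus_pi_half[symmetric] unfolding cis_pi_half[symmetric] cis_mult
      by (rule arg_cong[of _ _ cis], simp add: field_simps)+
    show "Im (cis (- (\<phi> + pi / 2)) * z) = - e 0 z"
      "Im (cis (- (\<phi> + pi / 2) - (\<theta> + \<eta> - pi)) * z) = e (\<theta> + \<eta>) z"
      "Im (cis (- (\<phi> + \<theta> - pi / 2)) * z) = e \<theta> z"
      "Im (cis (- (\<phi> + \<theta> - pi / 2) - (\<eta> - \<theta> + pi)) * z) = - e \<eta> z"
      unfolding c e_def by (simp_all add: mult.assoc)
  qed
  obtain A B where AB: "\<And>z. z \<in> \<Omega> \<Longrightarrow> A \<le> - e 0 z \<and> e (\<theta> + \<eta>) z \<le> B"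
    using w1 unfolding in_wedge_def eq by blast
  obtain C D where CD: "\<And>z. z \<in> \<Omega> \<Longrightarrow> C \<le> e \<theta> z \<and> - e \<eta> z \<le> D"
    using w2 unfolding in_wedge_def eq by blast
  define M where "M = \<bar>A\<bar> + \<bar>B\<bar> + \<bar>C\<bar> + \<bar>D\<bar>"
  have M: "e 0 z \<le> M" "e (\<theta> + \<eta>) z \<le> M" "- M \<le> e \<theta> z" "- M \<le> e \<eta> z" if "z \<in> \<Omega>" for z
    using AB[OF that] CD[OF that] unfolding M_def by linarith+
  have M0: "0 \<le> M" by (simp add: M_def)
  have rel: "sin \<theta> * e (\<theta> + \<eta>) z + sin \<eta> * e 0 z = sin (\<theta> + \<eta>) * e \<theta> z"
    "sin \<eta> * e (\<theta> + \<eta>) z + sin \<theta> * e 0 z = sin (\<theta> + \<eta>) * e \<eta> z" for z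
  proof -
    define w where "w = cis (- \<phi>) * z"
    have e: "e s z = cos s * Re w + sin s * Im w" for s
    proof -
      have "cis (- s - \<phi>) * z = cis (- s) * w"
        unfolding w_def by (simp only: mult.assoc[symmetric] cis_mult) simp
      then show ?thesis by (simp add: e_def)
    qed
    have q: "(sin \<theta>)\<^sup>2 = 1 - (cos \<theta>)\<^sup>2" "(sin \<eta>)\<^sup>2 = 1 - (cos \<eta>)\<^sup>2" by (simp_all add: sin_squared_eq)
    show "sin \<theta> * e (\<theta> + \<eta>) z + sin \<eta> * e 0 z = sin (\<theta> + \<eta>) * e \<theta> z"
      "sin \<eta> * e (\<theta> + \<eta>) z + sin \<theta> * e 0 z = sin (\<theta> + \<eta>) * e \<eta> z"
      unfolding e sin_add cos_add using q by (simp_all, algebra+)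
  qed
  have sp: "0 < sin (\<theta> + \<eta>)" using \<theta> \<eta> le nz by (intro sin_gt_zero) auto
  have s0: "0 \<le> sin \<theta>" "0 \<le> sin \<eta>" using \<theta> \<eta> le by (auto intro!: sin_ge_zero)
  \<comment> \<open>The roles of \<theta> and \<eta> are symmetric; x is one of them that does not vanish.\<close>
  have main: "bounded \<Omega>" if snz: "0 < sin x" and sy: "0 \<le> sin y"
    and rel: "\<And>z. sin x * e (x + y) z + sin y * e 0 z = sin (x + y) * e x z"
    and M: "\<And>z. z \<in> \<Omega> \<Longrightarrow> e 0 z \<le> M" "\<And>z. z \<in> \<Omega> \<Longrightarrow> e (x + y) z \<le> M"
      "\<And>z. z \<in> \<Omega> \<Longrightarrow> - M \<le> e x z" "\<And>z. z \<in> \<Omega> \<Longrightarrow> - M \<le> e y z"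
      and sp: "0 < sin (x + y)" and yz: "y = 0 \<or> 0 < sin y" for x y
  proof -
    have xb: "\<bar>e x z\<bar> \<le> M + (sin x + sin y) * M / sin (x + y)" if z: "z \<in> \<Omega>" for z
    proof -
      have "sin (x + y) * e x z \<le> sin x * M + sin y * M"
        unfolding rel[symmetric] by (intro add_mono mult_left_mono M z less_imp_le[OF snz] sy)
      then have "e x z \<le> (sin x + sin y) * M / sin (x + y)"
        using sp by (simp add: pos_le_divide_eq ring_distribs mult.commute)
      moreover have "0 \<le> (sin x + sin y) * M / sin (x + y)"
        using M0 sp snz sy by (intro divide_nonneg_nonneg mult_nonneg_nonneg) auto
      ultimately show ?thesis using M(3)[OF z] M0 by linarith
    qed
    obtain s K where s: "sin (x - s) \<noteq> 0" and K: "\<And>z. z \<in> \<Omega> \<Longrightarrow> \<bar>e s z\<bar> \<le> K"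
    proof (cases "y = 0")
      case True
      then have "sin (x - 0) \<noteq> 0" "\<And>z. z \<in> \<Omega> \<Longrightarrow> \<bar>e 0 z\<bar> \<le> M" using snz M(1,4) by (fastforce simp: abs_le_iff)+
      then show thesis by (rule that)
    next
      case False
      then have y: "0 < sin y" using yz by simp
      have "\<bar>e 0 z\<bar> \<le> M + (sin x + sin (x + y)) * M / sin y" if z: "z \<in> \<Omega>" for z
      proof -
        have "sin x * e (x + y) z \<le> sin x * M" "sin (x + y) * (- M) \<le> sin (x + y) * e x z"
          by (intro mult_left_mono M z less_imp_le[OF snz] less_imp_le[OF sp])+
        then have "- (sin x * M + sin (x + y) * M) \<le> sin y * e 0 z" using rel[of z] by simp
        then have "- ((sin x + sin (x + y)) * M / sin y) \<le> e 0 z"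
          using y by (simp add: minus_divide_left pos_divide_le_eq ring_distribs mult.commute)
        moreover have "0 \<le> (sin x + sin (x + y)) * M / sin y"
          using M0 sp snz y by (intro divide_nonneg_nonneg mult_nonneg_nonneg) auto
        ultimately show ?thesis using M(1)[OF z] M0 by linarith
      qed
      moreover have "sin (x - 0) \<noteq> 0" using snz by simp
      ultimately show thesis by (rule that[rotated])
    qed
    have E: "e t z = Im (cis (pi / 2 - t - \<phi>) * z)" for t z
    proof -
      have "cis (pi / 2 - t - \<phi>) = \<i> * cis (- t - \<phi>)"
        unfolding cis_pi_half[symmetric] cis_mult by (rule arg_cong[of _ _ cis]) simp
      then show ?thesis by (simp add: e_def mult.assoc)
    qed
    show ?thesis
    proof (rule bounded_complex_of_two_directions)
      show "sin ((pi / 2 - s - \<phi>) - (pi / 2 - x - \<phi>)) \<noteq> 0" using s by simp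
      show "\<bar>Im (cis (pi / 2 - x - \<phi>) * z)\<bar> \<le> M + (sin x + sin y) * M / sin (x + y)" if "z \<in> \<Omega>" for z
        unfolding E[symmetric] by (rule xb[OF that])
      show "\<bar>Im (cis (pi / 2 - s - \<phi>) * z)\<bar> \<le> K" if "z \<in> \<Omega>" for z
        unfolding E[symmetric] by (rule K[OF that])
    qed
  qed
  have nz0: "\<theta> = 0 \<or> 0 < sin \<theta>" "\<eta> = 0 \<or> 0 < sin \<eta>"
    using \<theta> \<eta> le by (auto intro!: sin_gt_zero)
  show ?thesis
  proof (cases "\<theta> = 0")
    case False
    show ?thesis by (rule main[of \<theta> \<eta>]) (use False nz0 s0 rel M sp in auto)
  next
    case True
    show ?thesis by (rule main[of \<eta> \<theta>]) (use True nz nz0 s0 rel M sp in \<open>auto simp: add.commute\<close>)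
  qed
qed

section \<open>Recession directions of a convex region\<close>

definition recedes :: "complex set \<Rightarrow> complex \<Rightarrow> bool" where
  "recedes \<Omega> w \<longleftrightarrow> (\<forall>p\<in>\<Omega>. \<forall>t\<ge>0. p + of_real t * w \<in> \<Omega>)"

lemma recedes_0 [simp]: "recedes \<Omega> 0"
  by (simp add: recedes_def)

lemma recedes_scale: "recedes \<Omega> w \<Longrightarrow> 0 \<le> t \<Longrightarrow> recedes \<Omega> (of_real t * w)"
  unfolding recedes_def by (metis (no_types, opaque_lifting) mult.assoc mult_nonneg_nonneg of_real_mult)

lemma recedes_add: "recedes \<Omega> v \<Longrightarrow> recedes \<Omega> w \<Longrightarrow> recedes \<Omega> (v + w)"
  unfolding recedes_def by (metis add.assoc distrib_left)

lemma recedesD: "recedes \<Omega> w \<Longrightarrow> p \<in> \<Omega> \<Longrightarrow> p + w \<in> \<Omega>"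
  unfolding recedes_def by (metis mult_1 of_real_1 zero_le_one)

text \<open>
  Near a limit direction the error can be absorbed into the starting point, because the region is open.
\<close>

lemma closed_recedes:
  assumes "open \<Omega>"
  shows "closed {w. recedes \<Omega> w}"
  unfolding closed_sequential_limits
proof (intro allI impI, elim conjE)
  fix x l assume x: "\<forall>n. x n \<in> {w. recedes \<Omega> w}" and lim: "x \<longlonglongrightarrow> l"
  show "l \<in> {w. recedes \<Omega> w}"
    unfolding recedes_def
  proof (safe)
    fix p and t :: real assume p: "p \<in> \<Omega>" and t: "0 \<le> t"
    have "(\<lambda>n. p + of_real t * (l - x n)) \<longlonglongrightarrow> p + of_real t * (l - l)"
      by (intro tendsto_intros lim)
    then have "eventually (\<lambda>n. p + of_real t * (l - x n) \<in> \<Omega>) sequentially"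
      by (rule topological_tendstoD) (use assms p in auto)
    then obtain n where "p + of_real t * (l - x n) \<in> \<Omega>"
      using eventually_happens'[OF sequentially_bot] by blast
    then have "p + of_real t * (l - x n) + of_real t * x n \<in> \<Omega>"
      using x t unfolding recedes_def by simp
    then show "p + of_real t * l \<in> \<Omega>" by (simp add: algebra_simps)
  qed
qed

text \<open>
  A point that leaves the region would be separated from it by a functional bounded on the region, against which
  the direction would have to be strictly increasing, because the region is open.
\<close>

lemma recedes_if_polar:
  assumes op: "open \<Omega>" and cv: "convex \<Omega>"
    and polar: "\<And>u c. u \<noteq> 0 \<Longrightarrow> (\<And>z. z \<in> \<Omega> \<Longrightarrow> u \<bullet> z \<le> c) \<Longrightarrow> u \<bullet> w \<le> 0"
  shows "recedes \<Omega> w"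
  unfolding recedes_def
proof (intro ballI allI impI, rule ccontr)
  fix p and t :: real assume p: "p \<in> \<Omega>" and t: "0 \<le> t" and n: "p + of_real t * w \<notin> \<Omega>"
  obtain u b where u: "u \<noteq> 0" and le: "\<And>x. x \<in> \<Omega> \<Longrightarrow> u \<bullet> x \<le> b" and ge: "b \<le> u \<bullet> (p + of_real t * w)"
    using separating_hyperplane_sets[of \<Omega> "{p + of_real t * w}"] cv p n by auto
  obtain e where e: "0 < e" "ball p e \<subseteq> \<Omega>" using op p openE by blast
  define x where "x = p + (e / (2 * norm u)) *\<^sub>R u"
  have "x \<in> ball p e" using u e by (simp add: x_def dist_norm)
  then have "u \<bullet> x \<le> b" using le e by blast
  also have "b \<le> u \<bullet> p + t * (u \<bullet> w)"
    using ge by (simp add: inner_add_right flip: scaleR_conv_of_real)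
  also have "\<dots> \<le> u \<bullet> p" using polar[OF u le] t by (simp add: mult_nonneg_nonpos)
  finally have "(e / (2 * norm u)) * (u \<bullet> u) \<le> 0" by (simp add: x_def inner_add_right)
  moreover have "0 < (e / (2 * norm u)) * (u \<bullet> u)" using u e by simp
  ultimately show False by simp
qed

text \<open>
  A limit of the directions of points going to infinity.
\<close>

lemma unbounded_asymptotic_direction:
  assumes "\<not> bounded (\<Omega> :: complex set)"
  obtains w where "norm w = 1" "\<And>u c. (\<And>z. z \<in> \<Omega> \<Longrightarrow> u \<bullet> z \<le> c) \<Longrightarrow> u \<bullet> w \<le> 0"
proof -
  have "\<forall>n. \<exists>x\<in>\<Omega>. real n + 1 < norm x"
    using assms unfolding bounded_iff by (meson not_le)
  then obtain x where x: "\<And>n. x n \<in> \<Omega>" "\<And>n. real n + 1 < norm (x n)" by metis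
  have "\<forall>n. sgn (x n) \<in> sphere 0 1"
  proof
    fix n show "sgn (x n) \<in> sphere 0 1" using x(2)[of n] by (auto simp: norm_sgn)
  qed
  then obtain w r where w: "w \<in> sphere 0 1" and r: "strict_mono r" and lim: "((\<lambda>n. sgn (x n)) \<circ> r) \<longlonglongrightarrow> w"
    using compact_sphere[of "0::complex" 1] unfolding compact_eq_seq_compact_metric seq_compact_def by metis
  have "u \<bullet> w \<le> 0" if c: "\<And>z. z \<in> \<Omega> \<Longrightarrow> u \<bullet> z \<le> c" for u c
  proof -
    have l1: "(\<lambda>n. u \<bullet> sgn (x (r n))) \<longlonglongrightarrow> u \<bullet> w"
      using lim by (intro tendsto_intros) (simp add: o_def)
    have l2: "(\<lambda>n. \<bar>c\<bar> / real (Suc n)) \<longlonglongrightarrow> 0"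
      using tendsto_mult_right_zero[OF LIMSEQ_inverse_real_of_nat, of "\<bar>c\<bar>"] by (simp add: divide_inverse)
    have "u \<bullet> sgn (x (r n)) \<le> \<bar>c\<bar> / real (Suc n)" for n
    proof -
      have big: "real (Suc n) < norm (x (r n))"
        using x(2)[of "r n"] seq_suble[OF r, of n] by simp
      have "u \<bullet> sgn (x (r n)) = (u \<bullet> x (r n)) / norm (x (r n))"
        by (simp add: sgn_div_norm divide_inverse)
      also have "\<dots> \<le> \<bar>c\<bar> / norm (x (r n))"
        using c[OF x(1), of "r n"] by (intro divide_right_mono) auto
      also have "\<dots> \<le> \<bar>c\<bar> / real (Suc n)"
      proof (intro divide_left_mono mult_pos_pos)
        show "0 < real (Suc n)" by simp
        then show "0 < norm (x (r n))" using big by linarith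
      qed (use big in auto)
      finally show ?thesis .
    qed
    then show ?thesis by (intro LIMSEQ_le[OF l1 l2]) auto
  qed
  then show thesis using that w by auto
qed

lemma inner_cis: "cis s \<bullet> z = Re (cis (- s) * z)" "cis s \<bullet> cis t = cos (t - s)"
  by (simp_all add: inner_complex_def cos_diff)

text \<open>
  Let \<open>w = cis \<omega>\<close> be an asymptotic direction. A functional that is bounded above on the region has its
  normal in the half-plane opposite to \<open>w\<close>, so it is encoded by its angle \<open>t\<close> from \<open>-w\<close>, with \<open>|t| \<le> \<pi>/2\<close>; let \<open>T\<close>
  be the set of these angles. Two of them, \<open>t1 \<le> t2\<close>, cut out a sector of angle \<open>\<pi> - (t2 - t1)\<close> around
  the region, so \<open>t2 - t1 \<le> \<pi> - \<pi>\<alpha>\<close>: the set \<open>T\<close> lies in an interval of that length. Every direction that makes an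
  angle of at least \<open>\<pi>/2\<close> with all normals from this interval is a recession direction, and these directions
  form an arc of length \<open>\<pi>\<alpha>\<close>.
\<close>

proposition recession_arc:
  assumes op: "open \<Omega>" and cv: "convex \<Omega>" and unb: "\<not> bounded \<Omega>" and nU: "\<Omega> \<noteq> UNIV"
    and ang: "angle_at_infinity \<Omega> = pi * \<alpha>"
  shows "0 \<le> \<alpha>" and "\<alpha> \<le> 1" and "\<exists>\<phi>. in_wedge \<Omega> \<phi> pi"
    and "\<exists>a. \<forall>s\<in>{a..a + pi * \<alpha>}. recedes \<Omega> (cis s)"
proof -
  obtain w where w1: "norm w = 1" and w: "\<And>u c. (\<And>z. z \<in> \<Omega> \<Longrightarrow> u \<bullet> z \<le> c) \<Longrightarrow> u \<bullet> w \<le> 0"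
    using unbounded_asymptotic_direction[OF unb] by blast
  define \<omega> where "\<omega> = Arg w"
  have w\<omega>: "w = cis \<omega>" using Arg_decomp[of w] w1 by (simp add: \<omega>_def)
  define T where "T = {t \<in> {- pi / 2..pi / 2}. \<exists>c. \<forall>z\<in>\<Omega>. c \<le> Re (cis (- \<omega> - t) * z)}"
  have TI: "\<exists>t\<in>T. u = - of_real (norm u) * cis (\<omega> + t)" if u: "u \<noteq> 0" and c: "\<And>z. z \<in> \<Omega> \<Longrightarrow> u \<bullet> z \<le> c" for u c
  proof -
    define t where "t = Arg (- u * cis (- \<omega>))"
    have "- u * cis (- \<omega>) = of_real (norm u) * cis t"
      using Arg_decomp[of "- u * cis (- \<omega>)"] by (simp add: t_def norm_mult)
    then have "- u * cis (- \<omega>) * cis \<omega> = of_real (norm u) * cis t * cis \<omega>" by simp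
    then have ut: "u = - of_real (norm u) * cis (\<omega> + t)"
      by (simp add: mult.assoc cis_mult add.commute minus_equation_iff[of u])
    have uz: "u \<bullet> z = - norm u * Re (cis (- \<omega> - t) * z)" for z
    proof -
      have "u \<bullet> z = - norm u * (cis (\<omega> + t) \<bullet> z)"
        by (subst ut) (simp flip: scaleR_conv_of_real)
      then show ?thesis unfolding inner_cis by simp
    qed
    have "u \<bullet> w \<le> 0" by (rule w[OF c])
    then have "0 \<le> norm u * cos t" unfolding uz w\<omega> by (simp add: cis_mult)
    then have ct: "0 \<le> cos t" using u by (simp add: zero_le_mult_iff)
    have tb: "- pi < t" "t \<le> pi" using Arg_bounded[of "- u * cis (- \<omega>)"] by (auto simp: t_def)
    have "\<bar>t\<bar> \<le> pi / 2"
    proof (rule ccontr)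
      assume "\<not> \<bar>t\<bar> \<le> pi / 2"
      then have "cos \<bar>t\<bar> < cos (pi / 2)" using tb by (intro cos_monotone_0_pi) auto
      then show False using ct by simp
    qed
    moreover have "- c / norm u \<le> Re (cis (- \<omega> - t) * z)" if "z \<in> \<Omega>" for z
      using c[OF that] u unfolding uz by (simp add: field_simps)
    ultimately have "t \<in> T" unfolding T_def by (auto simp: abs_le_iff)
    then show ?thesis using ut by blast
  qed
  have wedge: "in_wedge \<Omega> (\<omega> + t2 - pi / 2) (pi - (t2 - t1))" if "t1 \<in> T" "t2 \<in> T" for t1 t2
  proof -
    have c: "- \<i> * cis (- (\<omega> + t2 - pi / 2)) = cis (- \<omega> - t2)"
      "\<i> * cis (- (\<omega> + t2 - pi / 2) - (pi - (t2 - t1))) = cis (- \<omega> - t1)"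
      unfolding cis_minus_pi_half[symmetric] unfolding cis_pi_half[symmetric] cis_mult
      by (rule arg_cong[of _ _ cis], simp add: field_simps)+
    show ?thesis unfolding in_wedge_Re c using that by (simp add: T_def)
  qed
  obtain p q where p: "p \<in> \<Omega>" and q: "q \<notin> \<Omega>" using unb nU by (metis UNIV_eq_I bounded_empty ex_in_conv)
  obtain t0 where t0: "t0 \<in> T"
  proof -
    obtain u c where "u \<noteq> 0" "\<And>z. z \<in> \<Omega> \<Longrightarrow> u \<bullet> z \<le> c"
      using separating_hyperplane_sets[of \<Omega> "{q}"] cv p q by auto
    from TI[OF this] show thesis using that by blast
  qed
  show "\<exists>\<phi>. in_wedge \<Omega> \<phi> pi" using wedge[OF t0 t0] by auto
  then obtain \<phi> where \<phi>: "in_wedge \<Omega> \<phi> pi" by blast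
  obtain S0 where S0: "sector_of_angle pi S0" "\<Omega> \<subseteq> S0"
    using in_wedge_imp_sector[OF \<phi>] by auto
  have "pi * \<alpha> \<le> pi" unfolding ang[symmetric] by (rule angle_at_infinity_le[OF S0])
  then show a1: "\<alpha> \<le> 1" by simp
  have "0 \<le> angle_at_infinity \<Omega>"
    unfolding angle_at_infinity_def
  proof (rule cInf_greatest)
    show "{\<theta>. \<exists>S. sector_of_angle \<theta> S \<and> \<Omega> \<subseteq> S} \<noteq> {}" using S0 by blast
  qed (auto simp: sector_of_angle_def)
  then show a0: "0 \<le> \<alpha>" unfolding ang using pi_gt_zero by (auto simp: zero_le_mult_iff)
  have width: "t2 - t1 \<le> pi - pi * \<alpha>" if "t1 \<in> T" "t2 \<in> T" "t1 \<le> t2" for t1 t2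
  proof -
    have "0 \<le> pi - (t2 - t1)" "pi - (t2 - t1) \<le> pi" using that by (auto simp: T_def)
    from angle_at_infinity_le_wedge[OF wedge[OF that(1,2)] this] show ?thesis unfolding ang by linarith
  qed
  have bdd: "bdd_below T" by (rule bdd_belowI[of _ "- pi / 2"]) (simp add: T_def)
  define b where "b = Inf T"
  have b: "b \<le> t" "t \<le> b + pi - pi * \<alpha>" if t: "t \<in> T" for t
  proof -
    show "b \<le> t" unfolding b_def by (rule cInf_lower[OF t bdd])
    have "t - (pi - pi * \<alpha>) \<le> Inf T"
    proof (rule cInf_greatest)
      fix s assume s: "s \<in> T"
      have "pi * \<alpha> \<le> pi" using a1 by simp
      then show "t - (pi - pi * \<alpha>) \<le> s" using width[OF s t] by (cases "s \<le> t") linarith+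
    qed (use t in auto)
    then show "t \<le> b + pi - pi * \<alpha>" by (simp add: b_def)
  qed
  show "\<exists>a. \<forall>s\<in>{a..a + pi * \<alpha>}. recedes \<Omega> (cis s)"
  proof (intro exI[of _ "\<omega> + b + pi / 2 - pi * \<alpha>"] ballI recedes_if_polar op cv)
    fix s u c assume s: "s \<in> {\<omega> + b + pi / 2 - pi * \<alpha>..\<omega> + b + pi / 2 - pi * \<alpha> + pi * \<alpha>}"
      and u: "u \<noteq> 0" and c: "\<And>z. z \<in> \<Omega> \<Longrightarrow> u \<bullet> z \<le> c"
    obtain t where t: "t \<in> T" and ut: "u = - of_real (norm u) * cis (\<omega> + t)" using TI[OF u c] by blast
    have "u \<bullet> cis s = - norm u * (cis (\<omega> + t) \<bullet> cis s)"
      by (subst ut) (simp flip: scaleR_conv_of_real)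
    also have "\<dots> = - norm u * cos (s - (\<omega> + t))" by (simp only: inner_cis(2))
    also have "\<dots> \<le> 0"
    proof -
      have "0 \<le> cos (s - (\<omega> + t))"
        using s b[OF t] by (intro cos_ge_zero) auto
      then show ?thesis by (simp add: mult_nonneg_nonneg)
    qed
    finally show "u \<bullet> cis s \<le> 0" .
  qed
qed

section \<open>Convex mappings\<close>

lemma convex_mapping_facts:
  assumes "convex_mapping g"
  shows "g holomorphic_on unit_disk" "inj_on g unit_disk" "open (g ` unit_disk)" "convex (g ` unit_disk)"
    "\<And>z. z \<in> unit_disk \<Longrightarrow> deriv g z \<noteq> 0"
  using assms unfolding convex_mapping_def
  by (auto intro: open_mapping_thm3 dest: holomorphic_injective_imp_regular)

lemma convex_mapping_inverse:
  assumes "convex_mapping g"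
  obtains k where "k holomorphic_on g ` unit_disk" "\<And>z. z \<in> unit_disk \<Longrightarrow> k (g z) = z"
    "\<And>z. z \<in> unit_disk \<Longrightarrow> (k has_field_derivative (1 / deriv g z)) (at (g z))"
    "\<And>v. v \<in> g ` unit_disk \<Longrightarrow> k v \<in> unit_disk \<and> g (k v) = v"
proof -
  note g = convex_mapping_facts[OF assms]
  obtain k where k: "k holomorphic_on g ` unit_disk"
      and d: "\<And>z. z \<in> unit_disk \<Longrightarrow> deriv g z * deriv k (g z) = 1"
      and kg: "\<And>z. z \<in> unit_disk \<Longrightarrow> k (g z) = z"
    using holomorphic_has_inverse[OF g(1) open_ball g(2)] by metis
  have "(k has_field_derivative (1 / deriv g z)) (at (g z))" if z: "z \<in> unit_disk" for z
  proof -
    have "(k has_field_derivative deriv k (g z)) (at (g z))"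
      by (rule holomorphic_derivI[OF k g(3)]) (use z in auto)
    moreover have "deriv k (g z) = 1 / deriv g z" using d[OF z] g(5)[OF z] by (simp add: field_simps)
    ultimately show ?thesis by simp
  qed
  moreover have "k v \<in> unit_disk \<and> g (k v) = v" if "v \<in> g ` unit_disk" for v
    using that kg by auto
  ultimately show thesis using that[OF k kg] by blast
qed

text \<open>
  The inverse of a mapping onto the plane would be a bounded entire function.
\<close>

lemma convex_mapping_not_onto:
  assumes "convex_mapping g"
  shows "g ` unit_disk \<noteq> UNIV"
proof
  assume U: "g ` unit_disk = UNIV"
  obtain k where k: "k holomorphic_on g ` unit_disk" and kg: "\<And>z. z \<in> unit_disk \<Longrightarrow> k (g z) = z"
    and kv: "\<And>v. v \<in> g ` unit_disk \<Longrightarrow> k v \<in> unit_disk \<and> g (k v) = v"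
    using convex_mapping_inverse[OF assms] by metis
  have "bounded (range k)"
    by (rule bounded_subset[of unit_disk]) (use kv U in auto)
  then obtain c where "\<And>v. k v = c"
    using Liouville_theorem[of k] k U unfolding constant_on_def by auto
  then show False using kg[of 0] kg[of "1/2"] by simp
qed

lemma Re_derivative_nonneg:
  assumes D: "(k has_field_derivative D) (at 0)" and e: "0 < e"
    and ge: "\<And>t::real. 0 < t \<Longrightarrow> t < e \<Longrightarrow> Re (k 0) \<le> Re (k (of_real t))"
  shows "0 \<le> Re D"
proof (rule ccontr)
  assume neg: "\<not> 0 \<le> Re D"
  have "((\<lambda>t. k (of_real t)) has_vector_derivative D) (at (0::real))"
    by (rule has_vector_derivative_real_field) (use D in simp)
  from bounded_linear.has_vector_derivative[OF bounded_linear_Re this]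
  have "((\<lambda>t. Re (k (of_real t))) has_real_derivative Re D) (at (0::real))"
    by (simp add: has_real_derivative_iff_has_vector_derivative)
  from DERIV_neg_dec_right[OF this] neg obtain d where d: "0 < d"
      and dec: "\<And>h. 0 < h \<Longrightarrow> h < d \<Longrightarrow> Re (k (of_real h)) < Re (k 0)" by auto
  define h where "h = min d e / 2"
  have "0 < h" "h < d" "h < e" using d e by (auto simp: h_def)
  then show False using dec[of h] ge[of h] by simp
qed

text \<open>
  Geometrically, the image of a disk about the origin is convex, and \<open>z * deriv g z\<close> is the outward normal at
  \<open>g z\<close> of the image of the circle through \<open>z\<close>. The point \<open>om t y\<close> divides the segment from \<open>g y\<close> to
  \<open>g (x * y)\<close>, pulled back to the disk. For fixed \<open>t\<close> it is a self-map of the disk fixing 0, so \<open>|om t z| \<le> |z|\<close> by the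
  Schwarz lemma, with equality at \<open>t = 0\<close>; the derivative at \<open>t = 0\<close> gives the claim.
\<close>

lemma convex_mapping_subdisk:
  assumes g: "convex_mapping g" and z: "norm z < 1" "z \<noteq> 0" and x: "norm x \<le> 1"
  shows "0 \<le> Re ((g z - g (x * z)) / (z * deriv g z))"
proof -
  note gf = convex_mapping_facts[OF g]
  obtain k where k: "k holomorphic_on g ` unit_disk" and kg: "\<And>z. z \<in> unit_disk \<Longrightarrow> k (g z) = z"
    and dk: "\<And>z. z \<in> unit_disk \<Longrightarrow> (k has_field_derivative (1 / deriv g z)) (at (g z))"
    and kv: "\<And>v. v \<in> g ` unit_disk \<Longrightarrow> k v \<in> unit_disk \<and> g (k v) = v"
    using convex_mapping_inverse[OF g] by metis
  have xz: "norm (x * y) < 1" if "norm y < 1" for y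
    using that x mult_left_le[of "norm y" "norm x"] mult_right_mono[OF x, of "norm y"] by (simp add: norm_mult)
  define om where "om s y = k (g y + s * (g (x * y) - g y))" for s y
  have mem: "g y + of_real t * (g (x * y) - g y) \<in> g ` unit_disk" if "norm y < 1" "0 \<le> t" "t \<le> 1" for t y
  proof -
    have "(1 - t) *\<^sub>R g y + t *\<^sub>R g (x * y) \<in> g ` unit_disk"
      using that xz by (intro convexD_alt gf(4)) auto
    then show ?thesis by (simp add: scaleR_conv_of_real algebra_simps)
  qed
  have le: "norm (om (of_real t) z) \<le> norm z" if t: "0 < t" "t < 1" for t
  proof (rule Schwarz_Lemma(1)[of "om (of_real t)"])
    show "om (of_real t) holomorphic_on unit_disk"
      unfolding om_def
    proof (rule holomorphic_on_compose_gen[of _ _ k, unfolded o_def, OF _ k])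
      have "(\<lambda>y. g (x * y)) holomorphic_on unit_disk"
        by (rule holomorphic_on_compose_gen[of "\<lambda>y. x * y" _ g, unfolded o_def, OF _ gf(1)])
          (use xz in \<open>auto intro!: holomorphic_intros\<close>)
      then show "(\<lambda>y. g y + of_real t * (g (x * y) - g y)) holomorphic_on unit_disk"
        by (intro holomorphic_intros gf(1))
      show "(\<lambda>y. g y + of_real t * (g (x * y) - g y)) ` unit_disk \<subseteq> g ` unit_disk"
        using mem t by auto
    qed
    show "om (of_real t) 0 = 0" using kg[of 0] by (simp add: om_def)
    show "norm (om (of_real t) y) < 1" if "norm y < 1" for y
      using kv[OF mem[OF that, of t]] t by (simp add: om_def)
  qed (use z in auto)
  have om0: "om 0 z = z" using kg[of z] z by (simp add: om_def)
  have "((\<lambda>s. - cnj z * om s z) has_field_derivative (- cnj z * ((1 / deriv g z) * (g (x * z) - g z)))) (at 0)"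
    unfolding om_def
    by (rule DERIV_cmult[OF DERIV_chain2[of k]])
      (use dk[of z] z in \<open>auto intro!: derivative_eq_intros\<close>)
  then have "0 \<le> Re (- cnj z * ((1 / deriv g z) * (g (x * z) - g z)))"
  proof (rule Re_derivative_nonneg)
    fix t :: real assume t: "0 < t" "t < 1"
    have "Re (cnj z * om (of_real t) z) \<le> norm (cnj z * om (of_real t) z)" by (rule complex_Re_le_cmod)
    also have "\<dots> \<le> norm z * norm z" using le[OF t] by (simp add: norm_mult mult_left_mono)
    also have "\<dots> = Re (cnj z * om 0 z)" unfolding om0
      by (simp add: cmod_power2 flip: power2_eq_square)
    finally show "Re (- cnj z * om 0 z) \<le> Re (- cnj z * om (of_real t) z)" by simp
  qed simp
  also have "- cnj z * ((1 / deriv g z) * (g (x * z) - g z)) = of_real ((norm z)\<^sup>2) * ((g z - g (x * z)) / (z * deriv g z))"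
  proof -
    have "u * (1 / d * (- v)) = - (z * u * (v / (z * d)))" if "d \<noteq> 0" for u v d
      using z that by (simp add: field_simps)
    from this[of "deriv g z" "- cnj z" "g z - g (x * z)"] show ?thesis
      using gf(5)[of z] z by (simp only: complex_norm_square) simp
  qed
  finally have "0 \<le> (norm z)\<^sup>2 * Re ((g z - g (x * z)) / (z * deriv g z))"
    by (simp only: times_complex.sel Re_complex_of_real Im_complex_of_real mult_zero_left diff_zero)
  then show ?thesis using z by (simp add: zero_le_mult_iff)
qed

section \<open>A common Wolff point for the recession directions\<close>

lemma norm_one_minus_cnj:
  "(norm (1 - cnj a * z))\<^sup>2 - (norm (z - a))\<^sup>2 = (1 - (norm a)\<^sup>2) * (1 - (norm z)\<^sup>2)"
  unfolding cmod_power2 by simp (simp add: power2_eq_square algebra_simps)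

lemma norm_Moebius:
  assumes "norm a < 1" "norm z < 1"
  shows "1 - (norm (Moebius_function 0 a z))\<^sup>2 = (1 - (norm a)\<^sup>2) * (1 - (norm z)\<^sup>2) / (norm (1 - cnj a * z))\<^sup>2"
    and "1 - cnj a * z \<noteq> 0"
proof -
  have "norm (cnj a * z) < 1"
    using assms norm_mult_less[of "cnj a" 1 z 1] by simp
  then show nz: "1 - cnj a * z \<noteq> 0" by auto
  then show "1 - (norm (Moebius_function 0 a z))\<^sup>2 = (1 - (norm a)\<^sup>2) * (1 - (norm z)\<^sup>2) / (norm (1 - cnj a * z))\<^sup>2"
    unfolding norm_one_minus_cnj[symmetric] Moebius_function_simple norm_divide power_divide
    by (simp add: field_simps)
qed

text \<open>
  The Schwarz lemma for the map conjugated by disk automorphisms that move \<open>a\<close> and \<open>f a\<close> to 0.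
\<close>

lemma Schwarz_Pick:
  assumes f: "f holomorphic_on unit_disk" and im: "\<And>z. z \<in> unit_disk \<Longrightarrow> f z \<in> unit_disk"
    and z: "norm z < 1" and a: "norm a < 1"
  shows "(norm (1 - cnj (f a) * f z))\<^sup>2 * ((1 - (norm a)\<^sup>2) * (1 - (norm z)\<^sup>2))
    \<le> (norm (1 - cnj a * z))\<^sup>2 * ((1 - (norm (f a))\<^sup>2) * (1 - (norm (f z))\<^sup>2))"
proof -
  define h where "h y = Moebius_function 0 (f a) (f (Moebius_function 0 (- a) y))" for y
  have fa: "norm (f a) < 1" and fz: "norm (f z) < 1" using im[of a] im[of z] a z by auto
  have M: "norm (Moebius_function 0 a z) < 1" by (rule Moebius_function_norm_lt_1[OF a z])
  have M': "norm (Moebius_function 0 (- a) y) < 1" if "norm y < 1" for y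
    by (rule Moebius_function_norm_lt_1) (use a that in auto)
  have "norm (h (Moebius_function 0 a z)) \<le> norm (Moebius_function 0 a z)"
  proof (rule Schwarz_Lemma(1)[OF _ _ _ M])
    have "(\<lambda>y. f (Moebius_function 0 (- a) y)) holomorphic_on unit_disk"
      by (rule holomorphic_on_compose_gen[of _ _ f, unfolded o_def, OF Moebius_function_holomorphic f])
        (use M' a in auto)
    then show "h holomorphic_on unit_disk" unfolding h_def
      by (rule holomorphic_on_compose_gen[of _ _ "Moebius_function 0 (f a)", unfolded o_def,
            OF _ Moebius_function_holomorphic[OF fa]]) (use M' im in auto)
    show "h 0 = 0" by (simp add: h_def Moebius_function_of_zero Moebius_function_eq_zero)
    show "norm (h y) < 1" if "norm y < 1" for y
      unfolding h_def by (rule Moebius_function_norm_lt_1[OF fa]) (use M'[OF that] im in auto)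
  qed
  moreover have "h (Moebius_function 0 a z) = Moebius_function 0 (f a) (f z)"
    unfolding h_def by (subst Moebius_function_compose) (use a z in auto)
  ultimately have "(norm (Moebius_function 0 (f a) (f z)))\<^sup>2 \<le> (norm (Moebius_function 0 a z))\<^sup>2"
    by (simp add: power_mono)
  then have "(1 - (norm a)\<^sup>2) * (1 - (norm z)\<^sup>2) / (norm (1 - cnj a * z))\<^sup>2
      \<le> (1 - (norm (f a))\<^sup>2) * (1 - (norm (f z))\<^sup>2) / (norm (1 - cnj (f a) * f z))\<^sup>2"
    using norm_Moebius(1)[OF a z] norm_Moebius(1)[OF fa fz] by linarith
  then show ?thesis
    using norm_Moebius(2)[OF a z] norm_Moebius(2)[OF fa fz]
    by (simp add: divide_le_eq le_divide_eq mult_ac)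
qed

lemma norm_lt_1_sq: "norm (z::complex) < 1 \<Longrightarrow> 0 < 1 - (norm z)\<^sup>2"
  by (simp add: abs_square_less_1)

text \<open>
  Translation by a recession direction \<open>w\<close> is, in disk coordinates, a self-map \<open>F\<close>, and the claim is Julia's lemma
  for it: \<open>F\<close> maps horodisks at \<open>\<tau>\<close> into themselves. The boundary point is found as a limit of points \<open>Z n\<close>, where
  Schwarz-Pick between \<open>z\<close> and \<open>Z n\<close> gives the claim in the limit provided that
  \<open>|F (Z n)| \<ge> |Z n|\<close> and \<open>F (Z n) - Z n \<longlonglongrightarrow> 0\<close>. To have the first for all \<open>w\<close> with \<open>l \<bullet> w > 0\<close> at once, \<open>Z n\<close> is
  chosen to maximise \<open>l \<bullet> g\<close> over a disk: translation increases \<open>l \<bullet> g\<close>, hence leaves the disk. For the second, the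
  maximum is taken only over points whose image is \<open>g 0 + v\<close> with \<open>v\<close> a recession direction: the pair
  \<open>Z n\<close>, \<open>F (Z n)\<close> is then the image of the fixed pair \<open>0\<close>, \<open>F 0\<close> under a self-map, so its
  hyperbolic distance stays bounded while it approaches the boundary.
\<close>

lemma common_horodisk_point:
  assumes g: "convex_mapping g" and w0: "recedes (g ` unit_disk) w0" "0 < l \<bullet> w0"
  obtains \<tau> where "norm \<tau> = 1"
    "\<And>w z y. recedes (g ` unit_disk) w \<Longrightarrow> 0 < l \<bullet> w \<Longrightarrow> z \<in> unit_disk \<Longrightarrow> y \<in> unit_disk \<Longrightarrow> g y = g z + w \<Longrightarrow>
       (norm (1 - cnj \<tau> * y))\<^sup>2 * (1 - (norm z)\<^sup>2) \<le> (norm (1 - cnj \<tau> * z))\<^sup>2 * (1 - (norm y)\<^sup>2)"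
proof -
  note gf = convex_mapping_facts[OF g]
  obtain k where k: "k holomorphic_on g ` unit_disk" and kg: "\<And>z. z \<in> unit_disk \<Longrightarrow> k (g z) = z"
    and kv: "\<And>v. v \<in> g ` unit_disk \<Longrightarrow> k v \<in> unit_disk \<and> g (k v) = v"
    using convex_mapping_inverse[OF g] by metis
  have contg: "continuous_on unit_disk g" using gf(1) by (rule holomorphic_on_imp_continuous_on)
  define p where "p = g 0"
  define \<rho> where "\<rho> n = 1 + - inverse (real (Suc n))" for n
  have \<rho>: "0 \<le> \<rho> n" "\<rho> n < 1" for n by (simp_all add: \<rho>_def field_simps)
  have \<rho>lim: "\<rho> \<longlonglongrightarrow> 1" unfolding \<rho>_def by (rule LIMSEQ_inverse_real_of_nat_add_minus)
  \<comment> \<open>Compact, because the recession directions of an open set form a closed set.\<close>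
  define E where "E n = {z \<in> cball 0 (\<rho> n). recedes (g ` unit_disk) (g z - p)}" for n
  have "\<exists>z\<in>E n. \<forall>y\<in>E n. l \<bullet> g y \<le> l \<bullet> g z" for n
  proof (rule continuous_attains_sup)
    have sub: "cball 0 (\<rho> n) \<subseteq> (unit_disk :: complex set)" using \<rho>[of n] by auto
    have cont: "continuous_on (cball 0 (\<rho> n)) (\<lambda>z. g z - p)"
      by (intro continuous_intros continuous_on_subset[OF contg sub])
    have "closed (cball 0 (\<rho> n) \<inter> (\<lambda>z. g z - p) -` {w. recedes (g ` unit_disk) w})"
      by (rule continuous_closed_preimage[OF cont closed_cball closed_recedes[OF gf(3)]])
    also have "cball 0 (\<rho> n) \<inter> (\<lambda>z. g z - p) -` {w. recedes (g ` unit_disk) w} = E n"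
      by (auto simp: E_def)
    finally have "compact (cball 0 (\<rho> n) \<inter> E n)"
      using compact_Int_closed[OF compact_cball] by blast
    moreover have "cball 0 (\<rho> n) \<inter> E n = E n" by (auto simp: E_def)
    ultimately show "compact (E n)" by simp
    have "0 \<in> E n" using \<rho>[of n] by (simp add: E_def p_def)
    then show "E n \<noteq> {}" by blast
    show "continuous_on (E n) (\<lambda>z. l \<bullet> g z)"
      by (intro continuous_intros continuous_on_subset[OF contg]) (use sub in \<open>auto simp: E_def\<close>)
  qed
  then obtain Z where Z: "\<And>n. Z n \<in> E n" and Zmax: "\<And>n y. y \<in> E n \<Longrightarrow> l \<bullet> g y \<le> l \<bullet> g (Z n)"
    by metis
  have Z1: "norm (Z n) \<le> \<rho> n" "norm (Z n) < 1" and Zr: "recedes (g ` unit_disk) (g (Z n) - p)" for n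
    using Z[of n] \<rho>[of n] by (auto simp: E_def)
  have "\<forall>n. Z n \<in> cball 0 1" using Z1(2) by (auto intro: less_imp_le)
  then obtain \<tau> r where \<tau>: "\<tau> \<in> cball 0 1" and r: "strict_mono r" and lim: "(Z \<circ> r) \<longlonglongrightarrow> \<tau>"
    using compact_cball[of "0::complex" 1] unfolding compact_eq_seq_compact_metric seq_compact_def by metis
  have lim': "(\<lambda>n. Z (r n)) \<longlonglongrightarrow> \<tau>" using lim by (simp add: o_def)
  have \<tau>1: "norm \<tau> = 1"
  proof (rule ccontr)
    assume "norm \<tau> \<noteq> 1"
    then have td: "\<tau> \<in> unit_disk" using \<tau> by simp
    have "isCont g \<tau>" using contg td by (simp add: continuous_on_eq_continuous_at)
    then have gl: "(\<lambda>n. g (Z (r n))) \<longlonglongrightarrow> g \<tau>" using lim' by (rule isCont_tendsto_compose)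
    then have "(\<lambda>n. g (Z (r n)) - p) \<longlonglongrightarrow> g \<tau> - p" by (intro tendsto_intros)
    then have "g \<tau> - p \<in> {w. recedes (g ` unit_disk) w}"
      by (rule closed_sequentially[OF closed_recedes[OF gf(3)], rotated]) (simp add: Zr)
    then have rt: "recedes (g ` unit_disk) (g \<tau> - p)" by simp
    \<comment> \<open>An interior limit would maximise l over the whole recession cone at g 0, where l is unbounded.\<close>
    have "g \<tau> + w0 \<in> g ` unit_disk" by (rule recedesD[OF w0(1)]) (use td in auto)
    then obtain y where y: "y \<in> unit_disk" "g y = g \<tau> + w0" by auto
    have "recedes (g ` unit_disk) (g y - p)"
      using recedes_add[OF rt w0(1)] by (simp add: y(2) algebra_simps)
    moreover have "eventually (\<lambda>n. norm y < \<rho> (r n)) sequentially"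
      by (rule order_tendstoD(1)[OF LIMSEQ_subseq_LIMSEQ[OF \<rho>lim r, unfolded o_def]]) (use y in simp)
    ultimately have "eventually (\<lambda>n. l \<bullet> g y \<le> l \<bullet> g (Z (r n))) sequentially"
      by (elim eventually_mono) (auto intro!: Zmax simp: E_def)
    then have "l \<bullet> g y \<le> l \<bullet> g \<tau>"
      by (intro tendsto_lowerbound[OF tendsto_inner[OF tendsto_const gl]]) auto
    then show False using w0(2) by (simp add: y(2) inner_add_right)
  qed
  have "(norm (1 - cnj \<tau> * y))\<^sup>2 * (1 - (norm z)\<^sup>2) \<le> (norm (1 - cnj \<tau> * z))\<^sup>2 * (1 - (norm y)\<^sup>2)"
    if w: "recedes (g ` unit_disk) w" "0 < l \<bullet> w" and z: "z \<in> unit_disk" and y: "y \<in> unit_disk" and gy: "g y = g z + w"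
    for w z y
  proof -
    define F where "F v x = k (g x + v)" for v x
    have F: "F v holomorphic_on unit_disk" "\<And>x. x \<in> unit_disk \<Longrightarrow> F v x \<in> unit_disk"
        "\<And>x. x \<in> unit_disk \<Longrightarrow> g (F v x) = g x + v" if v: "recedes (g ` unit_disk) v" for v
    proof -
      have m: "g x + v \<in> g ` unit_disk" if "x \<in> unit_disk" for x
        by (rule recedesD[OF v]) (use that in auto)
      show "F v holomorphic_on unit_disk" unfolding F_def
        by (rule holomorphic_on_compose_gen[of _ _ k, unfolded o_def, OF _ k])
          (use m in \<open>auto intro!: holomorphic_intros gf(1)\<close>)
      show "F v x \<in> unit_disk" "g (F v x) = g x + v" if "x \<in> unit_disk" for x
        using kv[OF m[OF that]] by (auto simp: F_def)
    qed
    have Fwz: "F w z = y" using kg[OF y] by (simp add: F_def gy)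
    define Y where "Y n = F w (Z n)" for n
    have Zd: "Z n \<in> unit_disk" for n using Z1 by simp
    have Yd: "norm (Y n) < 1" for n using F(2)[OF w(1) Zd] by (simp add: Y_def)
    have gY: "g (Y n) = g (Z n) + w" for n using F(3)[OF w(1) Zd] by (simp add: Y_def)
    have YZ: "norm (Z n) < norm (Y n)" for n
    proof -
      have "recedes (g ` unit_disk) (g (Y n) - p)"
        using recedes_add[OF Zr w(1), of n] by (simp add: gY algebra_simps)
      moreover have "\<not> l \<bullet> g (Y n) \<le> l \<bullet> g (Z n)" using w(2) by (simp add: gY inner_add_right)
      ultimately have "\<not> norm (Y n) \<le> \<rho> n" using Zmax[of "Y n" n] by (auto simp: E_def)
      then show ?thesis using Z1(1)[of n] by linarith
    qed
    have YZ2: "1 - (norm (Y n))\<^sup>2 \<le> 1 - (norm (Z n))\<^sup>2" for n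
      using YZ[of n] by (simp add: power_mono)
    have ineq: "(norm (1 - cnj (Y n) * y))\<^sup>2 * (1 - (norm z)\<^sup>2) \<le> (norm (1 - cnj (Z n) * z))\<^sup>2 * (1 - (norm y)\<^sup>2)" for n
    proof -
      have "(norm (1 - cnj (Y n) * y))\<^sup>2 * ((1 - (norm (Z n))\<^sup>2) * (1 - (norm z)\<^sup>2))
          \<le> (norm (1 - cnj (Z n) * z))\<^sup>2 * ((1 - (norm (Y n))\<^sup>2) * (1 - (norm y)\<^sup>2))"
        using Schwarz_Pick[OF F(1,2)[OF w(1)], where z = z and a = "Z n"] z Z1 unfolding Fwz Y_def by simp
      also have "\<dots> \<le> (norm (1 - cnj (Z n) * z))\<^sup>2 * ((1 - (norm (Z n))\<^sup>2) * (1 - (norm y)\<^sup>2))"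
        using YZ2[of n] norm_lt_1_sq[of y] y by (intro mult_left_mono mult_right_mono) auto
      finally have "(1 - (norm (Z n))\<^sup>2) * ((norm (1 - cnj (Y n) * y))\<^sup>2 * (1 - (norm z)\<^sup>2))
          \<le> (1 - (norm (Z n))\<^sup>2) * ((norm (1 - cnj (Z n) * z))\<^sup>2 * (1 - (norm y)\<^sup>2))"
        by (simp only: mult_ac)
      then show ?thesis using norm_lt_1_sq[OF Z1(2)] by (rule mult_left_le_imp_le)
    qed
    define q where "q = F w 0"
    have q: "norm q < 1" using F(2)[OF w(1), of 0] by (simp add: q_def)
    have gq: "g q = p + w" using F(3)[OF w(1), of 0] by (simp add: q_def p_def)
    have disp: "norm (Y n - Z n) \<le> (1 - (norm (Z n))\<^sup>2) / sqrt (1 - (norm q)\<^sup>2)" for n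
    proof -
      have f0: "F (g (Z n) - p) 0 = Z n" using kg[OF Zd] by (simp add: F_def p_def)
      have fq: "F (g (Z n) - p) q = Y n" using kg[of "Y n"] Yd by (simp add: F_def gq gY algebra_simps)
      have nz: "0 \<le> 1 - (norm (Z n))\<^sup>2" using norm_lt_1_sq[OF Z1(2)] by (rule less_imp_le)
      have "(norm (1 - cnj (Z n) * Y n))\<^sup>2 * (1 - (norm q)\<^sup>2) \<le> (1 - (norm (Z n))\<^sup>2) * (1 - (norm (Y n))\<^sup>2)"
        using Schwarz_Pick[OF F(1,2)[OF Zr[of n]], where z = q and a = 0] q unfolding f0 fq by simp
      also have "\<dots> \<le> (1 - (norm (Z n))\<^sup>2) * (1 - (norm (Z n))\<^sup>2)"
        by (intro mult_left_mono YZ2 nz)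
      finally have "(norm (1 - cnj (Z n) * Y n))\<^sup>2 * (1 - (norm q)\<^sup>2) \<le> (1 - (norm (Z n))\<^sup>2)\<^sup>2"
        by (simp only: power2_eq_square)
      moreover have "(norm (Y n - Z n))\<^sup>2 \<le> (norm (1 - cnj (Z n) * Y n))\<^sup>2"
        using norm_one_minus_cnj[of "Z n" "Y n"] norm_lt_1_sq[OF Yd] nz
        by (metis diff_ge_0_iff_ge less_imp_le mult_nonneg_nonneg)
      ultimately have "(norm (Y n - Z n))\<^sup>2 * (1 - (norm q)\<^sup>2) \<le> (1 - (norm (Z n))\<^sup>2)\<^sup>2"
        using norm_lt_1_sq[OF q] by (meson less_imp_le mult_right_mono order_trans)
      then have "(norm (Y n - Z n) * sqrt (1 - (norm q)\<^sup>2))\<^sup>2 \<le> (1 - (norm (Z n))\<^sup>2)\<^sup>2"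
        using norm_lt_1_sq[OF q] by (simp add: power_mult_distrib)
      then have "norm (Y n - Z n) * sqrt (1 - (norm q)\<^sup>2) \<le> 1 - (norm (Z n))\<^sup>2"
        using nz by (rule power2_le_imp_le)
      then show ?thesis using norm_lt_1_sq[OF q] by (simp add: pos_le_divide_eq)
    qed
    have "(\<lambda>n. (1 - (norm (Z (r n)))\<^sup>2) / sqrt (1 - (norm q)\<^sup>2)) \<longlonglongrightarrow> (1 - (norm \<tau>)\<^sup>2) / sqrt (1 - (norm q)\<^sup>2)"
      by (intro tendsto_intros lim') (use norm_lt_1_sq[OF q] in auto)
    then have l0: "(\<lambda>n. (1 - (norm (Z (r n)))\<^sup>2) / sqrt (1 - (norm q)\<^sup>2)) \<longlonglongrightarrow> 0" using \<tau>1 by simp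
    have "(\<lambda>n. Y (r n) - Z (r n)) \<longlonglongrightarrow> 0"
      by (rule Lim_null_comparison[OF _ l0]) (use disp in auto)
    from tendsto_add[OF this lim'] have limY: "(\<lambda>n. Y (r n)) \<longlonglongrightarrow> \<tau>" by simp
    show ?thesis
    proof (rule LIMSEQ_le)
      show "(\<lambda>n. (norm (1 - cnj (Y (r n)) * y))\<^sup>2 * (1 - (norm z)\<^sup>2)) \<longlonglongrightarrow> (norm (1 - cnj \<tau> * y))\<^sup>2 * (1 - (norm z)\<^sup>2)"
        by (intro tendsto_intros limY)
      show "(\<lambda>n. (norm (1 - cnj (Z (r n)) * z))\<^sup>2 * (1 - (norm y)\<^sup>2)) \<longlonglongrightarrow> (norm (1 - cnj \<tau> * z))\<^sup>2 * (1 - (norm y)\<^sup>2)"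
        by (intro tendsto_intros lim')
    qed (use ineq in auto)
  qed
  with \<tau>1 show thesis using that by blast
qed

text \<open>
  The function \<open>K\<close>, whose real part is the Poisson kernel at \<open>\<tau>\<close>, increases along each of the translation flows;
  the claim is that its derivative at time 0 is nonnegative, after the rotation that moves \<open>\<tau>\<close> to 1.
\<close>

proposition recession_angle_condition:
  assumes g: "convex_mapping g" and w0: "recedes (g ` unit_disk) w0" "0 < l \<bullet> w0"
  obtains \<tau> where "norm \<tau> = 1"
    "\<And>w z. recedes (g ` unit_disk) w \<Longrightarrow> 0 < l \<bullet> w \<Longrightarrow> z \<in> unit_disk \<Longrightarrow>
       0 \<le> Re (cnj w * ((1 - z)\<^sup>2 * deriv (\<lambda>x. g (\<tau> * x)) z))"
proof -
  note gf = convex_mapping_facts[OF g]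
  obtain k where kg: "\<And>z. z \<in> unit_disk \<Longrightarrow> k (g z) = z"
    and dk: "\<And>z. z \<in> unit_disk \<Longrightarrow> (k has_field_derivative (1 / deriv g z)) (at (g z))"
    and kv: "\<And>v. v \<in> g ` unit_disk \<Longrightarrow> k v \<in> unit_disk \<and> g (k v) = v"
    using convex_mapping_inverse[OF g] by metis
  obtain \<tau> where \<tau>: "norm \<tau> = 1" and horo: "\<And>w z y. recedes (g ` unit_disk) w \<Longrightarrow> 0 < l \<bullet> w \<Longrightarrow> z \<in> unit_disk
      \<Longrightarrow> y \<in> unit_disk \<Longrightarrow> g y = g z + w \<Longrightarrow>
       (norm (1 - cnj \<tau> * y))\<^sup>2 * (1 - (norm z)\<^sup>2) \<le> (norm (1 - cnj \<tau> * z))\<^sup>2 * (1 - (norm y)\<^sup>2)"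
    using common_horodisk_point[OF g w0] by metis
  have tt: "cnj \<tau> * \<tau> = 1" using \<tau> complex_norm_square[of \<tau>] by (simp add: mult.commute)
  have nz: "1 - cnj \<tau> * x \<noteq> 0" if "norm x < 1" for x
  proof
    assume "1 - cnj \<tau> * x = 0"
    then have "norm (cnj \<tau> * x) = 1" by simp
    then show False using that \<tau> by (simp add: norm_mult)
  qed
  define K where "K x = (1 + cnj \<tau> * x) / (1 - cnj \<tau> * x)" for x
  have ReK: "Re (K x) = (1 - (norm x)\<^sup>2) / (norm (1 - cnj \<tau> * x))\<^sup>2" for x
  proof -
    have "(norm (cnj \<tau> * x))\<^sup>2 = (norm x)\<^sup>2" using \<tau> by (simp add: norm_mult)
    moreover have "Re ((1 + v) / (1 - v)) = (1 - (norm v)\<^sup>2) / (norm (1 - v))\<^sup>2" for v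
      unfolding Re_divide cmod_power2 by (simp add: power2_eq_square algebra_simps)
    ultimately show ?thesis unfolding K_def by simp
  qed
  have "0 \<le> Re (cnj w * ((1 - z)\<^sup>2 * deriv (\<lambda>x. g (\<tau> * x)) z))"
    if w: "recedes (g ` unit_disk) w" "0 < l \<bullet> w" and z: "z \<in> unit_disk" for w z
  proof -
    define y where "y = \<tau> * z"
    have y: "y \<in> unit_disk" using z \<tau> by (simp add: y_def norm_mult)
    have ty: "cnj \<tau> * y = z" using tt by (simp add: y_def mult.assoc[symmetric])
    have z1: "1 - z \<noteq> 0" using z by auto
    define d where "d = deriv g y"
    have d: "d \<noteq> 0" using gf(5)[OF y] by (simp add: d_def)
    have df: "deriv (\<lambda>x. g (\<tau> * x)) z = \<tau> * d"
    proof (rule DERIV_imp_deriv)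
      have "(g has_field_derivative d) (at y)" unfolding d_def
        by (rule holomorphic_derivI[OF gf(1) open_ball y])
      then have "((\<lambda>x. g (\<tau> * x)) has_field_derivative d * \<tau>) (at z)"
        unfolding y_def by (rule DERIV_chain2[where g = "\<lambda>x. \<tau> * x"]) (auto intro!: derivative_eq_intros)
      then show "((\<lambda>x. g (\<tau> * x)) has_field_derivative \<tau> * d) (at z)"
        by (simp add: mult.commute)
    qed
    have k0: "k (g y + 0 * w) = y" using kg[OF y] by simp
    have "((\<lambda>s. k (g y + s * w)) has_field_derivative (1 / d * w)) (at 0)"
      by (rule DERIV_chain2[of k]) (use dk[OF y] in \<open>auto intro!: derivative_eq_intros simp: d_def\<close>)
    then have "((\<lambda>s. K (k (g y + s * w))) has_field_derivative (2 * cnj \<tau> / (1 - z)\<^sup>2 * (1 / d * w))) (at 0)"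
    proof (rule DERIV_chain2[of K, rotated])
      show "(K has_field_derivative 2 * cnj \<tau> / (1 - z)\<^sup>2) (at (k (g y + 0 * w)))"
        unfolding k0 K_def using nz[of y] y
        by (auto intro!: derivative_eq_intros simp: ty z1 power2_eq_square) (simp add: algebra_simps)
    qed
    then have "0 \<le> Re (2 * cnj \<tau> / (1 - z)\<^sup>2 * (1 / d * w))"
    proof (rule Re_derivative_nonneg)
      fix t :: real assume t: "0 < t" "t < 1"
      define x where "x = k (g y + of_real t * w)"
      have "recedes (g ` unit_disk) (of_real t * w)" by (rule recedes_scale[OF w(1)]) (use t in simp)
      moreover have "0 < l \<bullet> (of_real t * w)" using t w(2) by (simp flip: scaleR_conv_of_real)
      moreover have "x \<in> unit_disk \<and> g x = g y + of_real t * w"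
        unfolding x_def by (rule kv, rule recedesD[OF calculation(1)]) (use y in simp)
      ultimately have "(norm (1 - cnj \<tau> * x))\<^sup>2 * (1 - (norm y)\<^sup>2) \<le> (norm (1 - cnj \<tau> * y))\<^sup>2 * (1 - (norm x)\<^sup>2)"
        and x: "norm x < 1"
        using horo[OF _ _ y] by auto
      then have "Re (K y) \<le> Re (K x)"
        unfolding ReK using nz[OF x] nz[of y] y by (simp add: divide_le_eq le_divide_eq mult_ac)
      then show "Re (K (k (g y + 0 * w))) \<le> Re (K (k (g y + of_real t * w)))"
        unfolding k0 x_def .
    qed simp
    also have "2 * cnj \<tau> / (1 - z)\<^sup>2 * (1 / d * w) = 2 * (w / ((1 - z)\<^sup>2 * (\<tau> * d)))"
    proof -
      have "cnj \<tau> = 1 / \<tau>" using tt \<tau> by (metis nonzero_eq_divide_eq norm_zero zero_neq_one)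
      then show ?thesis by simp
    qed
    finally have "0 \<le> Re (2 * (w / ((1 - z)\<^sup>2 * (\<tau> * d))))" .
    moreover have "Re (2 * v) = 2 * Re v" for v by simp
    ultimately have "0 \<le> Re (w / ((1 - z)\<^sup>2 * (\<tau> * d)))" by (metis zero_le_mult_iff zero_less_numeral not_less)
    moreover have "Re (w / X) = Re (cnj w * X) / (norm X)\<^sup>2" for X
      unfolding Re_divide cmod_power2 by simp
    ultimately have "0 \<le> Re (cnj w * ((1 - z)\<^sup>2 * (\<tau> * d))) / (norm ((1 - z)\<^sup>2 * (\<tau> * d)))\<^sup>2" by simp
    moreover have "0 < (norm ((1 - z)\<^sup>2 * (\<tau> * d)))\<^sup>2" using d z1 \<tau> by auto
    ultimately show ?thesis unfolding df by (simp only: zero_le_divide_iff) auto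
  qed
  with \<tau> show thesis using that by blast
qed

section \<open>Coefficient sums in the disk\<close>

lemma tcoeff_scale:
  assumes "f holomorphic_on ball 0 R" "0 < R" "s \<noteq> 0"
  shows "tcoeff (\<lambda>x. f (s * x)) n = tcoeff f n * s ^ n"
proof (rule tcoeff_unique[of "R / norm s"])
  fix z :: complex assume "norm z < R / norm s"
  then have "norm (s * z) < R" using assms(3) by (simp add: norm_mult pos_less_divide_eq mult.commute)
  from tcoeff_sums[OF assms(1) this] show "(\<lambda>n. tcoeff f n * s ^ n * z ^ n) sums f (s * z)"
    by (simp add: power_mult_distrib mult.assoc)
qed (use assms in auto)

lemma tcoeff_cmult:
  assumes "f holomorphic_on ball 0 R" "0 < R"
  shows "tcoeff (\<lambda>x. c * f x) n = c * tcoeff f n"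
  by (rule tcoeff_unique[OF assms(2)])
    (use sums_mult[OF tcoeff_sums[OF assms(1)], of _ c] in \<open>simp add: mult.assoc\<close>)

lemma tcoeff_deriv: "tcoeff (deriv f) n = of_nat (Suc n) * tcoeff f (Suc n)"
  by (simp add: fps_expansion_def funpow_Suc_right field_simps del: funpow.simps of_nat_Suc)

lemma tcoeff_one_minus_mult:
  assumes f: "f holomorphic_on ball 0 R" and R: "0 < R"
  shows "tcoeff (\<lambda>x. (1 - x) * f x) 0 = tcoeff f 0"
    and "tcoeff (\<lambda>x. (1 - x) * f x) (Suc n) = tcoeff f (Suc n) - tcoeff f n"
proof -
  have "f has_fps_expansion fps_expansion f 0"
    by (rule has_fps_expansion_fps_expansion[OF _ _ f]) (use R in auto)
  then have "(\<lambda>x. (1 - x) * f x) has_fps_expansion (1 - fps_X) * fps_expansion f 0"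
    by (intro fps_expansion_intros)
  then have "fps_expansion (\<lambda>x. (1 - x) * f x) 0 = (1 - fps_X) * fps_expansion f 0"
    by (rule fps_expansion_eqI)
  then show "tcoeff (\<lambda>x. (1 - x) * f x) (Suc n) = tcoeff f (Suc n) - tcoeff f n"
    by (simp add: left_diff_distrib)
qed simp

lemma summable_tcoeff_shift:
  assumes f: "f holomorphic_on unit_disk" and G: "G holomorphic_on ball 0 R" and R: "1 < R"
  shows "summable (\<lambda>n. tcoeff f n * tcoeff G (n + j))"
proof -
  obtain S where S: "1 < S" "S < R" using dense[OF R] by blast
  have "summable (\<lambda>n. norm (tcoeff G n * of_real S ^ n))"
    by (rule summable_norm_tcoeff[OF G]) (use S in simp)
  then have "(\<lambda>n. norm (tcoeff G n * of_real S ^ n)) \<longlonglongrightarrow> 0" by (rule summable_LIMSEQ_zero)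
  from LIMSEQ_ignore_initial_segment[OF this, of j]
  have "eventually (\<lambda>n. norm (tcoeff G (n + j) * of_real S ^ (n + j)) < 1) sequentially"
    by (rule order_tendstoD(2)) simp
  then have "eventually (\<lambda>n. norm (tcoeff f n * tcoeff G (n + j)) \<le> norm (tcoeff f n * of_real (1 / S) ^ n)) sequentially"
  proof eventually_elim
    case (elim n)
    have "norm (tcoeff G (n + j)) * S ^ n \<le> norm (tcoeff G (n + j)) * S ^ (n + j)"
      using S by (intro mult_left_mono power_increasing) auto
    also have "\<dots> \<le> 1" using elim S by (simp add: norm_mult norm_power)
    finally have "norm (tcoeff G (n + j)) \<le> 1 / S ^ n" using S by (simp add: pos_le_divide_eq)
    then have "norm (tcoeff f n) * norm (tcoeff G (n + j)) \<le> norm (tcoeff f n) * (1 / S ^ n)"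
      by (rule mult_left_mono) simp
    then show ?case using S by (simp add: norm_mult norm_power norm_divide power_divide)
  qed
  then show ?thesis
    by (rule summable_comparison_test_ev[OF _ summable_norm_tcoeff[OF f]]) (use S in \<open>simp add: norm_divide\<close>)
qed

text \<open>
  Abel summation: multiplication by \<open>1 - x\<close> on one side is the difference operator on the other.
\<close>

lemma tcoeff_sum_by_parts:
  assumes f: "f holomorphic_on unit_disk" and G: "G holomorphic_on ball 0 R" and R: "1 < R"
  shows "(\<Sum>n. tcoeff (\<lambda>x. (1 - x) * f x) n * tcoeff G n) = (\<Sum>n. tcoeff f n * (tcoeff G n - tcoeff G (Suc n)))"
proof -
  note s0 = summable_tcoeff_shift[OF f G R, of 0] and s1 = summable_tcoeff_shift[OF f G R, of 1]
  define u where "u n = (case n of 0 \<Rightarrow> 0 | Suc m \<Rightarrow> tcoeff f m * tcoeff G (Suc m))" for n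
  have "(\<lambda>n. u (Suc n)) sums (\<Sum>n. tcoeff f n * tcoeff G (Suc n))"
    using s1 by (simp add: u_def summable_sums)
  then have u: "u sums (\<Sum>n. tcoeff f n * tcoeff G (Suc n))"
    by (simp only: sums_Suc_iff) (simp add: u_def)
  have "(\<lambda>n. tcoeff f n * tcoeff G n - u n) sums
      ((\<Sum>n. tcoeff f n * tcoeff G n) - (\<Sum>n. tcoeff f n * tcoeff G (Suc n)))"
    by (intro sums_diff u) (use s0 in \<open>simp add: summable_sums\<close>)
  moreover have "tcoeff f n * tcoeff G n - u n = tcoeff (\<lambda>x. (1 - x) * f x) n * tcoeff G n" for n
    by (cases n) (simp_all only: u_def nat.case tcoeff_one_minus_mult[OF f zero_less_one], simp_all add: algebra_simps)
  moreover have "(\<lambda>n. tcoeff f n * tcoeff G n - tcoeff f n * tcoeff G (Suc n)) sums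
      ((\<Sum>n. tcoeff f n * tcoeff G n) - (\<Sum>n. tcoeff f n * tcoeff G (Suc n)))"
    by (intro sums_diff) (use s0 s1 in \<open>simp_all add: summable_sums\<close>)
  ultimately show ?thesis by (simp add: sums_iff right_diff_distrib)
qed

text \<open>
  Positivity for the dilations of \<open>F\<close>, and a limit. The radius of convergence of \<open>P\<close> is absorbed into the
  rescaled function \<open>Q\<close>, so that the limit is taken at an interior point of the disk.
\<close>

lemma hadamard_positivity_disk:
  assumes F: "F holomorphic_on unit_disk" and ReF: "\<And>z. z \<in> unit_disk \<Longrightarrow> 0 \<le> Re (F z)"
    and P: "P holomorphic_on ball 0 R" and R: "1 < R" and P0: "P 0 = 1"
    and ReP: "\<And>x. norm x = 1 \<Longrightarrow> 1 / 2 \<le> Re (P x)"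
  shows "0 \<le> Re (\<Sum>n. tcoeff F n * tcoeff P n)"
proof -
  obtain S where S: "1 < S" "S < R" using dense[OF R] by blast
  define Q where "Q x = P (of_real S * x)" for x
  have SR: "norm (of_real S * x) < R" if "norm x < 1" for x :: complex
  proof -
    have "norm (of_real S * x) = S * norm x" using S by (simp add: norm_mult)
    also have "\<dots> \<le> S * 1" using S that by (intro mult_left_mono) auto
    finally show ?thesis using S by simp
  qed
  have Q: "Q holomorphic_on unit_disk" unfolding Q_def
    by (rule holomorphic_on_compose_gen[of _ _ P, unfolded o_def, OF _ P])
      (use SR in \<open>auto intro!: holomorphic_intros\<close>)
  have tQ: "tcoeff Q n = tcoeff P n * of_real S ^ n" for n
    unfolding Q_def by (rule tcoeff_scale[OF P]) (use S R in auto)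
  have eq: "(\<lambda>n. tcoeff F n * of_real s ^ n * tcoeff P n) sums hadamard F Q (of_real (s / S))"
    if s: "0 \<le> s" "s \<le> 1" for s
  proof -
    have "norm (complex_of_real (s / S)) < 1" using S s by (simp add: norm_divide)
    from hadamard_sums(1)[OF F Q this] show ?thesis
      using S by (simp add: tQ power_divide mult_ac)
  qed
  have "0 \<le> Re (hadamard F Q (of_real (s / S)))" if s: "0 < s" "s < 1" for s
  proof -
    have ns: "norm (complex_of_real s) < 1" using s by simp
    have sP: "summable (\<lambda>n. norm (tcoeff P n))" using summable_norm_tcoeff[OF P, of 1] R by simp
    have "0 \<le> Re (\<Sum>n. (tcoeff F n * of_real s ^ n) * tcoeff P n)"
    proof (rule hadamard_positivity[OF summable_norm_tcoeff[OF F ns] sP])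
      fix x :: complex assume x: "norm x = 1"
      have "norm (of_real s * x) < 1" using ns x by (simp add: norm_mult)
      then show "0 \<le> Re (wiener (\<lambda>n. tcoeff F n * of_real s ^ n) x)"
        using wiener_dilate[OF F ns, of x] ReF[of "of_real s * x"] x by simp
      have "wiener (tcoeff P) x = P x"
        using tcoeff_sums[OF P, of x] x R by (simp add: wiener_def sums_iff)
      then show "1 / 2 \<le> Re (wiener (tcoeff P) x)" using ReP[OF x] by simp
    qed (simp add: P0)
    then show ?thesis using eq[of s] s by (simp add: sums_iff)
  qed
  then have ev: "eventually (\<lambda>s. 0 \<le> Re (hadamard F Q (of_real (s / S)))) (at_left (1::real))"
    by (intro eventually_at_leftI[of 0]) auto
  have "isCont (hadamard F Q) (of_real (1 / S))"
    using holomorphic_on_imp_continuous_on[OF hadamard_holomorphic[OF F Q]] S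
    by (simp add: continuous_on_eq_continuous_at norm_divide)
  moreover have "((\<lambda>s. complex_of_real (s / S)) \<longlongrightarrow> of_real (1 / S)) (at_left 1)"
    using S by (intro tendsto_intros) auto
  ultimately have "((\<lambda>s. hadamard F Q (of_real (s / S))) \<longlongrightarrow> hadamard F Q (of_real (1 / S))) (at_left 1)"
    by (rule isCont_tendsto_compose)
  then have "((\<lambda>s. Re (hadamard F Q (of_real (s / S)))) \<longlongrightarrow> Re (hadamard F Q (of_real (1 / S)))) (at_left 1)"
    by (rule tendsto_Re)
  from tendsto_lowerbound[OF this ev] have "0 \<le> Re (hadamard F Q (of_real (1 / S)))" by simp
  then show ?thesis using eq[of 1] by (simp add: sums_iff)
qed

section \<open>The derivative of a convolution\<close>

lemma Re_one_over_one_minus: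
  assumes "norm x = 1" "x \<noteq> 1"
  shows "Re (1 / (1 - x)) = 1 / 2" and "- x / (1 - x)\<^sup>2 = of_real (1 / (norm (1 - x))\<^sup>2)"
proof -
  have x: "x * cnj x = 1" using assms(1) complex_norm_square[of x] by simp
  have n: "(norm (1 - x))\<^sup>2 = 2 * (1 - Re x)"
  proof -
    have "(Re x)\<^sup>2 + (Im x)\<^sup>2 = 1" using assms(1) cmod_power2[of x] by simp
    then show ?thesis unfolding cmod_power2 by (simp add: power2_eq_square algebra_simps)
  qed
  have nz: "(norm (1 - x))\<^sup>2 \<noteq> 0" using assms(2) by auto
  show "Re (1 / (1 - x)) = 1 / 2"
  proof -
    have "Re (1 / y) = Re y / (norm y)\<^sup>2" for y unfolding Re_divide cmod_power2 by simp
    from this[of "1 - x"] have "Re (1 / (1 - x)) = (1 - Re x) / (2 * (1 - Re x))" unfolding n by simp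
    moreover have "1 - Re x \<noteq> 0" using nz n by simp
    ultimately show ?thesis by simp
  qed
  have "(1 - x) * (1 - cnj x) * x = - (1 - x)\<^sup>2"
    using x by (simp add: power2_eq_square algebra_simps)
  moreover have "of_real ((norm (1 - x))\<^sup>2) = (1 - x) * (1 - cnj x)"
    unfolding complex_norm_square by simp
  ultimately have "of_real ((norm (1 - x))\<^sup>2) * x = - (1 - x)\<^sup>2" by simp
  then have "(1 - x)\<^sup>2 = - x * of_real ((norm (1 - x))\<^sup>2)" by (simp add: mult.commute)
  moreover have "x \<noteq> 0" using assms(1) by auto
  ultimately show "- x / (1 - x)\<^sup>2 = of_real (1 / (norm (1 - x))\<^sup>2)" by simp
qed

text \<open>
  The coefficients of \<open>F x = cnj w * (1 - x)\<^sup>2 * deriv f x\<close> are second differences. Summation by parts, twice, moves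
  them to a function \<open>G\<close> whose second differences are the coefficients of \<open>\<psi> x = g (x * z)\<close>; hence
  \<open>cnj w * z * deriv (hadamard f g) z\<close> is the coefficient sum of \<open>F\<close> against \<open>G\<close>. Such a \<open>G\<close> is obtained from \<open>\<psi>\<close>
  by two divided differences at 1, with a factor \<open>x\<close> in between. After normalising \<open>G\<close> to \<open>P\<close> with \<open>P 0 = 1\<close>,
  the convexity of \<open>g\<close> in the form \<open>convex_mapping_subdisk\<close> says exactly that \<open>Re P \<ge> 1/2\<close> on the unit
  circle, and positivity applies.
\<close>

proposition convolution_derivative_halfplane:
  assumes f: "f holomorphic_on unit_disk" and g: "convex_mapping g"
    and half: "\<And>x. x \<in> unit_disk \<Longrightarrow> 0 \<le> Re (cnj w * ((1 - x)\<^sup>2 * deriv f x))"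
    and z: "norm z < 1" "z \<noteq> 0"
  shows "0 \<le> Re (cnj w * (deriv (hadamard f g) z / deriv g z))"
proof -
  note gf = convex_mapping_facts[OF g]
  define R where "R = 1 / norm z"
  have R: "1 < R" using z by (simp add: R_def)
  define d where "d = deriv g z"
  have d: "d \<noteq> 0" using gf(5) z by (simp add: d_def)
  have Rz: "norm (x * z) < 1" if "norm x < R" for x
    using that z by (simp add: R_def norm_mult pos_less_divide_eq)
  define \<psi> where "\<psi> x = g (x * z)" for x
  have \<psi>: "\<psi> holomorphic_on ball 0 R" unfolding \<psi>_def
    by (rule holomorphic_on_compose_gen[of _ _ g, unfolded o_def, OF _ gf(1)])
      (use Rz in \<open>auto intro!: holomorphic_intros\<close>)
  have d\<psi>: "deriv \<psi> 1 = z * d"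
  proof (rule DERIV_imp_deriv)
    have "(g has_field_derivative d) (at (1 * z))" unfolding d_def
      using holomorphic_derivI[OF gf(1) open_ball, of z] z by simp
    then have "((\<lambda>x. g (x * z)) has_field_derivative d * z) (at 1)"
      by (rule DERIV_chain2[where g = "\<lambda>x. x * z"]) (auto intro!: derivative_eq_intros)
    then show "(\<psi> has_field_derivative z * d) (at 1)" by (simp add: \<psi>_def[abs_def] mult.commute)
  qed
  \<comment> \<open>The first divided difference of \<psi> at 1; K and G repeat the step, with removable singularities.\<close>
  define E where "E x = (if x = 1 then deriv \<psi> 1 else (\<psi> x - \<psi> 1) / (x - 1))" for x
  have E: "E holomorphic_on ball 0 R" unfolding E_def[abs_def] by (rule pole_lemma_open[OF \<psi> open_ball])
  define K where "K x = x * E x" for x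
  have K: "K holomorphic_on ball 0 R" unfolding K_def[abs_def] by (intro holomorphic_intros E)
  have K1: "K 1 = z * d" by (simp add: K_def E_def d\<psi>)
  define G where "G x = (if x = 1 then deriv K 1 else (K x - K 1) / (x - 1))" for x
  have G: "G holomorphic_on ball 0 R" unfolding G_def[abs_def] by (rule pole_lemma_open[OF K open_ball])
  have G0: "G 0 = z * d" by (simp add: G_def K1) (simp add: K_def)
  have rec_E: "tcoeff E n - tcoeff E (Suc n) = tcoeff \<psi> (Suc n)" for n
  proof -
    have "(\<lambda>x. (1 - x) * E x) = (\<lambda>x. \<psi> 1 - \<psi> x)" by (auto simp: E_def field_simps)
    moreover have "tcoeff (\<lambda>x. \<psi> 1 - \<psi> x) (Suc n) = - tcoeff \<psi> (Suc n)"
    proof -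
      have "\<psi> has_fps_expansion fps_expansion \<psi> 0"
        by (rule has_fps_expansion_fps_expansion[OF _ _ \<psi>]) (use R in auto)
      then have "(\<lambda>x. \<psi> 1 - \<psi> x) has_fps_expansion (fps_const (\<psi> 1) - fps_expansion \<psi> 0)"
        by (intro fps_expansion_intros)
      from fps_expansion_eqI[OF this] show ?thesis by simp
    qed
    ultimately show ?thesis
      using tcoeff_one_minus_mult(2)[OF E, of n] R by (simp add: algebra_simps)
  qed
  have rec_G: "tcoeff G n - tcoeff G (Suc n) = tcoeff E n" for n
  proof -
    have "(\<lambda>x. (1 - x) * G x) = (\<lambda>x. K 1 - x * E x)" by (auto simp: G_def K_def field_simps)
    moreover have "tcoeff (\<lambda>x. K 1 - x * E x) (Suc n) = - tcoeff E n"
    proof -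
      have "E has_fps_expansion fps_expansion E 0"
        by (rule has_fps_expansion_fps_expansion[OF _ _ E]) (use R in auto)
      then have "(\<lambda>x. K 1 - x * E x) has_fps_expansion (fps_const (K 1) - fps_X * fps_expansion E 0)"
        by (intro fps_expansion_intros)
      from fps_expansion_eqI[OF this] show ?thesis by simp
    qed
    ultimately show ?thesis
      using tcoeff_one_minus_mult(2)[OF G, of n] R by (simp add: algebra_simps)
  qed
  define P where "P x = 1 / (z * d) * G x" for x
  have P: "P holomorphic_on ball 0 R" unfolding P_def[abs_def] by (intro holomorphic_intros G)
  have P0: "P 0 = 1" using z d by (simp add: P_def G0)
  have ReP1: "1 / 2 \<le> Re (P x)" if x: "norm x = 1" "x \<noteq> 1" for x
  proof -
    define u where "u = (g z - g (x * z)) / (z * d)"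
    have "0 \<le> Re u" unfolding u_def d_def by (rule convex_mapping_subdisk[OF g z]) (use x in simp)
    have x1: "1 - x \<noteq> 0" "x - 1 \<noteq> 0" using x by auto
    have "\<psi> x - \<psi> 1 = - (z * d) * u" using z d by (simp add: u_def \<psi>_def)
    then have "G x = (x * (- (z * d) * u / (x - 1)) - z * d) / (x - 1)"
      using x by (simp add: G_def K1) (simp add: K_def E_def)
    also have "x * (- (z * d) * u / (x - 1)) - z * d = (z * d) * (x * (- u / (x - 1)) - 1)"
      by (simp add: algebra_simps)
    finally have "P x = (x * (- u / (x - 1)) - 1) / (x - 1)"
      using z d by (simp add: P_def)
    also have "\<dots> = 1 / (1 - x) + (- x / (1 - x)\<^sup>2) * u"
    proof -
      have "x - 1 = - (1 - x)" by simp
      then show ?thesis using x1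
        by (simp only: power2_eq_square) (simp add: divide_simps, simp add: algebra_simps)
    qed
    finally have "Re (P x) = 1 / 2 + 1 / (norm (1 - x))\<^sup>2 * Re u"
      unfolding Re_one_over_one_minus(2)[OF x] using Re_one_over_one_minus(1)[OF x]
      by (simp only: plus_complex.sel times_complex.sel Re_complex_of_real Im_complex_of_real mult_zero_left diff_zero)
    then show ?thesis using \<open>0 \<le> Re u\<close> by simp
  qed
  have ReP: "1 / 2 \<le> Re (P x)" if x: "norm x = 1" for x
  proof (cases "x = 1")
    case True
    \<comment> \<open>The divided differences give the bound only off 1; there it follows by continuity.\<close>
    have "isCont P 1" using holomorphic_on_imp_continuous_on[OF P] R by (simp add: continuous_on_eq_continuous_at)
    moreover have "(\<lambda>n. cis (inverse (real (Suc n)))) \<longlonglongrightarrow> cis 0"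
      by (intro tendsto_intros LIMSEQ_inverse_real_of_nat)
    ultimately have l: "(\<lambda>n. Re (P (cis (inverse (real (Suc n)))))) \<longlonglongrightarrow> Re (P 1)"
      by (intro tendsto_Re isCont_tendsto_compose[of 1 P]) auto
    have ne: "cis (inverse (real (Suc n))) \<noteq> 1" for n
    proof
      assume "cis (inverse (real (Suc n))) = 1"
      then have "sin (inverse (real (Suc n))) = 0" by (simp add: complex_eq_iff)
      moreover have "0 < sin (inverse (real (Suc n)))"
      proof (rule sin_gt_zero)
        have "inverse (real (Suc n)) \<le> 1" by (simp add: inverse_le_1_iff)
        also have "1 < pi" using pi_gt3 by simp
        finally show "inverse (real (Suc n)) < pi" .
      qed simp
      ultimately show False by simp
    qed
    show ?thesis unfolding True
      by (rule tendsto_lowerbound[OF l]) (use ReP1[OF norm_cis ne] in auto)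
  qed (use ReP1 x in auto)
  define F where "F x = cnj w * ((1 - x) * ((1 - x) * deriv f x))" for x
  have df: "deriv f holomorphic_on unit_disk" by (rule holomorphic_deriv[OF f open_ball])
  have F: "F holomorphic_on unit_disk" unfolding F_def[abs_def] by (intro holomorphic_intros df)
  have f1: "(\<lambda>x. (1 - x) * deriv f x) holomorphic_on unit_disk" by (intro holomorphic_intros df)
  have f2: "(\<lambda>x. (1 - x) * ((1 - x) * deriv f x)) holomorphic_on unit_disk" by (intro holomorphic_intros df)
  have pos: "0 \<le> Re (\<Sum>n. tcoeff F n * tcoeff P n)"
    by (rule hadamard_positivity_disk[OF F _ P R P0 ReP])
      (use half in \<open>simp_all add: F_def power2_eq_square mult.assoc\<close>)
  have R0: "0 < R" using R by simp
  have h: "hadamard f g holomorphic_on unit_disk" by (rule hadamard_holomorphic[OF f gf(1)])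
  have "(\<Sum>n. tcoeff F n * tcoeff P n) =
      (\<Sum>n. cnj w * (1 / (z * d)) * (tcoeff (\<lambda>x. (1 - x) * ((1 - x) * deriv f x)) n * tcoeff G n))"
    unfolding F_def[abs_def] P_def[abs_def] tcoeff_cmult[OF f2 zero_less_one] tcoeff_cmult[OF G R0]
    by (simp only: mult_ac)
  also have "\<dots> = cnj w * (1 / (z * d)) * (\<Sum>n. tcoeff (\<lambda>x. (1 - x) * ((1 - x) * deriv f x)) n * tcoeff G n)"
    using summable_tcoeff_shift[OF f2 G R, of 0] by (intro suminf_mult) simp
  also have "(\<Sum>n. tcoeff (\<lambda>x. (1 - x) * ((1 - x) * deriv f x)) n * tcoeff G n)
      = (\<Sum>n. tcoeff (\<lambda>x. (1 - x) * deriv f x) n * tcoeff E n)"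
    by (simp only: tcoeff_sum_by_parts[OF f1 G R] rec_G)
  also have "\<dots> = (\<Sum>n. tcoeff (deriv f) n * tcoeff \<psi> (Suc n))"
    by (simp only: tcoeff_sum_by_parts[OF df E R] rec_E)
  also have "\<dots> = (\<Sum>n. z * (tcoeff (deriv (hadamard f g)) n * z ^ n))"
  proof -
    have "tcoeff \<psi> n = tcoeff g n * z ^ n" for n
      using tcoeff_scale[OF gf(1) zero_less_one z(2), of n] by (simp add: \<psi>_def[abs_def] mult.commute)
    then show ?thesis by (simp only: tcoeff_deriv tcoeff_hadamard[OF f gf(1)] power_Suc mult_ac)
  qed
  also have "\<dots> = z * deriv (hadamard f g) z"
    using sums_mult[OF tcoeff_sums[OF holomorphic_deriv[OF h open_ball] z(1)], of z] by (simp add: sums_iff)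
  finally have "(\<Sum>n. tcoeff F n * tcoeff P n) = cnj w * (deriv (hadamard f g) z / d)"
    using z d by simp
  with pos show ?thesis by (simp only: d_def)
qed

section \<open>Growth in the directions of the dual cone\<close>

text \<open>
  Up to a multiple of \<open>F 0\<close>, the value \<open>F z\<close> is a coefficient sum of \<open>F\<close> against a geometric series. The
  constant \<open>k\<close> is the largest for which that series, normalised by \<open>P 0 = 1\<close>, keeps \<open>Re P \<ge> 1/2\<close> on the circle.
\<close>

lemma Harnack_lower:
  assumes F: "F holomorphic_on unit_disk" and ReF: "\<And>z. z \<in> unit_disk \<Longrightarrow> 0 \<le> Re (F z)" and z: "norm z < 1"
  shows "(1 - norm z) / (1 + norm z) * Re (F 0) \<le> Re (F z)"
proof (cases "z = 0")
  case False
  define r where "r = norm z"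
  have r: "0 < r" "r < 1" using z False by (auto simp: r_def)
  define k where "k = (1 + r) / (2 * r)"
  have k: "0 < k" using r by (simp add: k_def)
  define P where "P x = 1 + of_real k * (1 / (1 - x * z) - 1)" for x
  define R where "R = 1 / r"
  have R: "1 < R" using r by (simp add: R_def)
  have Rz: "norm (x * z) < 1" if "norm x < R" for x
    using that r by (simp add: R_def norm_mult pos_less_divide_eq flip: r_def)
  have P: "P holomorphic_on ball 0 R" unfolding P_def[abs_def]
  proof (intro holomorphic_intros)
    fix x :: complex assume "x \<in> ball 0 R"
    then have "norm (x * z) < 1" using Rz by simp
    then show "1 - x * z \<noteq> 0" by auto
  qed
  have tP: "tcoeff P n = of_real k * z ^ n + (if n = 0 then 1 - of_real k else 0)" for n
  proof (rule tcoeff_unique[of R])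
    fix x :: complex assume "norm x < R"
    from geometric_sums[OF Rz[OF this]]
    have "(\<lambda>n. of_real k * (x * z) ^ n) sums (of_real k * (1 / (1 - x * z)))" by (rule sums_mult)
    from sums_add[OF this sums_single[of 0 "\<lambda>_. 1 - of_real k"]]
    have "(\<lambda>n. of_real k * (x * z) ^ n + (if n = 0 then 1 - of_real k else 0)) sums P x"
      by (simp add: P_def algebra_simps)
    moreover have "of_real k * (x * z) ^ n + (if n = 0 then 1 - of_real k else 0)
        = (of_real k * z ^ n + (if n = 0 then 1 - of_real k else 0)) * x ^ n" for n
      by (simp add: power_mult_distrib ring_distribs)
    ultimately show "(\<lambda>n. (of_real k * z ^ n + (if n = 0 then 1 - of_real k else 0)) * x ^ n) sums P x"
      by simp
  qed (use R in simp)
  have "0 \<le> Re (\<Sum>n. tcoeff F n * tcoeff P n)"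
  proof (rule hadamard_positivity_disk[OF F ReF P R])
    show "P 0 = 1" by (simp add: P_def)
    fix x :: complex assume x: "norm x = 1"
    define v where "v = x * z"
    have v: "norm v = r" using x by (simp add: v_def norm_mult r_def)
    have vn: "(Re v)\<^sup>2 + (Im v)\<^sup>2 = r\<^sup>2" using cmod_power2[of v] v by simp
    have n: "(norm (1 - v))\<^sup>2 = 1 - 2 * Re v + r\<^sup>2"
      using vn unfolding cmod_power2 by (simp add: power2_eq_square algebra_simps)
    have nz: "0 < (norm (1 - v))\<^sup>2" using v r by auto
    have "- r \<le> Re v" using abs_Re_le_cmod[of v] v by linarith
    then have "0 \<le> (1 - r) * (r + Re v)" using r by simp
    also have "\<dots> = (1 + r) * (1 - Re v) - (norm (1 - v))\<^sup>2"
      unfolding n by (simp add: power2_eq_square algebra_simps)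
    finally have "1 / (1 + r) \<le> (1 - Re v) / (norm (1 - v))\<^sup>2"
      using nz r by (simp add: divide_le_eq le_divide_eq mult.commute)
    also have "\<dots> = Re (1 / (1 - v))" unfolding Re_divide cmod_power2 by simp
    finally have "k * (1 / (1 + r) - 1) \<le> k * (Re (1 / (1 - v)) - 1)"
      using k by (intro mult_left_mono) auto
    moreover have "k * (1 / (1 + r) - 1) = - (1 / 2)"
    proof -
      have "1 / (1 + r) - 1 = - r / (1 + r)" using r by (simp add: field_simps)
      then show ?thesis using r by (simp add: k_def)
    qed
    moreover have "Re (P x) = 1 + k * (Re (1 / (1 - v)) - 1)"
      unfolding P_def v_def by (simp only: plus_complex.sel times_complex.sel minus_complex.sel Re_complex_of_real
          Im_complex_of_real one_complex.sel mult_zero_left diff_zero)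
    ultimately show "1 / 2 \<le> Re (P x)" by linarith
  qed
  also have "(\<Sum>n. tcoeff F n * tcoeff P n) = of_real k * F z + F 0 * (1 - of_real k)"
  proof -
    have "(\<lambda>n. of_real k * (tcoeff F n * z ^ n) + (if n = 0 then F 0 * (1 - of_real k) else 0))
        sums (of_real k * F z + F 0 * (1 - of_real k))"
      using sums_add[OF sums_mult[OF tcoeff_sums[OF F z], of "of_real k"] sums_single[of 0 "\<lambda>_. F 0 * (1 - of_real k)"]] .
    moreover have "tcoeff F n * tcoeff P n = of_real k * (tcoeff F n * z ^ n) + (if n = 0 then F 0 * (1 - of_real k) else 0)" for n
      by (simp add: tP algebra_simps)
    ultimately show ?thesis by (simp add: sums_iff)
  qed
  finally have "(k - 1) * Re (F 0) \<le> k * Re (F z)" by (simp add: algebra_simps)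
  then have "(k - 1) / k * Re (F 0) \<le> Re (F z)" using k by (simp add: divide_le_eq mult.commute)
  moreover have "(k - 1) / k = (1 - r) / (1 + r)"
  proof -
    have "k - 1 = (1 - r) / (2 * r)" using r by (simp add: k_def field_simps)
    then show ?thesis using r by (simp add: k_def)
  qed
  ultimately show ?thesis by (simp add: r_def)
qed simp

text \<open>
  In the half-plane coordinate \<open>\<zeta> = 1/(1 - z)\<close> the derivative of \<open>h\<close> is \<open>(1 - z)\<^sup>2 * deriv h z\<close>. Along the ray
  \<open>\<zeta> = 1 + x * d\<close> with \<open>d = u * cnj w\<close>, which stays in the half-plane because \<open>u \<bullet> w > 0\<close>, the derivative
  of \<open>u \<bullet> h\<close> is \<open>|u|\<^sup>2 Re F\<close> with \<open>Re F \<ge> 0\<close>. By Harnack it is at least a multiple of \<open>1/(1 + x)\<close>, so \<open>u \<bullet> h\<close> grows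
  at least like \<open>ln (1 + x)\<close>.
\<close>

lemma unbounded_in_direction_strict:
  assumes h: "h holomorphic_on unit_disk"
    and half: "\<And>z. z \<in> unit_disk \<Longrightarrow> 0 \<le> Re (cnj w * ((1 - z)\<^sup>2 * deriv h z))"
    and strict: "0 < Re (cnj w * deriv h 0)" and uw: "0 < u \<bullet> w"
  shows "\<exists>z\<in>unit_disk. c < u \<bullet> h z"
proof (rule ccontr)
  assume "\<not> ?thesis"
  then have bd: "\<And>z. z \<in> unit_disk \<Longrightarrow> u \<bullet> h z \<le> c" by (auto simp: not_less)
  have u0: "u \<noteq> 0" using uw by auto
  define d where "d = u * cnj w"
  have d: "0 < Re d" using uw by (simp add: d_def inner_complex_def)
  define F where "F z = cnj w * ((1 - z)\<^sup>2 * deriv h z)" for z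
  have dh: "deriv h holomorphic_on unit_disk" by (rule holomorphic_deriv[OF h open_ball])
  have F: "F holomorphic_on unit_disk" unfolding F_def[abs_def] by (intro holomorphic_intros dh)
  define \<zeta> where "\<zeta> x = 1 + of_real x * d" for x
  define Z where "Z x = 1 - 1 / \<zeta> x" for x
  have Re\<zeta>: "Re (\<zeta> x) = 1 + x * Re d" for x by (simp add: \<zeta>_def)
  have \<zeta>0: "\<zeta> x \<noteq> 0" if "0 \<le> x" for x
  proof -
    have "0 < Re (\<zeta> x)" using that d by (simp add: Re\<zeta> add_pos_nonneg)
    then show ?thesis by auto
  qed
  have nZ: "1 - (norm (Z x))\<^sup>2 = (1 + 2 * x * Re d) / (norm (\<zeta> x))\<^sup>2" if x: "0 \<le> x" for x
  proof -
    have "Z x = (\<zeta> x - 1) / \<zeta> x" using \<zeta>0[OF x] by (simp add: Z_def diff_divide_distrib)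
    then have "(norm (Z x))\<^sup>2 = (norm (\<zeta> x - 1))\<^sup>2 / (norm (\<zeta> x))\<^sup>2" by (simp add: norm_divide power_divide)
    then have "1 - (norm (Z x))\<^sup>2 = ((norm (\<zeta> x))\<^sup>2 - (norm (\<zeta> x - 1))\<^sup>2) / (norm (\<zeta> x))\<^sup>2"
      using \<zeta>0[OF x] by (simp add: diff_divide_distrib)
    also have "(norm (\<zeta> x))\<^sup>2 - (norm (\<zeta> x - 1))\<^sup>2 = 2 * Re (\<zeta> x) - 1"
      unfolding cmod_power2 by (simp add: power2_eq_square algebra_simps)
    finally show ?thesis by (simp add: Re\<zeta>)
  qed
  have Z1: "norm (Z x) < 1" if x: "0 \<le> x" for x
  proof -
    have "0 < 1 - (norm (Z x))\<^sup>2" unfolding nZ[OF x]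
      using x d \<zeta>0[OF x] by (intro divide_pos_pos add_pos_nonneg) auto
    then show ?thesis by (simp add: abs_square_less_1)
  qed
  \<comment> \<open>From 1 + 2 * x * Re d \<ge> min 1 (2 * Re d) * (1 + x) and |\<zeta> x| \<le> (1 + norm d) * (1 + x).\<close>
  define \<kappa> where "\<kappa> = min 1 (2 * Re d) / (1 + norm d)\<^sup>2"
  have \<kappa>: "0 < \<kappa>" using d norm_ge_zero[of d] unfolding \<kappa>_def by (intro divide_pos_pos zero_less_power add_pos_nonneg) auto
  have lowZ: "\<kappa> / (1 + x) \<le> 1 - (norm (Z x))\<^sup>2" if x: "0 \<le> x" for x
  proof -
    have "norm (\<zeta> x) \<le> 1 + x * norm d"
      using norm_triangle_ineq[of 1 "of_real x * d"] x by (simp add: \<zeta>_def norm_mult)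
    also have "\<dots> \<le> (1 + norm d) * (1 + x)" using x norm_ge_zero[of d] by (simp add: algebra_simps)
    finally have "(norm (\<zeta> x))\<^sup>2 \<le> ((1 + norm d) * (1 + x))\<^sup>2" by (intro power_mono) auto
    moreover have "min 1 (2 * Re d) * (1 + x) \<le> 1 + 2 * x * Re d"
    proof -
      have "min 1 (2 * Re d) * x \<le> 2 * Re d * x" using x by (intro mult_right_mono) auto
      then show ?thesis by (simp add: algebra_simps)
    qed
    ultimately have "min 1 (2 * Re d) * (1 + x) / ((1 + norm d) * (1 + x))\<^sup>2 \<le> (1 + 2 * x * Re d) / (norm (\<zeta> x))\<^sup>2"
      using \<zeta>0[OF x] d x by (intro frac_le) auto
    moreover have "min 1 (2 * Re d) * (1 + x) / ((1 + norm d) * (1 + x))\<^sup>2 = \<kappa> / (1 + x)"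
      using x norm_ge_zero[of d] unfolding \<kappa>_def power_mult_distrib
      by (simp add: power2_eq_square)
    ultimately show ?thesis unfolding nZ[OF x] by simp
  qed
  define C where "C = (norm u)\<^sup>2 * (Re (F 0) * (\<kappa> / 4))"
  have F0: "0 < Re (F 0)" using strict by (simp add: F_def)
  have C: "0 < C" using u0 F0 \<kappa> unfolding C_def by (intro mult_pos_pos) auto
  have lowF: "C / (1 + x) \<le> (norm u)\<^sup>2 * Re (F (Z x))" if x: "0 \<le> x" for x
  proof -
    define r where "r = norm (Z x)"
    have r: "0 \<le> r" "r < 1" using Z1[OF x] by (auto simp: r_def)
    have "(1 - r\<^sup>2) / 4 \<le> (1 - r) / (1 + r)"
    proof -
      have "(1 + r)\<^sup>2 \<le> 2\<^sup>2" using r by (intro power_mono) auto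
      then have "(1 - r) * (1 + r)\<^sup>2 \<le> (1 - r) * 4" using r by (intro mult_left_mono) auto
      then have "(1 - r\<^sup>2) * (1 + r) \<le> (1 - r) * 4" by (simp add: power2_eq_square algebra_simps)
      then have "(1 - r\<^sup>2) / 4 * (1 + r) \<le> 1 - r" by simp
      then show ?thesis using r by (subst pos_le_divide_eq) auto
    qed
    moreover have "\<kappa> / (1 + x) / 4 \<le> (1 - r\<^sup>2) / 4"
      using lowZ[OF x] unfolding r_def by (rule divide_right_mono) simp
    ultimately have "\<kappa> / (1 + x) / 4 \<le> (1 - r) / (1 + r)" by (rule order_trans[rotated])
    then have "\<kappa> / (1 + x) / 4 * Re (F 0) \<le> (1 - r) / (1 + r) * Re (F 0)"
      using F0 by (intro mult_right_mono) auto
    also have "\<dots> \<le> Re (F (Z x))" unfolding r_def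
      by (rule Harnack_lower[OF F _ Z1[OF x]]) (use half in \<open>simp add: F_def\<close>)
    finally have "(norm u)\<^sup>2 * (\<kappa> / (1 + x) / 4 * Re (F 0)) \<le> (norm u)\<^sup>2 * Re (F (Z x))"
      by (intro mult_left_mono) auto
    then show ?thesis by (simp add: C_def mult_ac)
  qed
  define q where "q x = u \<bullet> h (Z x) - C * ln (1 + x)" for x
  have dq: "(q has_real_derivative ((norm u)\<^sup>2 * Re (F (Z x)) - C / (1 + x))) (at x)" if x: "0 \<le> x" for x
  proof -
    have Zd: "((\<lambda>y. 1 - 1 / (1 + y * d)) has_field_derivative d / (\<zeta> x)\<^sup>2) (at (of_real x))"
      using \<zeta>0[OF x] unfolding \<zeta>_def
      by (auto intro!: derivative_eq_intros simp: power2_eq_square)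
    have "(h has_field_derivative deriv h (Z x)) (at (Z x))"
      by (rule holomorphic_derivI[OF h open_ball]) (use Z1[OF x] in simp)
    then have "((\<lambda>y. h (1 - 1 / (1 + y * d))) has_field_derivative deriv h (Z x) * (d / (\<zeta> x)\<^sup>2)) (at (of_real x))"
      unfolding Z_def \<zeta>_def by (rule DERIV_chain2) (use Zd in \<open>simp add: \<zeta>_def\<close>)
    from has_vector_derivative_real_field[OF this, of UNIV]
    have "((\<lambda>y. h (Z y)) has_vector_derivative deriv h (Z x) * (d / (\<zeta> x)\<^sup>2)) (at x)"
      by (simp add: Z_def[abs_def] \<zeta>_def[abs_def])
    from bounded_linear.has_vector_derivative[OF bounded_linear_inner_right this, of u]
    have "((\<lambda>y. u \<bullet> h (Z y)) has_real_derivative u \<bullet> (deriv h (Z x) * (d / (\<zeta> x)\<^sup>2))) (at x)"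
      by (simp add: has_real_derivative_iff_has_vector_derivative)
    moreover have "u \<bullet> (deriv h (Z x) * (d / (\<zeta> x)\<^sup>2)) = (norm u)\<^sup>2 * Re (F (Z x))"
    proof -
      have "1 - Z x = 1 / \<zeta> x" by (simp add: Z_def)
      then have e: "cnj u * (deriv h (Z x) * (d / (\<zeta> x)\<^sup>2)) = of_real ((norm u)\<^sup>2) * F (Z x)"
        unfolding complex_norm_square F_def d_def by (simp add: power_divide)
      have "u \<bullet> v = Re (cnj u * v)" "Re (of_real c * v) = c * Re v" for v c
        by (simp_all add: inner_complex_def)
      then show ?thesis by (simp only: e)
    qed
    moreover have "((\<lambda>y. C * ln (1 + y)) has_real_derivative C / (1 + x)) (at x)"
      using x by (auto intro!: derivative_eq_intros)
    ultimately show ?thesis unfolding q_def[abs_def] by (auto intro!: derivative_intros)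
  qed
  have mono: "q 0 \<le> q x" if x: "0 \<le> x" for x
  proof (rule DERIV_nonneg_imp_nondecreasing[OF x])
    fix y assume "0 \<le> y" "y \<le> x"
    then show "\<exists>D. DERIV q y :> D \<and> 0 \<le> D"
      using dq[of y] lowF[of y] by (intro exI[of _ "(norm u)\<^sup>2 * Re (F (Z y)) - C / (1 + y)"]) auto
  qed
  define M where "M = \<bar>c - u \<bullet> h 0\<bar> / C + 1"
  define x where "x = exp M - 1"
  have M: "0 < M" using C by (auto simp: M_def intro!: add_nonneg_pos)
  have x: "0 \<le> x" using M by (simp add: x_def)
  have "q 0 \<le> q x" by (rule mono[OF x])
  then have "u \<bullet> h 0 + C * M \<le> u \<bullet> h (Z x)" by (simp add: q_def x_def Z_def \<zeta>_def)
  also have "\<dots> \<le> c" by (rule bd) (use Z1[OF x] in simp)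
  also have "C * M = \<bar>c - u \<bullet> h 0\<bar> + C" using C by (simp add: M_def field_simps)
  finally show False using C by linarith
qed

text \<open>
  If the real part vanishes at 0, the function is an imaginary constant by the open mapping theorem; tilting
  \<open>w\<close> slightly makes its real part positive without losing \<open>u \<bullet> w > 0\<close>.
\<close>

proposition unbounded_in_direction:
  assumes h: "h holomorphic_on unit_disk"
    and half: "\<And>z. z \<in> unit_disk \<Longrightarrow> 0 \<le> Re (cnj w * ((1 - z)\<^sup>2 * deriv h z))"
    and h0: "deriv h 0 \<noteq> 0" and uw: "0 < u \<bullet> w"
  shows "\<exists>z\<in>unit_disk. c < u \<bullet> h z"
proof (cases "0 < Re (cnj w * deriv h 0)")
  case True
  show ?thesis by (rule unbounded_in_direction_strict[OF h half True uw])
next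
  case False
  define F where "F z = cnj w * ((1 - z)\<^sup>2 * deriv h z)" for z
  have dh: "deriv h holomorphic_on unit_disk" by (rule holomorphic_deriv[OF h open_ball])
  have F: "F holomorphic_on unit_disk" unfolding F_def[abs_def] by (intro holomorphic_intros dh)
  have F0: "Re (F 0) = 0" using False half[of 0] by (simp add: F_def)
  have Fc: "F constant_on unit_disk"
  proof (rule ccontr)
    assume nc: "\<not> F constant_on unit_disk"
    have "open (F ` unit_disk)"
      by (rule open_mapping_thm[OF F open_ball connected_ball open_ball subset_refl nc])
    moreover have "F 0 \<in> F ` unit_disk" by (rule imageI) simp
    ultimately obtain e where e: "0 < e" "ball (F 0) e \<subseteq> F ` unit_disk" using openE by blast
    have "F 0 - of_real (e / 2) \<in> ball (F 0) e" using e by (simp add: dist_norm)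
    then obtain z where z: "z \<in> unit_disk" "F z = F 0 - of_real (e / 2)" using e by (metis imageE subsetD)
    have "0 \<le> Re (F z)" using half[OF z(1)] by (simp add: F_def)
    then show False using z(2) F0 e by simp
  qed
  define \<kappa> where "\<kappa> = Im (F 0)"
  have F\<kappa>: "F z = \<i> * of_real \<kappa>" if "z \<in> unit_disk" for z
  proof -
    have "F z = F 0" using Fc that unfolding constant_on_def by (metis centre_in_ball zero_less_one)
    then show ?thesis using F0 by (simp add: complex_eq_iff \<kappa>_def)
  qed
  have w0: "w \<noteq> 0" using uw by auto
  have "F 0 \<noteq> 0" using w0 h0 by (simp add: F_def)
  then have \<kappa>0: "\<kappa> \<noteq> 0" using F\<kappa>[of 0] by auto
  define I where "I = \<kappa> * Im (cnj u * w)"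
  \<comment> \<open>The tilt costs u \<bullet> w at most half of its value.\<close>
  define \<delta> where "\<delta> = (u \<bullet> w) / (2 * (\<bar>I\<bar> + 1))"
  have \<delta>: "0 < \<delta>" using uw by (simp add: \<delta>_def)
  have dI: "\<delta> * I < u \<bullet> w"
  proof -
    have "\<delta> * I \<le> \<delta> * (\<bar>I\<bar> + 1)" using \<delta> by (intro mult_left_mono) auto
    also have "\<dots> = (u \<bullet> w) / 2" by (simp add: \<delta>_def field_simps)
    finally show ?thesis using uw by simp
  qed
  define w' where "w' = w * (1 + \<i> * of_real (\<delta> * \<kappa>))"
  have e: "cnj w' * ((1 - z)\<^sup>2 * deriv h z) = \<i> * of_real \<kappa> + of_real (\<delta> * \<kappa>\<^sup>2)" if "z \<in> unit_disk" for z
  proof -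
    have "cnj w' * ((1 - z)\<^sup>2 * deriv h z) = (1 - \<i> * of_real (\<delta> * \<kappa>)) * F z"
      by (simp add: w'_def F_def)
    also have "\<dots> = \<i> * of_real \<kappa> + of_real (\<delta> * \<kappa>\<^sup>2)"
      unfolding F\<kappa>[OF that] by (simp add: power2_eq_square algebra_simps)
    finally show ?thesis .
  qed
  have p: "0 < \<delta> * \<kappa>\<^sup>2" using \<delta> \<kappa>0 by simp
  show ?thesis
  proof (rule unbounded_in_direction_strict[OF h, of w'])
    show "0 \<le> Re (cnj w' * ((1 - z)\<^sup>2 * deriv h z))" if "z \<in> unit_disk" for z
      unfolding e[OF that] using p by simp
    show "0 < Re (cnj w' * deriv h 0)" using e[of 0] p by simp
    have "u \<bullet> w' = u \<bullet> w - \<delta> * I" by (simp add: w'_def I_def inner_complex_def algebra_simps)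
    then show "0 < u \<bullet> w'" using dI by simp
  qed
qed

section \<open>The angle at infinity of a convolution\<close>

lemma rotate_disk: "norm \<tau> = 1 \<Longrightarrow> (\<lambda>x. \<tau> * x) ` unit_disk = (unit_disk :: complex set)"
proof (intro equalityI subsetI)
  fix x :: complex assume t: "norm \<tau> = 1" and x: "x \<in> unit_disk"
  then have "\<tau> \<noteq> 0" by auto
  then show "x \<in> (\<lambda>x. \<tau> * x) ` unit_disk"
    using t x by (intro image_eqI[of _ _ "x / \<tau>"]) (auto simp: norm_divide)
qed (auto simp: norm_mult)

lemma convex_mapping_rotate:
  assumes g: "convex_mapping g" and \<tau>: "norm \<tau> = 1"
  shows "convex_mapping (\<lambda>x. g (\<tau> * x))"
proof -
  note gf = convex_mapping_facts[OF g]
  have im: "(\<lambda>x. g (\<tau> * x)) ` unit_disk = g ` unit_disk"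
    using rotate_disk[OF \<tau>] by (metis image_image)
  have "(\<lambda>x. g (\<tau> * x)) holomorphic_on unit_disk"
    by (rule holomorphic_on_compose_gen[of "\<lambda>x. \<tau> * x" _ g, unfolded o_def, OF _ gf(1)])
      (use rotate_disk[OF \<tau>] in \<open>auto intro!: holomorphic_intros\<close>)
  moreover have "inj_on (\<lambda>x. g (\<tau> * x)) unit_disk"
  proof (rule inj_onI)
    fix x y assume xy: "x \<in> unit_disk" "y \<in> unit_disk" and eq: "g (\<tau> * x) = g (\<tau> * y)"
    have "\<tau> * x = \<tau> * y" by (rule inj_onD[OF gf(2) eq]) (use xy \<tau> in \<open>auto simp: norm_mult\<close>)
    moreover have "\<tau> \<noteq> 0" using \<tau> by auto
    ultimately show "x = y" by simp
  qed
  ultimately show ?thesis unfolding convex_mapping_def im using gf(4) by blast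
qed

lemma hadamard_rotate_image:
  assumes f: "f holomorphic_on unit_disk" and g: "g holomorphic_on unit_disk"
    and \<sigma>: "norm \<sigma> = 1" and \<tau>: "norm \<tau> = 1"
  shows "hadamard (\<lambda>x. f (\<sigma> * x)) (\<lambda>x. g (\<tau> * x)) ` unit_disk = hadamard f g ` unit_disk"
proof -
  have nz: "\<sigma> \<noteq> 0" "\<tau> \<noteq> 0" using \<sigma> \<tau> by auto
  have "hadamard (\<lambda>x. f (\<sigma> * x)) (\<lambda>x. g (\<tau> * x)) z = hadamard f g ((\<sigma> * \<tau>) * z)" for z
    unfolding hadamard_def tcoeff_scale[OF f zero_less_one nz(1)] tcoeff_scale[OF g zero_less_one nz(2)]
    by (simp add: power_mult_distrib mult_ac)
  then have "hadamard (\<lambda>x. f (\<sigma> * x)) (\<lambda>x. g (\<tau> * x)) ` unit_disk = hadamard f g ` ((\<lambda>x. (\<sigma> * \<tau>) * x) ` unit_disk)"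
    by (simp add: image_image)
  also have "(\<lambda>x. (\<sigma> * \<tau>) * x) ` unit_disk = unit_disk"
    by (rule rotate_disk) (use \<sigma> \<tau> in \<open>simp add: norm_mult\<close>)
  finally show ?thesis .
qed

text \<open>
  The dual cone of an arc. Besides the interior directions of the arc, where the inequality is available,
  the midpoint is included so that the case \<open>\<delta> = 0\<close> of a single direction is covered.
\<close>

lemma polar_of_arc:
  assumes \<delta>: "0 \<le> \<delta>" "\<delta> \<le> pi / 2"
    and half: "\<And>s. \<bar>s - m\<bar> < \<delta> \<or> s = m \<Longrightarrow> 0 \<le> Re (cis (- s) * k)"
  obtains \<kappa> where "k = of_real (norm k) * cis \<kappa>" "\<bar>\<kappa> - m\<bar> \<le> pi / 2 - \<delta>"
proof (cases "k = 0")
  case True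
  then show thesis using that[of m] \<delta> by simp
next
  case False
  define A where "A = Arg (cis (- m) * k)"
  have "cis (- m) * k = of_real (norm k) * cis A"
    using Arg_decomp[of "cis (- m) * k"] by (simp add: A_def norm_mult)
  then have "cis m * (cis (- m) * k) = of_real (norm k) * cis (m + A)" by (simp add: cis_mult mult.left_commute)
  then have k: "k = of_real (norm k) * cis (m + A)" by (simp add: mult.assoc[symmetric] cis_mult)
  have A: "- pi < A" "A \<le> pi" using Arg_bounded[of "cis (- m) * k"] by (auto simp: A_def)
  have cosA: "0 \<le> cos (m + A - s)" if "\<bar>s - m\<bar> < \<delta> \<or> s = m" for s
  proof -
    have "cis (- s) * k = of_real (norm k) * cis (m + A - s)"
      by (subst k) (simp add: cis_mult mult.left_commute)
    then have "Re (cis (- s) * k) = norm k * cos (m + A - s)" by simp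
    then show ?thesis using half[OF that] False by (simp add: zero_le_mult_iff)
  qed
  have cneg: "cos x < 0" if "pi / 2 < x" "x < 3 * pi / 2" for x
    using that cos_gt_zero_pi[of "x - pi"] by (simp add: cos_diff)
  have A2: "\<bar>A\<bar> \<le> pi / 2"
  proof (rule ccontr)
    assume "\<not> \<bar>A\<bar> \<le> pi / 2"
    then have "cos \<bar>A\<bar> < 0" using A pi_gt_zero by (intro cneg) linarith+
    then show False using cosA[of m] by simp
  qed
  have "\<bar>A\<bar> \<le> pi / 2 - \<delta>"
  proof (rule ccontr)
    assume "\<not> ?thesis"
    then have lt: "pi / 2 - \<bar>A\<bar> < \<delta>" by linarith
    obtain \<epsilon> where e: "pi / 2 - \<bar>A\<bar> < \<epsilon>" "\<epsilon> < \<delta>" using dense[OF lt] by blast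
    have e0: "0 \<le> \<epsilon>" using e A2 by linarith
    have neg: "cos (\<bar>A\<bar> + \<epsilon>) < 0" using e A2 \<delta> pi_gt_zero by (intro cneg) linarith+
    show False
    proof (cases "0 \<le> A")
      case True
      then show False using cosA[of "m - \<epsilon>"] e e0 neg by simp
    next
      case False
      then have "\<bar>A\<bar> + \<epsilon> = - (A - \<epsilon>)" by simp
      then have "cos (A - \<epsilon>) < 0" using neg by (metis cos_minus)
      then show False using cosA[of "m + \<epsilon>"] e e0 by simp
    qed
  qed
  then show thesis using that[OF k] by simp
qed

lemma wedge_of_angle_less:
  assumes ne: "\<exists>\<phi>. in_wedge \<Omega> \<phi> pi" and lt: "angle_at_infinity \<Omega> < x" and x: "x \<le> pi"
  shows "\<exists>\<theta> \<phi>. 0 \<le> \<theta> \<and> \<theta> < x \<and> in_wedge \<Omega> \<phi> \<theta>"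
proof -
  have "{\<theta>. \<exists>S. sector_of_angle \<theta> S \<and> \<Omega> \<subseteq> S} \<noteq> {}"
    using ne in_wedge_imp_sector[of \<Omega> _ pi] by fastforce
  from cInf_lessD[OF this lt[unfolded angle_at_infinity_def]]
  obtain \<theta> S where S: "sector_of_angle \<theta> S" "\<Omega> \<subseteq> S" and th: "\<theta> < x" by blast
  have "0 \<le> \<theta>" using S(1) by (auto simp: sector_of_angle_def)
  moreover have "\<exists>\<phi>. in_wedge \<Omega> \<phi> \<theta>" by (rule sector_imp_in_wedge[OF S]) (use th x in simp)
  ultimately show ?thesis using th by blast
qed

text \<open>
  Both wedges being strips is the only case in which the four half-planes may leave a strip.
\<close>

lemma hadamard_bounded:
  assumes f: "f holomorphic_on unit_disk" and g: "g holomorphic_on unit_disk"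
    and wf: "in_wedge (f ` unit_disk) \<phi> \<theta>" and wg: "in_wedge (g ` unit_disk) \<psi> \<eta>"
    and \<theta>: "0 \<le> \<theta>" and \<eta>: "0 \<le> \<eta>" and lt: "\<theta> + \<eta> < pi"
  shows "bounded (hadamard f g ` unit_disk)"
proof (cases "\<theta> = 0 \<and> \<eta> = 0")
  case False
  show ?thesis
    by (rule bounded_of_wedges[OF hadamard_in_wedge[OF f g wf wg] \<theta> \<eta> lt]) (use False in blast)
next
  case True
  have strip: "\<exists>l M. l \<noteq> 0 \<and> (\<forall>z\<in>unit_disk. \<bar>Re (l * k z)\<bar> \<le> M)" if w: "in_wedge (k ` unit_disk) \<xi> 0" for k \<xi>
  proof -
    obtain c d where cd: "\<And>z. z \<in> unit_disk \<Longrightarrow> c \<le> Im (cis (- \<xi>) * k z) \<and> Im (cis (- \<xi>) * k z) \<le> d"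
      using w unfolding in_wedge_def diff_zero by blast
    have "Re (- \<i> * cis (- \<xi>) * v) = Im (cis (- \<xi>) * v)" for v by (simp add: mult.assoc)
    then have "\<bar>Re (- \<i> * cis (- \<xi>) * k z)\<bar> \<le> \<bar>c\<bar> + \<bar>d\<bar>" if "z \<in> unit_disk" for z
      using cd[OF that] by (simp only:) linarith
    then show ?thesis by (intro exI[of _ "- \<i> * cis (- \<xi>)"] exI[of _ "\<bar>c\<bar> + \<bar>d\<bar>"]) auto
  qed
  obtain l M where l: "l \<noteq> 0" "\<And>z. z \<in> unit_disk \<Longrightarrow> \<bar>Re (l * f z)\<bar> \<le> M" using strip wf True by metis
  obtain m N where m: "m \<noteq> 0" "\<And>z. z \<in> unit_disk \<Longrightarrow> \<bar>Re (m * g z)\<bar> \<le> N" using strip wg True by metis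
  show ?thesis by (rule hadamard_bounded_of_strips[OF f l g m])
qed

text \<open>
  Rotations of the two mappings move both Wolff points to 1 and change neither the three images nor the
  recession directions. Then \<open>h'/f2'\<close> and \<open>(1 - z)\<^sup>2 f2'\<close> lie in the dual cones of the two arcs, so the argument of
  their product stays within \<open>\<pi> - \<delta>1 - \<delta>2\<close> of \<open>m1 + m2\<close>, that is, within \<open>\<pi>/2\<close> of every admissible \<open>t\<close>.
\<close>

proposition hadamard_unbounded_directions:
  assumes g1: "convex_mapping g\<^sub>1" and g2: "convex_mapping g\<^sub>2"
    and r1: "\<And>s. s \<in> {a\<^sub>1..a\<^sub>1 + pi * \<alpha>} \<Longrightarrow> recedes (g\<^sub>1 ` unit_disk) (cis s)"
    and r2: "\<And>s. s \<in> {a\<^sub>2..a\<^sub>2 + pi * \<beta>} \<Longrightarrow> recedes (g\<^sub>2 ` unit_disk) (cis s)"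
    and \<alpha>: "0 \<le> \<alpha>" "\<alpha> \<le> 1" and \<beta>: "0 \<le> \<beta>" "\<beta> \<le> 1"
    and t: "a\<^sub>1 + a\<^sub>2 + pi / 2 \<le> t" "t \<le> a\<^sub>1 + a\<^sub>2 + pi * (\<alpha> + \<beta>) - pi / 2"
    and u: "0 < u \<bullet> cis t"
  shows "\<exists>v\<in>hadamard g\<^sub>1 g\<^sub>2 ` unit_disk. c < u \<bullet> v"
proof -
  \<comment> \<open>The midpoint of the arc serves as the functional l; its angle with the directions in the open arc is acute,
    while for an arc of length \<pi> the end directions are orthogonal to it.\<close>
  have direct: "\<exists>\<tau>. norm \<tau> = 1 \<and> (\<forall>s z. (\<bar>s - (a + pi * \<gamma> / 2)\<bar> < pi * \<gamma> / 2 \<or> s = a + pi * \<gamma> / 2) \<longrightarrow> z \<in> unit_disk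
      \<longrightarrow> 0 \<le> Re (cnj (cis s) * ((1 - z)\<^sup>2 * deriv (\<lambda>x. g (\<tau> * x)) z)))"
    if g: "convex_mapping g" and r: "\<And>s. s \<in> {a..a + pi * \<gamma>} \<Longrightarrow> recedes (g ` unit_disk) (cis s)"
      and \<gamma>: "0 \<le> \<gamma>" "\<gamma> \<le> 1" for g a \<gamma>
  proof -
    define m where "m = a + pi * \<gamma> / 2"
    have g0: "0 \<le> pi * \<gamma>" "pi * \<gamma> \<le> pi" using \<gamma> by simp_all
    have P: "recedes (g ` unit_disk) (cis s) \<and> 0 < cis m \<bullet> cis s" if s: "\<bar>s - m\<bar> < pi * \<gamma> / 2 \<or> s = m" for s
    proof
      have "a \<le> s" "s \<le> a + pi * \<gamma>" using s g0(1) unfolding m_def by linarith+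
      then show "recedes (g ` unit_disk) (cis s)" by (intro r) simp
      have "0 < cos (s - m)" using s g0 pi_gt_zero by (intro cos_gt_zero_pi) linarith+
      then show "0 < cis m \<bullet> cis s" by (simp only: inner_cis(2))
    qed
    obtain \<tau> where "norm \<tau> = 1" "\<And>w z. recedes (g ` unit_disk) w \<Longrightarrow> 0 < cis m \<bullet> w \<Longrightarrow> z \<in> unit_disk \<Longrightarrow>
       0 \<le> Re (cnj w * ((1 - z)\<^sup>2 * deriv (\<lambda>x. g (\<tau> * x)) z))"
      using recession_angle_condition[OF g, of "cis m" "cis m"] P[of m] by blast
    then show ?thesis using P unfolding m_def by blast
  qed
  define m1 m2 \<delta>1 \<delta>2 where "m1 = a\<^sub>1 + pi * \<alpha> / 2" and "m2 = a\<^sub>2 + pi * \<beta> / 2"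
    and "\<delta>1 = pi * \<alpha> / 2" and "\<delta>2 = pi * \<beta> / 2"
  have \<delta>: "0 \<le> \<delta>1" "\<delta>1 \<le> pi / 2" "0 \<le> \<delta>2" "\<delta>2 \<le> pi / 2"
    using \<alpha> \<beta> by (simp_all add: \<delta>1_def \<delta>2_def)
  obtain \<sigma> where \<sigma>: "norm \<sigma> = 1" and h1: "\<And>s z. \<bar>s - m1\<bar> < \<delta>1 \<or> s = m1 \<Longrightarrow> z \<in> unit_disk \<Longrightarrow>
      0 \<le> Re (cnj (cis s) * ((1 - z)\<^sup>2 * deriv (\<lambda>x. g\<^sub>1 (\<sigma> * x)) z))"
    using direct[OF g1 r1 \<alpha>] unfolding m1_def \<delta>1_def by blast
  obtain \<tau> where \<tau>: "norm \<tau> = 1" and h2: "\<And>s z. \<bar>s - m2\<bar> < \<delta>2 \<or> s = m2 \<Longrightarrow> z \<in> unit_disk \<Longrightarrow>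
      0 \<le> Re (cnj (cis s) * ((1 - z)\<^sup>2 * deriv (\<lambda>x. g\<^sub>2 (\<tau> * x)) z))"
    using direct[OF g2 r2 \<beta>] unfolding m2_def \<delta>2_def by blast
  define f1 f2 where "f1 x = g\<^sub>1 (\<sigma> * x)" and "f2 x = g\<^sub>2 (\<tau> * x)" for x
  have cf1: "convex_mapping f1" and cf2: "convex_mapping f2"
    using convex_mapping_rotate[OF g1 \<sigma>] convex_mapping_rotate[OF g2 \<tau>] by (simp_all add: f1_def[abs_def] f2_def[abs_def])
  note F1 = convex_mapping_facts[OF cf1] and F2 = convex_mapping_facts[OF cf2]
  define h where "h = hadamard f1 f2"
  have him: "hadamard g\<^sub>1 g\<^sub>2 ` unit_disk = h ` unit_disk"
    unfolding h_def f1_def[abs_def] f2_def[abs_def]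
    by (rule hadamard_rotate_image[symmetric]) (use convex_mapping_facts(1) g1 g2 \<sigma> \<tau> in auto)
  have h: "h holomorphic_on unit_disk" unfolding h_def by (rule hadamard_holomorphic[OF F1(1) F2(1)])
  have h0: "deriv h 0 = deriv f1 0 * deriv f2 0"
    using tcoeff_hadamard[OF F1(1) F2(1), of "Suc 0"] by (simp add: h_def)
  have h1': "\<And>s z. \<bar>s - m1\<bar> < \<delta>1 \<or> s = m1 \<Longrightarrow> z \<in> unit_disk \<Longrightarrow> 0 \<le> Re (cnj (cis s) * ((1 - z)\<^sup>2 * deriv f1 z))"
    using h1 by (simp add: f1_def[abs_def])
  have h2': "\<And>s z. \<bar>s - m2\<bar> < \<delta>2 \<or> s = m2 \<Longrightarrow> z \<in> unit_disk \<Longrightarrow> 0 \<le> Re (cnj (cis s) * ((1 - z)\<^sup>2 * deriv f2 z))"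
    using h2 by (simp add: f2_def[abs_def])
  have quot: "0 \<le> Re (cnj (cis s) * (deriv h z / deriv f2 z))"
    if s: "\<bar>s - m1\<bar> < \<delta>1 \<or> s = m1" and z: "z \<in> unit_disk" for s z
  proof (cases "z = 0")
    case True
    have "deriv f2 0 \<noteq> 0" by (rule F2(5)) simp
    then show ?thesis using h1'[OF s, of 0] by (simp add: True h0)
  next
    case False
    then show ?thesis unfolding h_def
      by (intro convolution_derivative_halfplane[OF F1(1) cf2]) (use h1'[OF s] z in auto)
  qed
  have dual: "0 \<le> Re (cnj (cis t) * ((1 - z)\<^sup>2 * deriv h z))" if z: "z \<in> unit_disk" for z
  proof -
    obtain \<kappa>1 where k1: "deriv h z / deriv f2 z = of_real (norm (deriv h z / deriv f2 z)) * cis \<kappa>1"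
        and b1: "\<bar>\<kappa>1 - m1\<bar> \<le> pi / 2 - \<delta>1"
      using polar_of_arc[OF \<delta>(1,2), of m1 "deriv h z / deriv f2 z"] quot z by (metis cis_cnj)
    obtain \<kappa>2 where k2: "(1 - z)\<^sup>2 * deriv f2 z = of_real (norm ((1 - z)\<^sup>2 * deriv f2 z)) * cis \<kappa>2"
        and b2: "\<bar>\<kappa>2 - m2\<bar> \<le> pi / 2 - \<delta>2"
      using polar_of_arc[OF \<delta>(3,4), of m2 "(1 - z)\<^sup>2 * deriv f2 z"] h2' z by (metis cis_cnj)
    define \<rho> where "\<rho> = norm (deriv h z / deriv f2 z) * norm ((1 - z)\<^sup>2 * deriv f2 z)"
    have "(1 - z)\<^sup>2 * deriv h z = (deriv h z / deriv f2 z) * ((1 - z)\<^sup>2 * deriv f2 z)"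
      using F2(5)[OF z] by simp
    also have "\<dots> = (of_real (norm (deriv h z / deriv f2 z)) * cis \<kappa>1) * (of_real (norm ((1 - z)\<^sup>2 * deriv f2 z)) * cis \<kappa>2)"
      by (rule arg_cong2[OF k1 k2])
    also have "\<dots> = of_real \<rho> * (cis \<kappa>1 * cis \<kappa>2)"
      unfolding \<rho>_def of_real_mult by (simp only: mult_ac)
    finally have "cnj (cis t) * ((1 - z)\<^sup>2 * deriv h z) = of_real \<rho> * cis (\<kappa>1 + \<kappa>2 - t)"
      by (simp add: cis_cnj cis_mult mult.left_commute)
    then have "Re (cnj (cis t) * ((1 - z)\<^sup>2 * deriv h z)) = \<rho> * cos (\<kappa>1 + \<kappa>2 - t)" by simp
    moreover have "0 \<le> cos (\<kappa>1 + \<kappa>2 - t)"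
    proof (rule cos_ge_zero)
      have e: "pi * (\<alpha> + \<beta>) = 2 * \<delta>1 + 2 * \<delta>2" "a\<^sub>1 = m1 - \<delta>1" "a\<^sub>2 = m2 - \<delta>2"
        by (simp_all add: \<delta>1_def \<delta>2_def m1_def m2_def ring_distribs)
      show "- (pi / 2) \<le> \<kappa>1 + \<kappa>2 - t" "\<kappa>1 + \<kappa>2 - t \<le> pi / 2"
        using b1 b2 t unfolding e by linarith+
    qed
    moreover have "0 \<le> \<rho>" by (simp add: \<rho>_def)
    ultimately show ?thesis by simp
  qed
  have "deriv h 0 \<noteq> 0" using h0 F1(5)[of 0] F2(5)[of 0] by simp
  from unbounded_in_direction[OF h dual this u] show ?thesis unfolding him by blast
qed

text \<open>
  The normals of the two sides of a sector are bounded above on it, so none of the directions \<open>cis t\<close> may increase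
  them: \<open>sin (t - \<phi>) \<ge> 0 \<ge> sin (t - \<phi> - \<theta>)\<close> for all \<open>t\<close> in the arc. An arc longer than \<open>\<theta>\<close> would contain both
  \<open>t\<close> and \<open>t + \<theta>\<close> for an interval of \<open>t\<close>, on which \<open>sin (t - \<phi>)\<close> would vanish.
\<close>

lemma sector_angle_ge_arc:
  assumes unb: "\<And>u t c. t \<in> {t0..t0 + \<gamma>} \<Longrightarrow> 0 < u \<bullet> cis t \<Longrightarrow> \<exists>v\<in>\<Omega>. c < u \<bullet> v"
    and \<gamma>: "\<gamma> \<le> pi" and S: "sector_of_angle \<theta> S" "\<Omega> \<subseteq> S"
  shows "\<gamma> \<le> \<theta>"
proof (rule ccontr)
  assume "\<not> \<gamma> \<le> \<theta>"
  then have lt: "\<theta> < \<gamma>" by simp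
  have th0: "0 \<le> \<theta>" using S(1) by (auto simp: sector_of_angle_def)
  obtain \<phi> where "in_wedge \<Omega> \<phi> \<theta>" using sector_imp_in_wedge[OF S] lt \<gamma> by auto
  then obtain c d where cd: "\<And>z. z \<in> \<Omega> \<Longrightarrow> c \<le> Im (cis (- \<phi>) * z)" "\<And>z. z \<in> \<Omega> \<Longrightarrow> Im (cis (- \<phi> - \<theta>) * z) \<le> d"
    unfolding in_wedge_def by blast
  have s1: "0 \<le> sin (t - \<phi>)" if t: "t \<in> {t0..t0 + \<gamma>}" for t
  proof (rule ccontr)
    assume n: "\<not> 0 \<le> sin (t - \<phi>)"
    have "cis (\<phi> - pi / 2) \<bullet> z = - Im (cis (- \<phi>) * z)" for z
      unfolding inner_cis(1) by (simp add: cos_diff sin_diff)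
    moreover have "0 < cis (\<phi> - pi / 2) \<bullet> cis t"
    proof -
      have "t - (\<phi> - pi / 2) = (t - \<phi>) + pi / 2" by simp
      then have "cis (\<phi> - pi / 2) \<bullet> cis t = - sin (t - \<phi>)"
        unfolding inner_cis(2) by (simp only: cos_add cos_pi_half sin_pi_half)
      then show ?thesis using n by simp
    qed
    ultimately show False using unb[OF t, of "cis (\<phi> - pi / 2)" "- c"] cd(1) by fastforce
  qed
  have s2: "sin (t - \<phi> - \<theta>) \<le> 0" if t: "t \<in> {t0..t0 + \<gamma>}" for t
  proof (rule ccontr)
    assume n: "\<not> sin (t - \<phi> - \<theta>) \<le> 0"
    have "cis (\<phi> + \<theta> + pi / 2) \<bullet> z = Im (cis (- \<phi> - \<theta>) * z)" for z
    proof -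
      have "cis (- (\<phi> + \<theta> + pi / 2)) = - \<i> * cis (- \<phi> - \<theta>)"
        unfolding cis_minus_pi_half[symmetric] cis_mult by (rule arg_cong[of _ _ cis]) simp
      then show ?thesis unfolding inner_cis(1) by (simp add: mult.assoc)
    qed
    moreover have "0 < cis (\<phi> + \<theta> + pi / 2) \<bullet> cis t"
    proof -
      have "t - (\<phi> + \<theta> + pi / 2) = (t - \<phi> - \<theta>) - pi / 2" by simp
      then have "cis (\<phi> + \<theta> + pi / 2) \<bullet> cis t = sin (t - \<phi> - \<theta>)"
        unfolding inner_cis(2) by (simp only: cos_diff cos_pi_half sin_pi_half)
      then show ?thesis using n by simp
    qed
    ultimately show False using unb[OF t, of "cis (\<phi> + \<theta> + pi / 2)" d] cd(2) by fastforce
  qed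
  have z: "sin (t0 + s - \<phi>) = 0" if "0 \<le> s" "s \<le> \<gamma> - \<theta>" for s
    using s1[of "t0 + s"] s2[of "t0 + s + \<theta>"] that th0 by (simp add: add.commute add_diff_eq)
  define s where "s = min (\<gamma> - \<theta>) (pi / 2)"
  have s: "0 < s" "s \<le> \<gamma> - \<theta>" "s < pi" using lt pi_gt_zero by (auto simp: s_def min_def)
  have "sin (t0 - \<phi>) = 0" using z[of 0] lt by simp
  moreover have "sin ((t0 - \<phi>) + s) = 0" using z[of s] s by (simp add: algebra_simps)
  ultimately have "cos (t0 - \<phi>) * sin s = 0" unfolding sin_add by simp
  moreover have "0 < sin s" by (rule sin_gt_zero[OF s(1,3)])
  ultimately have "cos (t0 - \<phi>) = 0" by simp
  then show False using \<open>sin (t0 - \<phi>) = 0\<close> sin_cos_squared_add[of "t0 - \<phi>"] by simp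
qed

theorem theorem3p2:
  fixes g\<^sub>1 g\<^sub>2 :: "complex \<Rightarrow> complex" and \<alpha> \<beta> :: real
  assumes "convex_mapping g\<^sub>1" and "\<not> bounded (g\<^sub>1 ` unit_disk)"
    and "convex_mapping g\<^sub>2" and "\<not> bounded (g\<^sub>2 ` unit_disk)"
    and "angle_at_infinity (g\<^sub>1 ` unit_disk) = pi * \<alpha>"
    and "angle_at_infinity (g\<^sub>2 ` unit_disk) = pi * \<beta>"
  shows "(\<alpha> + \<beta> < 1 \<longrightarrow> bounded (hadamard g\<^sub>1 g\<^sub>2 ` unit_disk)) \<and>
    (1 \<le> \<alpha> + \<beta> \<longrightarrow>
       \<not> bounded (hadamard g\<^sub>1 g\<^sub>2 ` unit_disk) \<and>
       pi * (\<alpha> + \<beta> - 1) \<le> angle_at_infinity (hadamard g\<^sub>1 g\<^sub>2 ` unit_disk) \<and>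
       (admits_minimal_sector (g\<^sub>1 ` unit_disk) \<and> admits_minimal_sector (g\<^sub>2 ` unit_disk) \<longrightarrow>
          angle_at_infinity (hadamard g\<^sub>1 g\<^sub>2 ` unit_disk) = pi * (\<alpha> + \<beta> - 1)))"
proof -
  note g1 = assms(1) and g2 = assms(3) and ang1 = assms(5) and ang2 = assms(6)
  note G1 = convex_mapping_facts[OF g1] and G2 = convex_mapping_facts[OF g2]
  note A1 = recession_arc[OF G1(3,4) assms(2) convex_mapping_not_onto[OF g1] ang1]
  note A2 = recession_arc[OF G2(3,4) assms(4) convex_mapping_not_onto[OF g2] ang2]
  let ?H = "hadamard g\<^sub>1 g\<^sub>2 ` unit_disk"
  have "bounded ?H" if ab: "\<alpha> + \<beta> < 1"
  proof -
    define e where "e = pi * (1 - \<alpha> - \<beta>) / 2"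
    have e: "0 < e" using ab by (simp add: e_def)
    have sum: "(pi * \<alpha> + e) + (pi * \<beta> + e) = pi" by (simp add: e_def field_simps)
    have nn: "0 \<le> pi * \<alpha>" "0 \<le> pi * \<beta>" using A1(1) A2(1) by simp_all
    obtain \<theta> \<phi> where w1: "0 \<le> \<theta>" "\<theta> < pi * \<alpha> + e" "in_wedge (g\<^sub>1 ` unit_disk) \<phi> \<theta>"
      using wedge_of_angle_less[OF A1(3), of "pi * \<alpha> + e"] ang1 e sum nn by auto
    obtain \<eta> \<psi> where w2: "0 \<le> \<eta>" "\<eta> < pi * \<beta> + e" "in_wedge (g\<^sub>2 ` unit_disk) \<psi> \<eta>"
      using wedge_of_angle_less[OF A2(3), of "pi * \<beta> + e"] ang2 e sum nn by auto
    show ?thesis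
      by (rule hadamard_bounded[OF G1(1) G2(1) w1(3) w2(3) w1(1) w2(1)]) (use w1(2) w2(2) sum in linarith)
  qed
  moreover have "\<not> bounded ?H \<and> pi * (\<alpha> + \<beta> - 1) \<le> angle_at_infinity ?H \<and>
      (admits_minimal_sector (g\<^sub>1 ` unit_disk) \<and> admits_minimal_sector (g\<^sub>2 ` unit_disk) \<longrightarrow>
       angle_at_infinity ?H = pi * (\<alpha> + \<beta> - 1))" if ab: "1 \<le> \<alpha> + \<beta>"
  proof -
    define \<gamma> where "\<gamma> = pi * (\<alpha> + \<beta> - 1)"
    have \<gamma>: "0 \<le> \<gamma>" "\<gamma> \<le> pi" using ab A1(2) A2(2) by (simp_all add: \<gamma>_def)
    obtain a1 where a1: "\<And>s. s \<in> {a1..a1 + pi * \<alpha>} \<Longrightarrow> recedes (g\<^sub>1 ` unit_disk) (cis s)" using A1(4) by blast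
    obtain a2 where a2: "\<And>s. s \<in> {a2..a2 + pi * \<beta>} \<Longrightarrow> recedes (g\<^sub>2 ` unit_disk) (cis s)" using A2(4) by blast
    define t0 where "t0 = a1 + a2 + pi / 2"
    have unb: "\<exists>v\<in>?H. c < u \<bullet> v" if t: "t \<in> {t0..t0 + \<gamma>}" and u: "0 < u \<bullet> cis t" for u t c
      by (rule hadamard_unbounded_directions[OF g1 g2 a1 a2 A1(1,2) A2(1,2) _ _ u])
        (use t in \<open>auto simp: t0_def \<gamma>_def algebra_simps\<close>)
    have nb: "\<not> bounded ?H"
    proof
      assume "bounded ?H"
      then obtain B where B: "\<And>v. v \<in> ?H \<Longrightarrow> norm v \<le> B" unfolding bounded_iff by blast
      have "0 < cis t0 \<bullet> cis t0" by (simp only: inner_cis(2)) simp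
      then obtain v where v: "v \<in> ?H" "B < cis t0 \<bullet> v" using unb[of t0 "cis t0" B] \<gamma>(1) by auto
      have "cis t0 \<bullet> v \<le> norm (cis t0) * norm v" by (rule norm_cauchy_schwarz)
      then show False using v B[OF v(1)] by simp
    qed
    obtain \<phi> \<psi> where half: "in_wedge (g\<^sub>1 ` unit_disk) \<phi> pi" "in_wedge (g\<^sub>2 ` unit_disk) \<psi> pi"
      using A1(3) A2(3) by blast
    have lower: "\<gamma> \<le> angle_at_infinity ?H"
      unfolding angle_at_infinity_def
    proof (rule cInf_greatest)
      have "in_wedge ?H (\<phi> + \<psi> + pi / 2) pi" using hadamard_in_wedge(1)[OF G1(1) G2(1) half] by simp
      from in_wedge_imp_sector[OF this] show "{\<theta>. \<exists>S. sector_of_angle \<theta> S \<and> ?H \<subseteq> S} \<noteq> {}" by auto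
      fix \<theta> assume "\<theta> \<in> {\<theta>. \<exists>S. sector_of_angle \<theta> S \<and> ?H \<subseteq> S}"
      then obtain S where S: "sector_of_angle \<theta> S" "?H \<subseteq> S" by blast
      show "\<gamma> \<le> \<theta>" by (rule sector_angle_ge_arc[OF _ \<gamma>(2) S]) (rule unb)
    qed
    have upper: "angle_at_infinity ?H \<le> \<gamma>"
      if min: "admits_minimal_sector (g\<^sub>1 ` unit_disk)" "admits_minimal_sector (g\<^sub>2 ` unit_disk)"
    proof -
      have "pi * \<alpha> \<le> pi" "pi * \<beta> \<le> pi" using A1(2) A2(2) by simp_all
      then obtain \<phi> \<psi> where "in_wedge (g\<^sub>1 ` unit_disk) \<phi> (pi * \<alpha>)" "in_wedge (g\<^sub>2 ` unit_disk) \<psi> (pi * \<beta>)"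
        using min sector_imp_in_wedge unfolding admits_minimal_sector_def ang1 ang2 by meson
      from hadamard_in_wedge(1)[OF G1(1) G2(1) this]
      have "in_wedge ?H (\<phi> + \<psi> + pi / 2) \<gamma>" by (simp add: \<gamma>_def algebra_simps)
      then show ?thesis by (rule angle_at_infinity_le_wedge[OF _ \<gamma>])
    qed
    show ?thesis using nb lower upper unfolding \<gamma>_def[symmetric] by (meson order_antisym)
  qed
  ultimately show ?thesis by blast
qed

end
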